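(* Let $\lambda\in\mathbb{D}\setminus\mathcal{E}$ be with $\arg\lambda\notin\pi\mathbb{Q}$, let $\Lambda$ be a finite nonempty set, let $\mathbf{a}=(a_i)_{i\in\Lambda}\in\mathbb{C}^{\Lambda}$ be such that $\mathcal{F}_{\lambda,\mathbf{a}}$ satisfies the SSC, and let $p\in\mathbb{P}_{\Lambda}$ be with $D_{2}(\nu_{\lambda,\mathbf{a}}^{p})>1$. Set $\nu=\nu_{\lambda,\mathbf{a}}^{p}$. Then there exists $\gamma>0$ such that: (1) $P_{z}\nu\in H_{\gamma}(\mathbb{R})$ for all $z\in S$; (2) $z\mapsto P_{z}\nu$ is continuous as a map from $S$ to $\left(H_{\gamma}(\mathbb{R}),\Vert\cdot\Vert_{(\gamma)}\right)$.
   Context: $\mathbb{D}=\{z\in\mathbb{C}:|z|<1\}$, $S=\{z\in\mathbb{C}:|z|=1\}$; the condition $\arg\lambda\notin\pi\mathbb{Q}$ includes $\lambda\neq0$. $\mathcal{M}(X)$ ($X=\mathbb{R}$ or $\mathbb{C}$) is the set of compactly supported Borel probability measures on $X$. $\mathbb{P}_{\Lambda}=\{(p_i)_{i\in\Lambda}\in(0,1)^{\Lambda}:\sum_{i}p_i=1\}$. $P_z:\mathbb{C}\to\mathbb{R}$ is $P_zw=\mathrm{Re}(z\overline{w})$ and $P_z\mu$ is the push-forward. Self-similar objects: $\mathcal{F}_{\lambda,\mathbf{a}}=\{f_i(w)=\lambda w+a_i\}_{i\in\Lambda}$ is an IFS on $\mathbb{C}$; $K_{\lambda,\mathbf{a}}$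 is its attractor, the unique nonempty compact set with $K_{\lambda,\mathbf{a}}=\bigcup_{i\in\Lambda}f_i(K_{\lambda,\mathbf{a}})$; $\nu_{\lambda,\mathbf{a}}^{p}\in\mathcal{M}(\mathbb{C})$ is the unique measure with $\nu_{\lambda,\mathbf{a}}^{p}=\sum_{i}p_i\cdot f_i\nu_{\lambda,\mathbf{a}}^{p}$ (push-forwards). The strong separation condition (SSC) means that the sets $f_i(K_{\lambda,\mathbf{a}})$, $i\in\Lambda$, are pairwise disjoint. Correlation dimension: $D_2(\mu)=\liminf_{\delta\downarrow0}\frac{\log\int\mu(B(x,\delta))d\mu(x)}{\log\delta}$, with $B(x,\delta)$ the closed ball. Sobolev spaces: for $\gamma\ge0$, $H_\gamma(\mathbb{R})=\{g\in L^2(\mathbb{R}):\int|\widehat{g}(\xi)|^2(1+|\xi|^2)^\gamma d\xi<\infty\}$ with norm $\Vert g\Vert_{(\gamma)}=\left(\int|\widehat{g}(\xi)|^2(1+|\xi|^2)^\gamma d\xi\right)^{1/2}$, where $\widehat{g}$ is the Fourier transform (convention $\widehat g(\xi)=\int e^{i\xi x}g(x)\,dx$). For a measure $\mu$ on $\mathbb{R}$, $\mu\in H_\gamma(\mathbb{R})$ means that $\mu$ is absolutely continuous with density in $H_\gamma(\mathbb{R})$; $\mu$ is then identified with its density. Exceptional set: for $\mu\in\mathcal{M}(\mathbb{C})$, $\widehat{\mu}(\xi)=\int e^{i\,\mathrm{Re}(\xi\overline{w})}d\mu(w)$. $\mathcal{E}'\subset\mathbb{D}$ is a fixed set with $\dim_H\mathcal{E}'=0$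 ($\dim_H$ is Hausdorff dimension; the existence of such a set is a known theorem of Shmerkin and Solomyak) such that: for every $\lambda\in\mathbb{D}\setminus(\mathcal{E}'\cup\mathbb{R})$, every finite nonempty set $\Lambda$, every $\mathbf{a}\in\mathbb{C}^\Lambda$ with not all $a_i$ equal and every $p\in\mathbb{P}_\Lambda$, there are $C,\gamma>0$ with $|\widehat{\nu_{\lambda,\mathbf{a}}^{p}}(\xi)|\le C|\xi|^{-\gamma}$ for all $0\neq\xi\in\mathbb{C}$. Then $\mathcal{E}=\bigcup_{k\ge1}\{\lambda\in\mathbb{D}:\lambda^k\in\mathcal{E}'\}$, which satisfies $\dim_H\mathcal{E}=0$. *)

theory Defs
  imports "HOL-Probability.Probability"
begin

section \<open>Hausdorff dimension\<close>

text \<open>Only exponents \<open>s > 0\<close> are used, so that the value of \<open>0 powr 0\<close> plays no role. The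
  boundedness condition is needed because \<^const>\<open>diameter\<close> is unspecified on unbounded sets.\<close>

definition hausdorff_premeasure :: "real \<Rightarrow> real \<Rightarrow> 'a::metric_space set \<Rightarrow> ennreal" where
  "hausdorff_premeasure s \<delta> A =
     (INF U \<in> {U :: nat \<Rightarrow> 'a set. A \<subseteq> (\<Union>n. U n) \<and> (\<forall>n. bounded (U n) \<and> diameter (U n) \<le> \<delta>)}.
        (\<Sum>n. ennreal (diameter (U n) powr s)))"

definition hausdorff_measure :: "real \<Rightarrow> 'a::metric_space set \<Rightarrow> ennreal" where
  "hausdorff_measure s A = (SUP \<delta> \<in> {0<..}. hausdorff_premeasure s \<delta> A)"

definition hausdorff_dim :: "'a::metric_space set \<Rightarrow> ereal" where
  "hausdorff_dim A = (INF s \<in> {s. 0 < s \<and> hausdorff_measure s A = 0}. ereal s)"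

section \<open>Measures\<close>

definition compact_prob :: "'a::topological_space measure \<Rightarrow> bool" where
  "compact_prob \<mu> \<longleftrightarrow>
     sets \<mu> = sets borel \<and> prob_space \<mu> \<and> (\<exists>K. compact K \<and> emeasure \<mu> (- K) = 0)"

definition correlation_dim :: "'a::metric_space measure \<Rightarrow> ereal" where
  "correlation_dim \<mu> =
     Liminf (at_right 0) (\<lambda>\<delta>::real. ereal (ln (LINT x|\<mu>. measure \<mu> (cball x \<delta>)) / ln \<delta>))"

definition measure_fourier :: "complex measure \<Rightarrow> complex \<Rightarrow> complex" where
  "measure_fourier \<mu> \<xi> = (LINT w|\<mu>. cis (Re (\<xi> * cnj w)))"

definition proj_measure :: "complex \<Rightarrow> complex measure \<Rightarrow> real measure" where
  "proj_measure z \<mu> = distr \<mu> borel (\<lambda>w. Re (z * cnj w))"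

section \<open>Self-similar sets and measures\<close>

definition prob_vector :: "'i set \<Rightarrow> ('i \<Rightarrow> real) \<Rightarrow> bool" where
  "prob_vector \<Lambda> p \<longleftrightarrow> (\<forall>i\<in>\<Lambda>. 0 < p i \<and> p i < 1) \<and> (\<Sum>i\<in>\<Lambda>. p i) = 1"

definition ifs_map :: "complex \<Rightarrow> ('i \<Rightarrow> complex) \<Rightarrow> 'i \<Rightarrow> complex \<Rightarrow> complex" where
  "ifs_map l a i w = l * w + a i"

definition attractor :: "complex \<Rightarrow> 'i set \<Rightarrow> ('i \<Rightarrow> complex) \<Rightarrow> complex set" where
  "attractor l \<Lambda> a =
     (THE K. K \<noteq> {} \<and> compact K \<and> K = (\<Union>i\<in>\<Lambda>. ifs_map l a i ` K))"

definition strong_separation :: "complex \<Rightarrow> 'i set \<Rightarrow> ('i \<Rightarrow> complex) \<Rightarrow> bool" where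
  "strong_separation l \<Lambda> a \<longleftrightarrow> disjoint_family_on (\<lambda>i. ifs_map l a i ` attractor l \<Lambda> a) \<Lambda>"

definition self_similar_measure ::
  "complex \<Rightarrow> 'i set \<Rightarrow> ('i \<Rightarrow> complex) \<Rightarrow> ('i \<Rightarrow> real) \<Rightarrow> complex measure" where
  "self_similar_measure l \<Lambda> a p =
     (THE \<nu>. compact_prob \<nu> \<and>
        (\<forall>A\<in>sets borel.
           emeasure \<nu> A = (\<Sum>i\<in>\<Lambda>. ennreal (p i) * emeasure (distr \<nu> borel (ifs_map l a i)) A)))"

section \<open>The exceptional set\<close>

text \<open>The index sets here are finite sets of naturals, since a formula cannot quantify over
  types; up to relabelling these are all the finite index sets.\<close>

definition fourier_decay_off :: "complex set \<Rightarrow> bool" where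
  "fourier_decay_off X \<longleftrightarrow>
     (\<forall>l \<in> ball 0 1 - (X \<union> \<real>).
      \<forall>(\<Lambda> :: nat set) (a :: nat \<Rightarrow> complex) (p :: nat \<Rightarrow> real).
        finite \<Lambda> \<longrightarrow> \<Lambda> \<noteq> {} \<longrightarrow> (\<exists>i\<in>\<Lambda>. \<exists>j\<in>\<Lambda>. a i \<noteq> a j) \<longrightarrow> prob_vector \<Lambda> p \<longrightarrow>
        (\<exists>C \<gamma>. C > 0 \<and> \<gamma> > 0 \<and>
           (\<forall>\<xi>. \<xi> \<noteq> 0 \<longrightarrow>
              cmod (measure_fourier (self_similar_measure l \<Lambda> a p) \<xi>) \<le> C * cmod \<xi> powr (- \<gamma>))))"

definition root_closure :: "complex set \<Rightarrow> complex set" where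
  "root_closure X = (\<Union>k\<in>{1::nat..}. {l \<in> ball 0 1. l ^ k \<in> X})"

section \<open>Sobolev spaces on the line\<close>

definition L2_line :: "(real \<Rightarrow> complex) set" where
  "L2_line = {g. g \<in> borel_measurable lborel \<and> integrable lborel (\<lambda>x. (cmod (g x))\<^sup>2)}"

text \<open>The Fourier transform on \<open>L\<^sup>2\<close> (without normalising constant): the limit in \<open>L\<^sup>2\<close> of the
  transforms of the truncations of \<open>g\<close> to \<open>[-R, R]\<close>. It is determined up to null sets.\<close>

definition is_L2_fourier :: "(real \<Rightarrow> complex) \<Rightarrow> (real \<Rightarrow> complex) \<Rightarrow> bool" where
  "is_L2_fourier g h \<longleftrightarrow>
     h \<in> L2_line \<and>
     ((\<lambda>R. \<integral>\<^sup>+ \<xi>. ennreal ((cmod (h \<xi> - (LINT x:{-R..R}|lborel. cis (\<xi> * x) * g x)))\<^sup>2) \<partial>lborel)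
        \<longlongrightarrow> 0) at_top"

definition L2_fourier :: "(real \<Rightarrow> complex) \<Rightarrow> real \<Rightarrow> complex" where
  "L2_fourier g = (SOME h. is_L2_fourier g h)"

definition sobolev :: "real \<Rightarrow> (real \<Rightarrow> complex) set" where
  "sobolev \<gamma> =
     {g \<in> L2_line. integrable lborel (\<lambda>\<xi>. (cmod (L2_fourier g \<xi>))\<^sup>2 * (1 + \<xi>\<^sup>2) powr \<gamma>)}"

definition sobolev_norm :: "real \<Rightarrow> (real \<Rightarrow> complex) \<Rightarrow> real" where
  "sobolev_norm \<gamma> g = sqrt (LINT \<xi>|lborel. (cmod (L2_fourier g \<xi>))\<^sup>2 * (1 + \<xi>\<^sup>2) powr \<gamma>)"

text \<open>A version of the Lebesgue density of an absolutely continuous measure.\<close>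

definition lebesgue_density :: "real measure \<Rightarrow> real \<Rightarrow> complex" where
  "lebesgue_density \<mu> x = complex_of_real (enn2real (RN_deriv lborel \<mu> x))"

definition measure_in_sobolev :: "real \<Rightarrow> real measure \<Rightarrow> bool" where
  "measure_in_sobolev \<gamma> \<mu> \<longleftrightarrow>
     absolutely_continuous lborel \<mu> \<and> lebesgue_density \<mu> \<in> sobolev \<gamma>"

end

theory Submission
  imports Defs
begin

text \<open>Put \<open>\<kappa> = l\<^sup>k\<close> and split the random series \<open>\<Sum>j. l\<^sup>j c\<^sub>j\<close> with law \<open>\<nu>\<close> into the
  digits with \<open>j \<equiv> k - 1 (mod k)\<close> and the others, so that \<open>\<nu>\<close> is a convolution \<open>\<nu>\<^sub>1 * \<nu>\<^sub>2\<close> of two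
  self-similar measures of ratio \<open>\<kappa>\<close>. The transform of \<open>\<nu>\<^sub>2\<close> decays polynomially because \<open>\<kappa>\<close> is not
  exceptional. For \<open>k\<close> large \<open>\<nu>\<^sub>1\<close> still has correlation dimension above \<open>1\<close>, and it remains to show that
  the correlation sums of \<open>P\<^sub>z \<nu>\<^sub>1\<close> at scale \<open>\<rho>\<close> are \<open>O(\<rho>\<^bsup>1-\<epsilon>\<^esup>)\<close> uniformly in \<open>z\<close>. They are submultiplicative
  along the orbit of \<open>z\<close> under the irrational rotation by the argument of \<open>\<kappa>\<close>, so AM-GM bounds them by
  orbit averages of \<open>\<nu>\<^sub>1 \<times> \<nu>\<^sub>1 {|P\<^sub>z(x - y)| \<le> \<rho>}\<close>. By equidistribution these averages are at most a constant
  times the mean of \<open>min 1 (\<rho> / |x - y|)\<close>, which is \<open>O(\<rho>)\<close> since the dimension exceeds \<open>1\<close>. Hence the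
  transforms of \<open>P\<^sub>z \<nu>\<close> lie in a weighted \<open>L\<^sup>2\<close> space with a bound uniform in \<open>z\<close>.\<close>

section \<open>Convolutions and contracting random walks\<close>

text \<open>The orbit averages are O(\<rho>) only up to a constant that enters once per block, so
  the rotation argument always loses a small power; and even correlation sums of order exactly
  \<rho> would not yield a Sobolev exponent \<gamma> > 0. A convolution factor with polynomial
  Fourier decay has to pay both for the loss and for the weight, which is the reason for splitting
  \<nu>. The split is by digits, so both factors have ratio \<kappa>, a power of \<open>l\<close>
  that depends on \<nu>; this is where the exclusion of all roots of exceptional parameters enters.
  Irrationality of the argument is used for every power of \<open>l\<close>: the powers are not
  real, and they generate dense rotations. The estimates are made for finite walks instead of the
  limit measures. To each frequency scale belongs the walk of matching length, so all expectations
  are finite sums. The return to the measures takes place on the Fourier side, where a transform is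
  that of the walk times a factor of modulus at most 1, and at least 1/2 near the origin.\<close>

definition conv_pmf :: "complex pmf \<Rightarrow> complex pmf \<Rightarrow> complex pmf" where
  "conv_pmf v w = bind_pmf v (\<lambda>x. map_pmf (\<lambda>y. x + y) w)"

lemma conv_pmf_commute: "conv_pmf v w = conv_pmf w v"
  unfolding conv_pmf_def map_pmf_def
  by (subst bind_commute_pmf) (simp add: add.commute)

lemma conv_pmf_assoc: "conv_pmf (conv_pmf u v) w = conv_pmf u (conv_pmf v w)"
  unfolding conv_pmf_def map_pmf_def
  by (simp add: bind_assoc_pmf bind_return_pmf add.assoc)

lemma conv_pmf_left_commute: "conv_pmf v (conv_pmf u w) = conv_pmf u (conv_pmf v w)"
  by (metis conv_pmf_assoc conv_pmf_commute)

lemma conv_pmf_return_0 [simp]: "conv_pmf v (return_pmf 0) = v" "conv_pmf (return_pmf 0) v = v"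
proof -
  have "(+) (0::complex) = id" by auto
  then show "conv_pmf v (return_pmf 0) = v" "conv_pmf (return_pmf 0) v = v"
    by (simp_all add: conv_pmf_def bind_return_pmf bind_return_pmf')
qed

lemma map_conv_pmf: "map_pmf ((*) b) (conv_pmf v w) = conv_pmf (map_pmf ((*) b) v) (map_pmf ((*) b) w)"
  unfolding conv_pmf_def map_pmf_def
  by (simp add: bind_assoc_pmf bind_return_pmf distrib_left)

lemma set_conv_pmf: "set_pmf (conv_pmf v w) = (\<Union>x\<in>set_pmf v. (+) x ` set_pmf w)"
  by (simp add: conv_pmf_def)

lemma finite_set_conv_pmf [simp]:
  "finite (set_pmf v) \<Longrightarrow> finite (set_pmf w) \<Longrightarrow> finite (set_pmf (conv_pmf v w))"
  by (simp add: set_conv_pmf)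

lemma nn_integral_conv_pmf:
  "(\<integral>\<^sup>+x. f x \<partial>measure_pmf (conv_pmf v w)) = (\<integral>\<^sup>+x. \<integral>\<^sup>+y. f (x + y) \<partial>measure_pmf w \<partial>measure_pmf v)"
  by (simp add: conv_pmf_def)

lemma expectation_conv_pmf:
  fixes f :: "complex \<Rightarrow> 'b::{banach, second_countable_topology}"
  assumes "finite (set_pmf v)" "finite (set_pmf w)"
  shows "measure_pmf.expectation (conv_pmf v w) f
         = measure_pmf.expectation v (\<lambda>x. measure_pmf.expectation w (\<lambda>y. f (x + y)))"
  unfolding conv_pmf_def
  by (subst pmf_expectation_bind[of "set_pmf v"]) (use assms in \<open>auto simp: integral_measure_pmf\<close>)

text \<open>Negation is written as multiplication by -1, so that the rules for convolutions and
  scalings show that taking differences commutes with forming walks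
  (\<open>walk_diff\<close>).\<close>

definition diff_pmf :: "complex pmf \<Rightarrow> complex pmf" where
  "diff_pmf w = conv_pmf w (map_pmf ((*) (-1)) w)"

lemma finite_set_diff_pmf [simp]: "finite (set_pmf w) \<Longrightarrow> finite (set_pmf (diff_pmf w))"
  by (simp add: diff_pmf_def)

lemma map_pmf_times_commute:
  "map_pmf ((*) (b::complex)) (map_pmf ((*) c) w) = map_pmf ((*) c) (map_pmf ((*) b) w)"
  by (simp add: pmf.map_comp o_def mult.left_commute)

text \<open>The law of \<open>\<Sum>j<n. k ^ j * c\<^sub>j\<close> for independent \<open>c\<^sub>j\<close> with law \<open>w\<close>.\<close>

primrec walk :: "complex \<Rightarrow> complex pmf \<Rightarrow> nat \<Rightarrow> complex pmf" where
  "walk k w 0 = return_pmf 0"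
| "walk k w (Suc n) = conv_pmf w (map_pmf ((*) k) (walk k w n))"

lemma walk_add: "walk k w (n + m) = conv_pmf (walk k w n) (map_pmf ((*) (k ^ n)) (walk k w m))"
proof (induction n)
  case 0 then show ?case by (simp add: pmf.map_ident)
next
  case (Suc n) then show ?case
    by (simp add: map_conv_pmf conv_pmf_assoc pmf.map_comp o_def mult.assoc)
qed

lemma walk_1 [simp]: "walk k w (Suc 0) = w" by simp

text \<open>Grouping m consecutive digits into one digit. This is how the ratio passes from
  \<open>l\<close> to a power of \<open>l\<close>.\<close>

lemma walk_mult: "walk (k ^ m) (walk k w m) n = walk k w (m * n)"
  by (induction n) (simp_all add: walk_add)

lemma walk_conv: "walk k (conv_pmf v w) n = conv_pmf (walk k v n) (walk k w n)"
  by (induction n) (simp_all only: walk.simps map_conv_pmf conv_pmf_assoc conv_pmf_left_commute conv_pmf_return_0)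

lemma walk_map: "walk k (map_pmf ((*) b) w) n = map_pmf ((*) b) (walk k w n)"
  by (induction n) (simp_all only: walk.simps map_conv_pmf map_pmf_times_commute map_return_pmf mult_zero_right)

lemma walk_diff: "walk k (diff_pmf w) n = diff_pmf (walk k w n)"
  by (simp add: diff_pmf_def walk_conv walk_map)

lemma finite_set_walk [simp]: "finite (set_pmf w) \<Longrightarrow> finite (set_pmf (walk k w n))"
  by (induction n) auto

lemma walk_bound:
  assumes "\<And>c. c \<in> set_pmf w \<Longrightarrow> cmod c \<le> A" "cmod k < 1" "s \<in> set_pmf (walk k w n)"
  shows "cmod s \<le> A / (1 - cmod k)"
  using assms(3)
proof (induction n arbitrary: s)
  case 0
  have "0 \<le> A" using assms(1) set_pmf_not_empty[of w] norm_ge_zero order_trans by blast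
  with 0 assms show ?case by simp
next
  case (Suc n)
  then obtain c t where ct: "c \<in> set_pmf w" "t \<in> set_pmf (walk k w n)" "s = c + k * t"
    by (auto simp: set_conv_pmf)
  have "cmod s \<le> cmod c + cmod k * cmod t"
    unfolding ct(3) by (metis norm_mult norm_triangle_ineq)
  also have "\<dots> \<le> A + cmod k * (A / (1 - cmod k))"
    using Suc.IH[OF ct(2)] assms(1)[OF ct(1)] by (intro add_mono mult_left_mono) auto
  also have "\<dots> = A / (1 - cmod k)" using assms(2) by (simp add: field_simps)
  finally show ?case .
qed

lemma pmf_diff_0_pos: "0 < pmf (diff_pmf w) 0"
  unfolding pmf_positive_iff
proof -
  obtain x where "x \<in> set_pmf w" using set_pmf_not_empty[of w] by blast
  then show "0 \<in> set_pmf (diff_pmf w)"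
    by (force simp: diff_pmf_def set_conv_pmf)
qed

text \<open>The event that the second summand is 0 is independent of the first summand and leaves
  the sum unchanged. This bounds the cost of deleting a summand.\<close>

lemma prob_conv_pmf_ge:
  "measure_pmf.prob v A * pmf w 0 \<le> measure_pmf.prob (conv_pmf v w) A"
proof -
  have "ennreal (measure_pmf.prob v A * pmf w 0) = (\<integral>\<^sup>+x. indicator A x * (\<integral>\<^sup>+y. indicator {0} y \<partial>measure_pmf w) \<partial>measure_pmf v)"
    by (simp add: nn_integral_multc measure_pmf.emeasure_eq_measure ennreal_mult pmf.rep_eq emeasure_pmf_single)
  also have "\<dots> \<le> (\<integral>\<^sup>+x. \<integral>\<^sup>+y. indicator A (x + y) \<partial>measure_pmf w \<partial>measure_pmf v)"
    by (subst nn_integral_cmult[symmetric], simp)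
       (intro nn_integral_mono, auto split: split_indicator)
  also have "\<dots> = emeasure (measure_pmf (conv_pmf v w)) A"
    by (simp add: nn_integral_conv_pmf flip: nn_integral_indicator)
  finally show ?thesis by (simp add: measure_pmf.emeasure_eq_measure)
qed

text \<open>All \<open>n\<close> digits vanish independently; cancellation between nonzero digits
  can only add to the probability.\<close>

lemma pmf_walk_0_ge: "pmf w 0 ^ n \<le> pmf (walk k w n) 0"
proof (induction n)
  case (Suc n)
  have "pmf w 0 ^ n \<le> pmf (map_pmf ((*) k) (walk k w n)) 0"
  proof -
    have "pmf (walk k w n) 0 \<le> measure_pmf.prob (walk k w n) ((*) k -` {0})"
      unfolding measure_pmf_single[symmetric] by (intro measure_pmf.finite_measure_mono) auto
    then show ?thesis using Suc by (simp add: pmf_map)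
  qed
  then have "pmf w 0 * pmf w 0 ^ n \<le> measure_pmf.prob w {0} * pmf (map_pmf ((*) k) (walk k w n)) 0"
    by (intro mult_mono) (auto simp: measure_pmf_single)
  also have "\<dots> \<le> pmf (walk k w (Suc n)) 0"
    using prob_conv_pmf_ge[of w "{0}"] by (simp add: measure_pmf_single)
  finally show ?case by simp
qed simp

text \<open>The digits after the first \<open>n\<close> contribute at most the tail of a geometric
  series, which the larger radius absorbs.\<close>

lemma prob_walk_truncate:
  assumes "\<And>d. d \<in> set_pmf w \<Longrightarrow> cmod d \<le> A" "cmod k < 1" "n \<le> N"
  shows "measure_pmf.prob (walk k w N) (cball 0 \<rho>)
         \<le> measure_pmf.prob (walk k w n) (cball 0 (\<rho> + A / (1 - cmod k) * cmod k ^ n))"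
proof -
  have eq: "walk k w N = conv_pmf (walk k w n) (map_pmf ((*) (k ^ n)) (walk k w (N - n)))"
    using walk_add[of k w n "N - n"] assms by simp
  have "emeasure (walk k w N) (cball 0 \<rho>) = (\<integral>\<^sup>+x. \<integral>\<^sup>+y. indicator (cball 0 \<rho>) (x + k ^ n * y) \<partial>walk k w (N - n) \<partial>walk k w n)"
    by (simp add: eq nn_integral_conv_pmf flip: nn_integral_indicator)
  also have "\<dots> \<le> (\<integral>\<^sup>+x. \<integral>\<^sup>+y. indicator (cball 0 (\<rho> + A / (1 - cmod k) * cmod k ^ n)) x \<partial>walk k w (N - n) \<partial>walk k w n)"
  proof (intro nn_integral_mono nn_integral_mono_AE, unfold AE_measure_pmf_iff, intro ballI)
    fix x y assume y: "y \<in> set_pmf (walk k w (N - n))"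
    have "cmod (k ^ n * y) \<le> A / (1 - cmod k) * cmod k ^ n"
      using mult_right_mono[OF walk_bound[OF assms(1,2) y], of "cmod k ^ n"]
      by (simp add: norm_mult norm_power mult.commute)
    then have "cmod x \<le> cmod (x + k ^ n * y) + A / (1 - cmod k) * cmod k ^ n"
      using norm_triangle_ineq4[of "x + k ^ n * y" "k ^ n * y"] by simp
    then show "(indicator (cball 0 \<rho>) (x + k ^ n * y) :: ennreal)
      \<le> indicator (cball 0 (\<rho> + A / (1 - cmod k) * cmod k ^ n)) x"
      by (auto split: split_indicator)
  qed
  also have "\<dots> = emeasure (walk k w n) (cball 0 (\<rho> + A / (1 - cmod k) * cmod k ^ n))"
    by simp
  finally show ?thesis by (simp add: measure_pmf.emeasure_eq_measure)
qed

section \<open>Self-similar measures as stationary measures\<close>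

text \<open>Self-similarity expressed through the law of the translation alone. The index set
  disappears, and iterating the equation \<open>n\<close> times replaces \<alpha> by its
  walk.\<close>

definition stationary :: "complex \<Rightarrow> complex pmf \<Rightarrow> complex measure \<Rightarrow> bool" where
  "stationary l \<alpha> \<nu> \<longleftrightarrow> compact_prob \<nu> \<and>
     \<nu> = measure_pmf \<alpha> \<bind> (\<lambda>c. distr \<nu> borel (\<lambda>x. c + l * x))"

lemma measurable_affine [measurable]: "(\<lambda>x. c + l * x :: complex) \<in> borel_measurable borel"
  by (intro borel_measurable_continuous_onI continuous_intros)

lemma compact_prob_kernel:
  fixes \<nu> :: "complex measure"
  assumes "compact_prob \<nu>"
  shows "(\<lambda>c. distr \<nu> borel (\<lambda>x. c + l * x)) \<in> measurable (measure_pmf \<alpha>) (subprob_algebra borel)"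
proof -
  have s: "sets \<nu> = sets borel" and "prob_space \<nu>" using assms by (auto simp: compact_prob_def)
  interpret prob_space \<nu> by fact
  have "(\<lambda>x. c + l * x) \<in> borel_measurable \<nu>" for c
    unfolding measurable_cong_sets[OF s refl] by (rule measurable_affine)
  then show ?thesis
    by (simp add: space_subprob_algebra prob_space_imp_subprob_space prob_space_distr measurable_def[of "measure_pmf \<alpha>"])
qed

lemma nn_integral_kernel_bind:
  fixes \<nu> :: "complex measure"
  assumes "compact_prob \<nu>" and h: "h \<in> borel_measurable borel"
  shows "(\<integral>\<^sup>+x. h x \<partial>(measure_pmf \<alpha> \<bind> (\<lambda>c. distr \<nu> borel (\<lambda>x. c + l * x))))
    = (\<integral>\<^sup>+c. \<integral>\<^sup>+x. h (c + l * x) \<partial>\<nu> \<partial>measure_pmf \<alpha>)"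
proof -
  have s: "sets \<nu> = sets borel" using assms by (auto simp: compact_prob_def)
  have "(\<lambda>x. c + l * x) \<in> borel_measurable \<nu>" for c
    unfolding measurable_cong_sets[OF s refl] by (rule measurable_affine)
  then have "(\<integral>\<^sup>+x. h x \<partial>(distr \<nu> borel (\<lambda>x. c + l * x))) = (\<integral>\<^sup>+x. h (c + l * x) \<partial>\<nu>)" for c
    by (rule nn_integral_distr) (simp add: h)
  then show ?thesis
    using nn_integral_bind[OF h compact_prob_kernel[OF assms(1)]] by simp
qed

lemma stationary_step:
  assumes "stationary l \<alpha> \<nu>" and h: "h \<in> borel_measurable borel"
  shows "(\<integral>\<^sup>+x. h x \<partial>\<nu>) = (\<integral>\<^sup>+c. \<integral>\<^sup>+x. h (c + l * x) \<partial>\<nu> \<partial>measure_pmf \<alpha>)"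
  using nn_integral_kernel_bind[of \<nu> h \<alpha> l] assms unfolding stationary_def by metis

lemma stationary_iff:
  "stationary l \<alpha> \<nu> \<longleftrightarrow> compact_prob \<nu> \<and>
     (\<forall>A\<in>sets borel. emeasure \<nu> A = (\<integral>\<^sup>+c. emeasure (distr \<nu> borel (\<lambda>x. c + l * x)) A \<partial>measure_pmf \<alpha>))"
proof (cases "compact_prob \<nu>")
  case True
  then have s: "sets \<nu> = sets borel" by (auto simp: compact_prob_def)
  note k = compact_prob_kernel[OF True]
  have "sets (measure_pmf \<alpha> \<bind> (\<lambda>c. distr \<nu> borel (\<lambda>x. c + l * x))) = sets borel"
    by (rule sets_bind) auto
  moreover have "emeasure (measure_pmf \<alpha> \<bind> (\<lambda>c. distr \<nu> borel (\<lambda>x. c + l * x))) A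
      = (\<integral>\<^sup>+c. emeasure (distr \<nu> borel (\<lambda>x. c + l * x)) A \<partial>measure_pmf \<alpha>)" if "A \<in> sets borel" for A
    by (rule emeasure_bind[OF _ k that]) simp
  ultimately show ?thesis using True s unfolding stationary_def
    by (auto intro!: measure_eqI dest: arg_cong[of _ _ emeasure])
qed (auto simp: stationary_def)

lemma emeasure_stationary:
  assumes "stationary l \<alpha> \<nu>" and A[measurable]: "A \<in> sets borel"
  shows "emeasure \<nu> A = (\<integral>\<^sup>+c. emeasure \<nu> ((\<lambda>x. c + l * x) -` A) \<partial>measure_pmf \<alpha>)"
proof -
  have s: "sets \<nu> = sets borel" using assms by (auto simp: stationary_def compact_prob_def)
  have "emeasure \<nu> A = (\<integral>\<^sup>+c. \<integral>\<^sup>+x. indicator A (c + l * x) \<partial>\<nu> \<partial>measure_pmf \<alpha>)"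
    using stationary_step[OF assms(1), of "indicator A"] by (simp add: s)
  also have "(\<lambda>c. \<integral>\<^sup>+x. indicator A (c + l * x) \<partial>\<nu>) = (\<lambda>c. emeasure \<nu> ((\<lambda>x. c + l * x) -` A))"
  proof
    fix c
    have "(\<lambda>x. c + l * x) -` A \<inter> space borel \<in> sets borel" by (rule measurable_sets[OF _ A]) measurable
    then have "(\<integral>\<^sup>+x. indicator ((\<lambda>x. c + l * x) -` A) x \<partial>\<nu>) = emeasure \<nu> ((\<lambda>x. c + l * x) -` A)"
      by (intro nn_integral_indicator) (simp add: s)
    then show "(\<integral>\<^sup>+x. indicator A (c + l * x) \<partial>\<nu>) = emeasure \<nu> ((\<lambda>x. c + l * x) -` A)"
      by (simp add: indicator_def)
  qed
  finally show ?thesis .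
qed

lemma stationary_steps:
  assumes "stationary l \<alpha> \<nu>" and h: "h \<in> borel_measurable borel"
  shows "(\<integral>\<^sup>+x. h x \<partial>\<nu>) = (\<integral>\<^sup>+s. \<integral>\<^sup>+x. h (s + l ^ n * x) \<partial>\<nu> \<partial>measure_pmf (walk l \<alpha> n))"
  using h
proof (induction n arbitrary: h)
  case (Suc n)
  have [measurable]: "h \<in> borel_measurable borel" by fact
  have "(\<integral>\<^sup>+x. h x \<partial>\<nu>) = (\<integral>\<^sup>+c. \<integral>\<^sup>+x. h (c + l * x) \<partial>\<nu> \<partial>measure_pmf \<alpha>)"
    by (rule stationary_step) fact+
  also have "\<dots> = (\<integral>\<^sup>+c. \<integral>\<^sup>+s. \<integral>\<^sup>+x. h (c + l * (s + l ^ n * x)) \<partial>\<nu> \<partial>measure_pmf (walk l \<alpha> n) \<partial>measure_pmf \<alpha>)"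
    by (intro nn_integral_cong Suc.IH) measurable
  finally show ?case by (simp add: nn_integral_conv_pmf algebra_simps)
qed simp

text \<open>Digits outside \<open>S\<close> are replaced by 0 so that, for bounded \<open>S\<close>
  and \<open>cmod l < 1\<close>, the series converges for every stream and not merely for almost
  every one.\<close>

definition digit_series :: "complex \<Rightarrow> complex set \<Rightarrow> complex stream \<Rightarrow> complex" where
  "digit_series l S \<omega> = (\<Sum>j. l ^ j * (if \<omega> !! j \<in> S then \<omega> !! j else 0))"

text \<open>The measure is the law of \<open>digit_series\<close> for independent digits. Prepending
  a digit \<open>c\<close> turns the sum \<open>X\<close> into \<open>c + l * X\<close>, and a
  stream of independent digits is an independent digit followed by such a stream. The explicit
  support bound passes later, by uniqueness, to every stationary measure.\<close>

lemma stationary_exists: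
  assumes l: "cmod l < 1" and fin: "finite (set_pmf \<alpha>)" and A: "\<And>c. c \<in> set_pmf \<alpha> \<Longrightarrow> cmod c \<le> A"
  shows "\<exists>\<nu>. stationary l \<alpha> \<nu> \<and> emeasure \<nu> (- cball 0 (A / (1 - cmod l))) = 0"
proof -
  let ?S = "set_pmf \<alpha>"
  let ?g = "\<lambda>c. if c \<in> ?S then c else 0 :: complex"
  define X where "X = digit_series l ?S"
  let ?M = "stream_space (measure_pmf \<alpha>)"
  have "0 \<le> A" using A set_pmf_not_empty[of \<alpha>] norm_ge_zero order_trans by blast
  then have g: "cmod (?g c) \<le> A" for c using A by auto
  have sum1: "summable (\<lambda>j. cmod l ^ j * A)"
    using l by (intro summable_mult2 summable_geometric) auto
  have b: "cmod (l ^ j * ?g c) \<le> cmod l ^ j * A" for j c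
    using g by (simp add: norm_mult norm_power mult_left_mono)
  have sm: "summable (\<lambda>j. l ^ j * ?g (\<omega> !! j))" for \<omega>
    by (rule summable_comparison_test'[OF sum1, of 0]) (use b in auto)
  have bound: "cmod (X \<omega>) \<le> A / (1 - cmod l)" for \<omega>
  proof -
    have "cmod (X \<omega>) \<le> (\<Sum>j. cmod l ^ j * A)"
      unfolding X_def digit_series_def
      by (rule norm_suminf_le) (use b sum1 in auto)
    also have "\<dots> = A / (1 - cmod l)"
      using l by (subst suminf_mult2[symmetric]) (auto simp: suminf_geometric summable_geometric)
    finally show ?thesis .
  qed
  have step: "X (c ## \<omega>) = ?g c + l * X \<omega>" for c \<omega>
  proof -
    have "X (c ## \<omega>) = (\<Sum>j. l ^ Suc j * ?g (\<omega> !! j)) + ?g c"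
      using suminf_split_head[OF sm[of "c ## \<omega>"]] unfolding X_def digit_series_def
      by (simp only: snth.simps stream.sel power_0 mult_1_left) (simp add: algebra_simps)
    also have "(\<Sum>j. l ^ Suc j * ?g (\<omega> !! j)) = l * X \<omega>"
      using suminf_mult[OF sm[of \<omega>], of l] unfolding X_def digit_series_def by (simp add: mult.assoc)
    finally show ?thesis by simp
  qed
  have [measurable]: "(\<lambda>\<omega>. ?g (\<omega> !! j)) \<in> borel_measurable ?M" for j
    by (rule measurable_compose[OF measurable_snth]) simp
  have X[measurable]: "X \<in> borel_measurable ?M"
    unfolding X_def digit_series_def by measurable
  interpret M: prob_space ?M
    by (rule prob_space.prob_space_stream_space[OF measure_pmf.prob_space_axioms])
  define \<nu> where "\<nu> = distr ?M borel X"
  have z: "emeasure \<nu> (- cball 0 (A / (1 - cmod l))) = 0"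
    unfolding \<nu>_def by (subst emeasure_distr) (use bound in \<open>auto simp: not_le[symmetric] vimage_def\<close>)
  have cp: "compact_prob \<nu>"
    unfolding compact_prob_def using z
    by (auto simp: \<nu>_def intro!: M.prob_space_distr exI[of _ "cball 0 (A / (1 - cmod l))"])
  moreover have "emeasure \<nu> B = (\<integral>\<^sup>+c. emeasure (distr \<nu> borel (\<lambda>x. c + l * x)) B \<partial>measure_pmf \<alpha>)"
    if B[measurable]: "B \<in> sets borel" for B
  proof -
    have "emeasure \<nu> B = (\<integral>\<^sup>+\<omega>. indicator B (X \<omega>) \<partial>?M)"
      unfolding \<nu>_def by (simp add: nn_integral_distr flip: nn_integral_indicator)
    also have "\<dots> = (\<integral>\<^sup>+c. \<integral>\<^sup>+\<omega>. indicator B (X (c ## \<omega>)) \<partial>?M \<partial>measure_pmf \<alpha>)"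
      by (rule prob_space.nn_integral_stream_space[OF measure_pmf.prob_space_axioms]) measurable
    also have "\<dots> = (\<integral>\<^sup>+c. emeasure (distr \<nu> borel (\<lambda>x. c + l * x)) B \<partial>measure_pmf \<alpha>)"
    proof (intro nn_integral_cong_AE, unfold AE_measure_pmf_iff, intro ballI)
      fix c assume c: "c \<in> ?S"
      have [measurable]: "(\<lambda>x. c + l * x) \<in> borel_measurable borel" by measurable
      have "emeasure (distr \<nu> borel (\<lambda>x. c + l * x)) B = (\<integral>\<^sup>+x. indicator B x \<partial>distr \<nu> borel (\<lambda>x. c + l * x))"
        by simp
      also have "\<dots> = (\<integral>\<^sup>+\<omega>. indicator B (c + l * X \<omega>) \<partial>?M)"
        unfolding \<nu>_def by (subst nn_integral_distr, measurable)+
      finally show "(\<integral>\<^sup>+\<omega>. indicator B (X (c ## \<omega>)) \<partial>?M) = emeasure (distr \<nu> borel (\<lambda>x. c + l * x)) B"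
        using c by (simp add: step)
    qed
    finally show ?thesis .
  qed
  ultimately show ?thesis using z unfolding stationary_iff by blast
qed

lemma compact_prob_cball:
  assumes "compact_prob (\<mu> :: complex measure)"
  obtains D where "0 < D" "AE x in \<mu>. cmod x \<le> D"
proof -
  from assms obtain K where K: "compact K" "emeasure \<mu> (- K) = 0" and s: "sets \<mu> = sets borel"
    by (auto simp: compact_prob_def)
  from compact_imp_bounded[OF K(1)] obtain D where D: "D > 0" "\<And>x. x \<in> K \<Longrightarrow> cmod x \<le> D"
    unfolding bounded_pos by auto
  have "- K \<in> sets \<mu>"
    unfolding s using compact_imp_closed[OF K(1)] by (intro borel_open) (rule open_Compl)
  then have "- K \<in> null_sets \<mu>" by (rule null_setsI[OF K(2)])
  then have "AE x in \<mu>. x \<in> K" by (rule AE_I') auto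
  then show ?thesis using D by (intro that[of D]) auto
qed

text \<open>Contracting the \<open>\<epsilon>\<close>-neighbourhood bound by the maps of the system improves \<open>\<epsilon>\<close> to \<open>|l| \<epsilon>\<close>.\<close>

lemma stationary_le:
  assumes \<nu>: "stationary l \<alpha> \<nu>" and \<mu>: "stationary l \<alpha> \<mu>" and l: "cmod l < 1"
    and F: "closed F"
  shows "emeasure \<nu> F \<le> emeasure \<mu> F"
proof (cases "F = {}")
  case ne: False
  let ?N = "\<lambda>F e. {x. \<exists>y\<in>F. dist x y \<le> e}"
  have sn: "sets \<nu> = sets borel" "sets \<mu> = sets borel" "prob_space \<nu>" "prob_space \<mu>"
    using \<nu> \<mu> by (auto simp: stationary_def compact_prob_def)
  have [measurable_cong]: "sets \<nu> = sets borel" "sets \<mu> = sets borel" by fact+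
  interpret \<nu>: prob_space \<nu> by fact
  interpret \<mu>: prob_space \<mu> by fact
  obtain D1 where D1: "0 < D1" "AE x in \<nu>. cmod x \<le> D1"
    using \<nu> compact_prob_cball unfolding stationary_def by metis
  obtain D2 where D2: "0 < D2" "AE x in \<mu>. cmod x \<le> D2"
    using \<mu> compact_prob_cball unfolding stationary_def by metis
  \<comment> \<open>Almost all points for \<nu> and almost all points for \<mu> are at distance at
    most \<open>e\<close>, so a closed set charged by \<nu> has an \<open>e\<close>-neighbourhood of
    full \<mu>-measure. This starts the induction.\<close>
  define e where "e = D1 + D2"
  have cN: "closed (?N F e)" if cF: "closed F" for F :: "complex set" and e
  proof (cases "0 \<le> e \<and> F \<noteq> {}")
    case True
    have "?N F e = {x. infdist x F \<le> e}"
    proof (intro set_eqI iffI; clarify)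
      fix x y assume "y \<in> F" "dist x y \<le> e"
      then show "infdist x F \<le> e" using infdist_le[of y F x] by simp
    next
      fix x assume "infdist x F \<le> e"
      moreover obtain y where "y \<in> F" "infdist x F = dist x y"
        using infdist_attains_inf[OF cF, of x] True by blast
      ultimately show "\<exists>y\<in>F. dist x y \<le> e" by auto
    qed
    then show ?thesis by (simp add: closed_Collect_le continuous_on_infdist)
  next
    case False
    then have "?N F e = {}" by (auto dest: order_trans[OF zero_le_dist])
    then show ?thesis by simp
  qed
  have main: "emeasure \<nu> F \<le> emeasure \<mu> (?N F (cmod l ^ n * e))" if "closed F" for F n
    using that
  proof (induction n arbitrary: F)
    case 0
    show ?case
    proof (cases "emeasure \<nu> F = 0")
      case False
      have "\<exists>x\<in>F. cmod x \<le> D1"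
      proof (rule ccontr)
        assume "\<not> ?thesis"
        then have "AE x in \<nu>. x \<notin> F" using D1(2) by auto
        then have "emeasure \<nu> {x \<in> space \<nu>. x \<in> F} = 0" by (rule emeasure_eq_0_AE)
        moreover have "{x \<in> space \<nu>. x \<in> F} = F" using sets_eq_imp_space_eq[OF sn(1)] by auto
        ultimately show False using False by simp
      qed
      then obtain x where x: "x \<in> F" "cmod x \<le> D1" by blast
      have "AE y in \<mu>. y \<in> ?N F e" using D2(2)
      proof eventually_elim
        case (elim y)
        have "dist y x \<le> e" using norm_triangle_ineq4[of y x] x elim unfolding e_def dist_norm by linarith
        then show ?case using x by blast
      qed
      then have "emeasure \<mu> (?N F e) = 1"
        using cN[OF 0] by (subst \<mu>.emeasure_eq_1_AE) (auto simp: sn)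
      then show ?thesis using \<nu>.emeasure_le_1 by simp
    qed simp
  next
    case (Suc n)
    let ?f = "\<lambda>c x. c + l * x"
    have cf: "closed (?f c -` F)" for c
      by (intro continuous_closed_vimage Suc.prems) (auto intro!: continuous_intros)
    have "emeasure \<nu> F = (\<integral>\<^sup>+c. emeasure \<nu> (?f c -` F) \<partial>measure_pmf \<alpha>)"
      using Suc.prems by (intro emeasure_stationary[OF \<nu>]) simp
    also have "\<dots> \<le> (\<integral>\<^sup>+c. emeasure \<mu> (?N (?f c -` F) (cmod l ^ n * e)) \<partial>measure_pmf \<alpha>)"
      by (intro nn_integral_mono Suc.IH cf)
    also have "\<dots> \<le> (\<integral>\<^sup>+c. emeasure \<mu> (?f c -` ?N F (cmod l ^ Suc n * e)) \<partial>measure_pmf \<alpha>)"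
    proof (intro nn_integral_mono emeasure_mono)
      fix c
      show "?N (?f c -` F) (cmod l ^ n * e) \<subseteq> ?f c -` ?N F (cmod l ^ Suc n * e)"
      proof (rule subsetI)
        fix x assume "x \<in> ?N (?f c -` F) (cmod l ^ n * e)"
        then obtain y where y: "c + l * y \<in> F" and d: "dist x y \<le> cmod l ^ n * e" by auto
        have "dist (c + l * x) (c + l * y) = cmod l * dist x y"
          by (simp add: dist_norm norm_mult flip: right_diff_distrib)
        also have "\<dots> \<le> cmod l ^ Suc n * e" using mult_left_mono[OF d, of "cmod l"] by (simp add: mult.assoc)
        finally show "x \<in> ?f c -` ?N F (cmod l ^ Suc n * e)" using y by blast
      qed
      show "?f c -` ?N F (cmod l ^ Suc n * e) \<in> sets \<mu>"
        unfolding sn by (intro borel_closed continuous_closed_vimage cN Suc.prems) (auto intro!: continuous_intros)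
    qed
    also have "\<dots> = emeasure \<mu> (?N F (cmod l ^ Suc n * e))"
      using cN[OF Suc.prems] by (intro emeasure_stationary[OF \<mu>, symmetric]) simp
    finally show ?case .
  qed
  have ev: "0 \<le> e" using D1 D2 by (simp add: e_def)
  \<comment> \<open>The neighbourhoods decrease to \<open>F\<close> because \<open>F\<close> is
    closed, so continuity from above removes them.\<close>
  have dec: "decseq (\<lambda>n. ?N F (cmod l ^ n * e))"
  proof (intro decseq_SucI subsetI)
    fix n x assume "x \<in> ?N F (cmod l ^ Suc n * e)"
    moreover have "cmod l ^ Suc n * e \<le> cmod l ^ n * e"
      using l ev by (intro mult_right_mono power_decreasing) auto
    ultimately show "x \<in> ?N F (cmod l ^ n * e)" by (auto intro: order_trans)
  qed
  have "(\<lambda>n. emeasure \<mu> (?N F (cmod l ^ n * e))) \<longlonglongrightarrow> emeasure \<mu> (\<Inter>n. ?N F (cmod l ^ n * e))"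
    using dec cN[OF F] by (intro Lim_emeasure_decseq) (auto simp: sn \<mu>.emeasure_eq_measure)
  moreover have "(\<Inter>n. ?N F (cmod l ^ n * e)) = F"
  proof (intro equalityI subsetI)
    fix x assume x: "x \<in> (\<Inter>n. ?N F (cmod l ^ n * e))"
    have "infdist x F \<le> cmod l ^ n * e" for n
    proof -
      obtain y where "y \<in> F" "dist x y \<le> cmod l ^ n * e" using x by blast
      then show ?thesis using infdist_le[of y F x] by simp
    qed
    moreover have "(\<lambda>n. cmod l ^ n * e) \<longlonglongrightarrow> 0 * e"
      using l by (intro tendsto_mult LIMSEQ_power_zero tendsto_const) auto
    ultimately have "infdist x F \<le> 0"
      by (intro LIMSEQ_le_const[of _ 0]) auto
    then show "x \<in> F" using in_closed_iff_infdist_zero[OF F ne] infdist_nonneg[of x F] by simp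
  next
    fix x assume "x \<in> F" then show "x \<in> (\<Inter>n. ?N F (cmod l ^ n * e))"
      using ev by (auto intro!: bexI[of _ x])
  qed
  ultimately show ?thesis
    using main[OF F] by (intro LIMSEQ_le_const[of "\<lambda>n. emeasure \<mu> (?N F (cmod l ^ n * e))"]) auto
qed simp

lemma stationary_unique:
  assumes "stationary l \<alpha> \<nu>" "stationary l \<alpha> \<mu>" "cmod l < 1"
  shows "\<nu> = \<mu>"
proof (rule measure_eqI_generator_eq[where E="Collect closed" and \<Omega>=UNIV and A="\<lambda>_. UNIV"])
  show "Int_stable (Collect closed :: complex set set)" by (auto simp: Int_stable_def)
  show "emeasure \<nu> X = emeasure \<mu> X" if "X \<in> Collect closed" for X
    using that stationary_le[OF assms(1,2,3)] stationary_le[OF assms(2,1,3)] by (auto intro: antisym)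
  show "sets \<nu> = sigma_sets UNIV (Collect closed)" "sets \<mu> = sigma_sets UNIV (Collect closed)"
    using assms by (auto simp: stationary_def compact_prob_def borel_eq_closed)
  show "emeasure \<nu> UNIV \<noteq> \<infinity>" for i :: nat
    using assms(1) unfolding stationary_def compact_prob_def
    by (auto simp: prob_space.finite_measure finite_measure.emeasure_finite)
qed auto

section \<open>The self-similar measure as a stationary measure of its digits\<close>

definition digit_pmf :: "'i set \<Rightarrow> ('i \<Rightarrow> complex) \<Rightarrow> ('i \<Rightarrow> real) \<Rightarrow> complex pmf" where
  "digit_pmf \<Lambda> a p = map_pmf a (embed_pmf (\<lambda>i. if i \<in> \<Lambda> then p i else 0))"

lemma
  assumes "finite \<Lambda>" "prob_vector \<Lambda> p"
  shows pmf_embed_prob_vector: "pmf (embed_pmf (\<lambda>i. if i \<in> \<Lambda> then p i else 0)) i = (if i \<in> \<Lambda> then p i else 0)"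
    and set_embed_prob_vector: "set_pmf (embed_pmf (\<lambda>i. if i \<in> \<Lambda> then p i else 0)) = \<Lambda>"
proof -
  let ?q = "\<lambda>i. if i \<in> \<Lambda> then p i else 0"
  have p: "\<And>i. i \<in> \<Lambda> \<Longrightarrow> 0 < p i" "(\<Sum>i\<in>\<Lambda>. p i) = 1" using assms(2) by (auto simp: prob_vector_def)
  have nn: "0 \<le> ?q i" for i using p(1) by (auto intro: less_imp_le)
  have "(\<integral>\<^sup>+x. ennreal (?q x) \<partial>count_space UNIV) = (\<Sum>i\<in>\<Lambda>. ennreal (p i))"
    by (subst nn_integral_count_space'[of \<Lambda>]) (auto simp: assms)
  also have "\<dots> = 1" using p by (simp add: sum_ennreal less_imp_le)
  finally have s: "(\<integral>\<^sup>+x. ennreal (?q x) \<partial>count_space UNIV) = 1" .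
  show "pmf (embed_pmf ?q) i = ?q i" by (rule pmf_embed_pmf[OF nn s])
  show "set_pmf (embed_pmf ?q) = \<Lambda>" using p(1) by (subst set_embed_pmf[OF nn s]) force
qed

lemma set_digit_pmf: "finite \<Lambda> \<Longrightarrow> prob_vector \<Lambda> p \<Longrightarrow> set_pmf (digit_pmf \<Lambda> a p) = a ` \<Lambda>"
  by (simp add: digit_pmf_def set_embed_prob_vector)

lemma nn_integral_digit_pmf:
  assumes "finite \<Lambda>" "prob_vector \<Lambda> p"
  shows "(\<integral>\<^sup>+c. f c \<partial>measure_pmf (digit_pmf \<Lambda> a p)) = (\<Sum>i\<in>\<Lambda>. ennreal (p i) * f (a i))"
  using assms
  by (simp add: digit_pmf_def nn_integral_measure_pmf_finite set_embed_prob_vector pmf_embed_prob_vector mult.commute)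

text \<open>Once the sum over \<Lambda> is read as an integral against the digit law, the predicate
  under the definite description is \<open>stationary\<close> itself; existence and uniqueness then
  make the description denote.\<close>

lemma self_similar_measure_stationary:
  assumes "cmod l < 1" "finite \<Lambda>" "prob_vector \<Lambda> p"
  shows "stationary l (digit_pmf \<Lambda> a p) (self_similar_measure l \<Lambda> a p)"
proof -
  have eq: "(\<lambda>\<nu>. compact_prob \<nu> \<and> (\<forall>A\<in>sets borel.
      emeasure \<nu> A = (\<Sum>i\<in>\<Lambda>. ennreal (p i) * emeasure (distr \<nu> borel (ifs_map l a i)) A)))
    = stationary l (digit_pmf \<Lambda> a p)"
    unfolding fun_eq_iff stationary_iff nn_integral_digit_pmf[OF assms(2,3)]
    by (simp add: ifs_map_def[abs_def] add.commute)
  have fin: "finite (set_pmf (digit_pmf \<Lambda> a p))" using assms by (simp add: set_digit_pmf)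
  have "cmod c \<le> Max (cmod ` set_pmf (digit_pmf \<Lambda> a p))" if "c \<in> set_pmf (digit_pmf \<Lambda> a p)" for c
    using that fin by (intro Max_ge) auto
  then obtain \<nu> where "stationary l (digit_pmf \<Lambda> a p) \<nu>"
    using stationary_exists[OF assms(1) fin] by blast
  then show ?thesis
    unfolding self_similar_measure_def eq
    by (rule theI) (use stationary_unique[OF _ _ assms(1)] \<open>stationary l _ \<nu>\<close> in blast)
qed

text \<open>By uniqueness \<nu> is the law of the digit series, whose support radius is
  explicit.\<close>

lemma stationary_AE_bound:
  assumes "cmod l < 1" "finite (set_pmf \<alpha>)" "\<And>c. c \<in> set_pmf \<alpha> \<Longrightarrow> cmod c \<le> A" "stationary l \<alpha> \<nu>"
  shows "AE x in \<nu>. cmod x \<le> A / (1 - cmod l)"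
proof -
  obtain \<mu> where \<mu>: "stationary l \<alpha> \<mu>" "emeasure \<mu> (- cball 0 (A / (1 - cmod l))) = 0"
    using stationary_exists[OF assms(1-3)] by blast
  have "\<mu> = \<nu>" using stationary_unique[OF \<mu>(1) assms(4,1)] .
  moreover have "sets \<mu> = sets borel" using \<mu>(1) by (auto simp: stationary_def compact_prob_def)
  ultimately have "- cball 0 (A / (1 - cmod l)) \<in> null_sets \<nu>"
    using \<mu>(2) by (intro null_setsI) auto
  then show ?thesis by (rule AE_I') auto
qed

lemma stationary_prob_space: "stationary l \<alpha> \<nu> \<Longrightarrow> prob_space \<nu>"
  and stationary_sets: "stationary l \<alpha> \<nu> \<Longrightarrow> sets \<nu> = sets borel"
  by (auto simp: stationary_def compact_prob_def)

text \<open>Adding the bound \<open>B\<close> to \<open>h\<close> reduces this to nonnegative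
  functions, where \<open>stationary_steps\<close> applies.\<close>

lemma stationary_integral:
  fixes h :: "complex \<Rightarrow> real"
  assumes st: "stationary l \<alpha> \<nu>" and fin: "finite (set_pmf \<alpha>)" and h[measurable]: "h \<in> borel_measurable borel"
    and B: "\<And>x. \<bar>h x\<bar> \<le> B"
  shows "(LINT x|\<nu>. h x) = measure_pmf.expectation (walk l \<alpha> n) (\<lambda>s. LINT x|\<nu>. h (s + l ^ n * x))"
proof -
  interpret prob_space \<nu> by (rule stationary_prob_space[OF st])
  note s = stationary_sets[OF st]
  have m: "(\<lambda>x. h (s + l ^ n * x)) \<in> borel_measurable \<nu>" "h \<in> borel_measurable \<nu>" for s
    unfolding measurable_cong_sets[OF s refl] by measurable
  have int: "integrable \<nu> (\<lambda>x. h (s + l ^ n * x))" "integrable \<nu> h" for s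
    using m B by (auto intro!: integrable_const_bound[of _ B])
  have pos: "0 \<le> h x + B" for x using B[of x] by linarith
  have lower: "- B \<le> h x" for x using B[of x] by linarith
  have "ennreal ((LINT x|\<nu>. h x) + B) = ennreal (LINT x|\<nu>. h x + B)"
    using int by (simp add: prob_space)
  also have "\<dots> = (\<integral>\<^sup>+x. ennreal (h x + B) \<partial>\<nu>)"
    using int pos by (subst nn_integral_eq_integral) auto
  also have "\<dots> = (\<integral>\<^sup>+s. \<integral>\<^sup>+x. ennreal (h (s + l ^ n * x) + B) \<partial>\<nu> \<partial>measure_pmf (walk l \<alpha> n))"
    by (rule stationary_steps[OF st]) measurable
  also have "\<dots> = (\<integral>\<^sup>+s. ennreal (LINT x|\<nu>. h (s + l ^ n * x) + B) \<partial>measure_pmf (walk l \<alpha> n))"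
    using int pos by (intro nn_integral_cong, subst nn_integral_eq_integral) auto
  also have "\<dots> = ennreal (measure_pmf.expectation (walk l \<alpha> n) (\<lambda>s. LINT x|\<nu>. h (s + l ^ n * x) + B))"
    using fin pos by (intro nn_integral_eq_integral) (auto intro!: integrable_measure_pmf_finite AE_I2 integral_nonneg_AE)
  also have "measure_pmf.expectation (walk l \<alpha> n) (\<lambda>s. LINT x|\<nu>. h (s + l ^ n * x) + B)
    = measure_pmf.expectation (walk l \<alpha> n) (\<lambda>s. LINT x|\<nu>. h (s + l ^ n * x)) + B"
    using int fin by (simp add: prob_space integrable_measure_pmf_finite)
  finally have "(LINT x|\<nu>. h x) + B = measure_pmf.expectation (walk l \<alpha> n) (\<lambda>s. LINT x|\<nu>. h (s + l ^ n * x)) + B"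
  proof (subst (asm) ennreal_inj)
    have "- B \<le> (LINT x|\<nu>. h x)"
      by (rule integral_ge_const) (use int lower in auto)
    then show "0 \<le> (LINT x|\<nu>. h x) + B" by simp
    have "- B \<le> (LINT x|\<nu>. h (s + l ^ n * x))" for s
      by (rule integral_ge_const) (use int lower in auto)
    then have "- B \<le> measure_pmf.expectation (walk l \<alpha> n) (\<lambda>s. LINT x|\<nu>. h (s + l ^ n * x))"
      using fin by (intro measure_pmf.integral_ge_const) (auto intro!: integrable_measure_pmf_finite)
    then show "0 \<le> measure_pmf.expectation (walk l \<alpha> n) (\<lambda>s. LINT x|\<nu>. h (s + l ^ n * x)) + B" by simp
  qed auto
  then show ?thesis by simp
qed

section \<open>Fourier transforms of stationary measures\<close>

lemma measurable_cis_inner [measurable]: "(\<lambda>w. cis (Re (\<xi> * cnj w))) \<in> borel_measurable borel"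
  by (intro borel_measurable_continuous_onI continuous_intros)

lemma integrable_cis_inner:
  assumes "finite_measure \<mu>" "sets \<mu> = sets borel"
  shows "integrable \<mu> (\<lambda>w. cis (Re (\<xi> * cnj w)))"
proof -
  interpret finite_measure \<mu> by fact
  have "(\<lambda>w. cis (Re (\<xi> * cnj w))) \<in> borel_measurable \<mu>"
    unfolding measurable_cong_sets[OF assms(2) refl] by (rule measurable_cis_inner)
  then show ?thesis by (intro integrable_const_bound[of _ 1]) auto
qed

text \<open>A point of \<nu> is \<open>s + l ^ n * x\<close> with \<open>s\<close> from the walk and
  an independent \<open>x\<close> from \<nu>, and the character factors. The conjugate appears
  because the pairing \<open>Re (\<xi> * cnj w)\<close> moves a factor \<open>l ^ n\<close> of
  \<open>w\<close> to \<xi> as its conjugate. Real and imaginary parts are treated separately since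
  \<open>stationary_integral\<close> concerns real functions.\<close>

lemma measure_fourier_stationary:
  assumes st: "stationary l \<alpha> \<nu>" and fin: "finite (set_pmf \<alpha>)"
  shows "measure_fourier \<nu> \<xi> = measure_fourier (measure_pmf (walk l \<alpha> n)) \<xi> * measure_fourier \<nu> (cnj l ^ n * \<xi>)"
proof -
  let ?e = "\<lambda>w. cis (Re (\<xi> * cnj w))"
  interpret prob_space \<nu> by (rule stationary_prob_space[OF st])
  note s = stationary_sets[OF st]
  have m: "(\<lambda>x. ?e (s + l ^ n * x)) \<in> borel_measurable \<nu>" for s
    unfolding measurable_cong_sets[OF s refl] by (intro borel_measurable_continuous_onI continuous_intros)
  then have int: "integrable \<nu> (\<lambda>x. ?e (s + l ^ n * x))" for s
    by (intro integrable_const_bound[of _ 1]) auto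
  have int0: "integrable \<nu> ?e" by (intro integrable_cis_inner s finite_measure_axioms)
  have fw: "finite (set_pmf (walk l \<alpha> n))" using fin by simp
  have *: "(LINT x|\<nu>. ?e x) = measure_pmf.expectation (walk l \<alpha> n) (\<lambda>s. LINT x|\<nu>. ?e (s + l ^ n * x))"
  proof (rule complex_eqI)
    have "Re (LINT x|\<nu>. ?e x) = (LINT x|\<nu>. cos (Re (\<xi> * cnj x)))" using int0 by (simp flip: integral_Re)
    also have "\<dots> = measure_pmf.expectation (walk l \<alpha> n) (\<lambda>s. LINT x|\<nu>. cos (Re (\<xi> * cnj (s + l ^ n * x))))"
      by (rule stationary_integral[OF st fin, of _ 1]) (auto intro!: borel_measurable_continuous_onI continuous_intros)
    also have "\<dots> = Re (measure_pmf.expectation (walk l \<alpha> n) (\<lambda>s. LINT x|\<nu>. ?e (s + l ^ n * x)))"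
      using int fw by (simp add: integrable_measure_pmf_finite flip: integral_Re)
    finally show "Re (LINT x|\<nu>. ?e x) = \<dots>" .
    have "Im (LINT x|\<nu>. ?e x) = (LINT x|\<nu>. sin (Re (\<xi> * cnj x)))" using int0 by (simp flip: integral_Im)
    also have "\<dots> = measure_pmf.expectation (walk l \<alpha> n) (\<lambda>s. LINT x|\<nu>. sin (Re (\<xi> * cnj (s + l ^ n * x))))"
      by (rule stationary_integral[OF st fin, of _ 1]) (auto intro!: borel_measurable_continuous_onI continuous_intros)
    also have "\<dots> = Im (measure_pmf.expectation (walk l \<alpha> n) (\<lambda>s. LINT x|\<nu>. ?e (s + l ^ n * x)))"
      using int fw by (simp add: integrable_measure_pmf_finite flip: integral_Im)
    finally show "Im (LINT x|\<nu>. ?e x) = \<dots>" .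
  qed
  have "?e (s + l ^ n * x) = ?e s * cis (Re (cnj l ^ n * \<xi> * cnj x))" for s x
    by (simp add: cis_mult algebra_simps)
  then show ?thesis unfolding measure_fourier_def * by simp
qed

lemma measure_fourier_conv:
  assumes "finite (set_pmf v)" "finite (set_pmf w)"
  shows "measure_fourier (conv_pmf v w) \<xi> = measure_fourier v \<xi> * measure_fourier w \<xi>"
proof -
  have *: "cis (Re (\<xi> * cnj (x + y))) = cis (Re (\<xi> * cnj x)) * cis (Re (\<xi> * cnj y))" for x y
    by (simp add: cis_mult algebra_simps)
  show ?thesis
    unfolding measure_fourier_def expectation_conv_pmf[OF assms] *
    by (simp only: integral_mult_right_zero integral_mult_left_zero)
qed

lemma measure_fourier_le_1: "prob_space \<mu> \<Longrightarrow> cmod (measure_fourier \<mu> \<xi>) \<le> 1"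
  unfolding measure_fourier_def
  using integral_norm_bound[of \<mu> "\<lambda>w. cis (Re (\<xi> * cnj w))"] by (simp add: prob_space.prob_space)

section \<open>Irrational rotations\<close>

lemma cmod_cis_diff_le: "cmod (cis a - cis b) \<le> \<bar>a - b\<bar>"
proof -
  have "cis a - cis b = cis b * (cis (a - b) - 1)" by (simp add: algebra_simps cis_mult)
  then have "cmod (cis a - cis b) = cmod (cis (a - b) - 1)" by (simp add: norm_mult)
  also have "\<dots> \<le> \<bar>a - b\<bar>" using iexp_approx1[of "a - b" 0] by (simp add: cis_conv_exp)
  finally show ?thesis .
qed

text \<open>Kronecker's approximation theorem for fractional parts, transported to the circle by the
  periodicity of \<open>cis\<close>.\<close>

lemma irrational_rotation_dense:
  assumes "\<theta> / (2 * pi) \<notin> \<rat>" "0 < e"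
  shows "\<exists>n. cmod (cis \<theta> ^ n - cis x) < e"
proof -
  define f where "f = frac (x / (2 * pi))"
  have f: "0 \<le> f" "f \<le> 1" by (auto simp: f_def frac_lt_1 less_imp_le)
  obtain k where k: "\<bar>frac (real k * (\<theta> / (2 * pi))) - f\<bar> < e / (2 * pi)"
    using Kronecker_approx_1_explicit[OF assms(1) f, of "e / (2 * pi)"] assms(2) by auto
  have per: "cis (2 * pi * frac y) = cis (2 * pi * y)" for y
  proof -
    have "cis (2 * pi * frac y) = cis (2 * pi * y - 2 * pi * of_int \<lfloor>y\<rfloor>)"
      by (simp add: frac_def right_diff_distrib)
    also have "\<dots> = cis (2 * pi * y)" by (simp add: cis_multiple_2pi flip: cis_divide)
    finally show ?thesis .
  qed
  have "cmod (cis \<theta> ^ k - cis x) = cmod (cis (2 * pi * (real k * (\<theta> / (2 * pi)))) - cis (2 * pi * (x / (2 * pi))))"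
  proof -
    have "2 * pi * (real k * (\<theta> / (2 * pi))) = real k * \<theta>" "2 * pi * (x / (2 * pi)) = x" by simp_all
    then show ?thesis by (simp only: Complex.DeMoivre)
  qed
  also have "\<dots> = cmod (cis (2 * pi * frac (real k * (\<theta> / (2 * pi)))) - cis (2 * pi * f))"
    unfolding f_def per ..
  also have "\<dots> \<le> \<bar>2 * pi * frac (real k * (\<theta> / (2 * pi))) - 2 * pi * f\<bar>" by (rule cmod_cis_diff_le)
  also have "\<dots> = 2 * pi * \<bar>frac (real k * (\<theta> / (2 * pi))) - f\<bar>" by (simp add: abs_mult flip: right_diff_distrib)
  also have "\<dots> < 2 * pi * (e / (2 * pi))" using k by (intro mult_strict_left_mono) auto
  finally show ?thesis by auto
qed

lemma sin_ge_half: "0 \<le> x \<Longrightarrow> x \<le> 1 \<Longrightarrow> x / 2 \<le> sin (x::real)"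
proof -
  assume x: "0 \<le> x" "x \<le> 1"
  have "\<bar>sin x - x\<bar> \<le> \<bar>x\<bar> ^ 3 / 6"
    using Maclaurin_sin_bound[of x 3] by (simp add: numeral_3_eq_3 sin_coeff_def fact_numeral power2_eq_square)
  moreover have "x * x \<le> 1 * 1" using x by (intro mult_mono) auto
  then have "x * (x * x) \<le> x * 3" using x by (intro mult_left_mono) auto
  then have "\<bar>x\<bar> ^ 3 / 6 \<le> x / 2" using x by (simp add: power3_eq_cube)
  ultimately show ?thesis by linarith
qed

text \<open>The times \<open>s i\<close> move the strip \<open>|Re| \<le> 1 / (8 K)\<close> of the circle to pairwise disjoint sets,
  so no orbit can visit it with frequency above \<open>1 / K\<close>.\<close>

lemma rotation_visits:
  assumes dense: "\<And>x e. 0 < e \<Longrightarrow> \<exists>n. cmod (R ^ n - cis x) < e" and R: "cmod R = 1" and K: "0 < K"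
  shows "\<exists>Q. \<forall>q w. cmod w = 1 \<longrightarrow> K * card {j. j < q \<and> \<bar>Re (R ^ j * w)\<bar> \<le> 1 / (8 * real K)} \<le> q + Q"
proof -
  \<comment> \<open>The \<open>K\<close> target angles \<open>i / K\<close> span less than one
    radian, where sin x is at least x / 2. Two of them differ by at least \<open>1 / K\<close>, so
    the imaginary part of their quotient is at least \<open>1 / (2 K)\<close> in modulus; the two
    approximation errors of \<open>1 / (16 K)\<close> leave more than
    \<open>1 / (4 K)\<close>.\<close>
  have "\<exists>n. cmod (R ^ n - cis (real i / real K)) < 1 / (16 * real K)" for i
    using K by (intro dense) auto
  then obtain s where s: "\<And>i. cmod (R ^ s i - cis (real i / real K)) < 1 / (16 * real K)" by metis
  define Q where "Q = (\<Sum>i<K. s i)"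
  have sep: "1 / (4 * real K) < \<bar>Im (R ^ s i * cnj (R ^ s j))\<bar>" if "j < i" "i < K" for i j
  proof -
    define x y a b where "x = R ^ s i" "y = R ^ s j" "a = cis (real i / real K)" "b = cis (real j / real K)"
    note d = this
    have u: "cmod y = 1" "cmod a = 1" using R by (auto simp: d norm_power)
    have "x * cnj y - a * cnj b = (x - a) * cnj y + a * cnj (y - b)" by (simp add: algebra_simps)
    then have "cmod (x * cnj y - a * cnj b) \<le> cmod (x - a) + cmod (y - b)"
      using norm_triangle_ineq[of "(x - a) * cnj y" "a * cnj (y - b)"] u by (simp add: norm_mult flip: complex_cnj_diff)
    also have "\<dots> < 1 / (16 * real K) + 1 / (16 * real K)" using s[of i] s[of j] by (intro add_strict_mono) (auto simp: d)
    finally have 1: "\<bar>Im (x * cnj y) - Im (a * cnj b)\<bar> < 1 / (8 * real K)"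
      using abs_Im_le_cmod[of "x * cnj y - a * cnj b"] by (simp add: field_simps)
    have "a * cnj b = cis ((real i - real j) / real K)"
      by (simp add: d cis_cnj cis_mult diff_divide_distrib)
    then have "Im (a * cnj b) = sin ((real i - real j) / real K)" by simp
    moreover have "1 / real K \<le> (real i - real j) / real K" "(real i - real j) / real K \<le> 1"
      using that by (auto intro!: divide_right_mono simp: divide_le_eq)
    ultimately have "1 / real K / 2 \<le> Im (a * cnj b)"
      using sin_ge_half[of "(real i - real j) / real K"] that by auto
    moreover define t where "t = 1 / (8 * real K)"
    moreover have "1 / real K / 2 = 4 * t" "1 / (4 * real K) = 2 * t" "0 < t"
      using K by (auto simp: t_def field_simps)
    moreover have "Im (a * cnj b) - Im (x * cnj y) < t" using 1[folded t_def] unfolding abs_less_iff by simp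
    ultimately have "2 * t < Im (x * cnj y)" by argo
    then show ?thesis unfolding d(1,2)[symmetric] \<open>1 / (4 * real K) = 2 * t\<close> by linarith
  qed
  have "K * card {j. j < q \<and> \<bar>Re (R ^ j * w)\<bar> \<le> 1 / (8 * real K)} \<le> q + Q" if w: "cmod w = 1" for q w
  proof -
    define S where "S = {j. j < q \<and> \<bar>Re (R ^ j * w)\<bar> \<le> 1 / (8 * real K)}"
    have fS: "finite S" by (simp add: S_def)
    \<comment> \<open>The strip meets the circle in two opposite arcs, so the quotient of two of its
      points is near 1 or near -1. In both cases the imaginary part of the quotient is at most
      \<open>1 / (4 K)\<close>, which is why \<open>sep\<close> measures imaginary parts and not
      distances.\<close>
    have disj: "(\<lambda>j. j + s i) ` S \<inter> (\<lambda>j. j + s i') ` S = {}" if i: "i' < i" "i < K" for i i'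
    proof (rule ccontr)
      assume "\<not> ?thesis"
      then obtain j j' where j: "j \<in> S" "j' \<in> S" "j + s i = j' + s i'" by auto
      define u v where "u = R ^ j * w" "v = R ^ j' * w"
      have cu: "R ^ n * cnj (R ^ n) = 1" "w * cnj w = 1" for n
        using R w by (simp_all only: norm_power power_one of_real_1 flip: complex_norm_square)
      have "R ^ j * R ^ s i = R ^ j' * R ^ s i'" using j(3) by (simp flip: power_add)
      then have "R ^ j * R ^ s i * (cnj (R ^ s i') * cnj (R ^ j)) = R ^ j' * R ^ s i' * (cnj (R ^ s i') * cnj (R ^ j))"
        by simp
      then have "R ^ s i * cnj (R ^ s i') * (R ^ j * cnj (R ^ j)) = R ^ j' * cnj (R ^ j) * (R ^ s i' * cnj (R ^ s i'))"
        by (simp only: mult_ac)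
      then have "R ^ s i * cnj (R ^ s i') = R ^ j' * cnj (R ^ j)" unfolding cu by simp
      also have "\<dots> = v * cnj u * 1"
        unfolding cu(2)[symmetric] by (simp only: u_v_def complex_cnj_mult) (simp add: mult_ac cu(2))
      finally have "Im (R ^ s i * cnj (R ^ s i')) = Im v * Re u - Re v * Im u" by simp
      moreover have "cmod u = 1" "cmod v = 1" using R w by (simp_all add: u_v_def norm_mult norm_power)
      then have "\<bar>Im u\<bar> \<le> 1" "\<bar>Im v\<bar> \<le> 1" using abs_Im_le_cmod[of u] abs_Im_le_cmod[of v] by simp_all
      moreover have "\<bar>Re u\<bar> \<le> 1 / (8 * real K)" "\<bar>Re v\<bar> \<le> 1 / (8 * real K)"
        using j(1,2) by (simp_all only: S_def u_v_def mem_Collect_eq)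
      ultimately have "\<bar>Im v * Re u\<bar> \<le> 1 * (1 / (8 * real K))" "\<bar>Re v * Im u\<bar> \<le> (1 / (8 * real K)) * 1"
        unfolding abs_mult by (intro mult_mono; simp)+
      moreover note \<open>Im (R ^ s i * cnj (R ^ s i')) = Im v * Re u - Re v * Im u\<close>
      ultimately have "\<bar>Im (R ^ s i * cnj (R ^ s i'))\<bar> \<le> 1 / (8 * real K) + 1 / (8 * real K)" by linarith
      also have "\<dots> = 1 / (4 * real K)" by simp
      finally show False using sep[OF i] by linarith
    qed
    have "K * card S = (\<Sum>i<K. card ((\<lambda>j. j + s i) ` S))"
      by (simp add: card_image inj_on_def)
    also have "\<dots> = card (\<Union>i<K. (\<lambda>j. j + s i) ` S)"
    proof (rule card_UN_disjoint[symmetric])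
      show "\<forall>i\<in>{..<K}. \<forall>j\<in>{..<K}. i \<noteq> j \<longrightarrow> (\<lambda>ja. ja + s i) ` S \<inter> (\<lambda>ja. ja + s j) ` S = {}"
      proof (intro ballI impI)
        fix i j assume "i \<in> {..<K}" "j \<in> {..<K}" "i \<noteq> j"
        then show "(\<lambda>ja. ja + s i) ` S \<inter> (\<lambda>ja. ja + s j) ` S = {}"
          using disj[of i j] disj[of j i] by (cases "i < j") auto
      qed
    qed (use fS in auto)
    also have "\<dots> \<le> card {..<q + Q}"
    proof (intro card_mono UN_least)
      fix i assume "i \<in> {..<K}"
      then have "s i \<le> Q" unfolding Q_def by (intro member_le_sum) auto
      then show "(\<lambda>j. j + s i) ` S \<subseteq> {..<q + Q}" by (auto simp: S_def)
    qed simp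
    finally show ?thesis unfolding S_def by simp
  qed
  then show ?thesis by blast
qed

text \<open>For \<eta> below 1/32 the integer part \<open>K\<close> of \<open>1 / (8 \<eta>)\<close>
  is at least \<open>1 / (16 \<eta>)\<close>; together with the bound \<open>2 q\<close> for
  \<open>q + Q K\<close> this gives the factor 32. For larger \<eta> the bound is trivial. The lower
  bound \<open>\<eta>0\<close> leaves only finitely many \<open>K\<close>, hence one
  \<open>Q\<close> for all \<eta> and all starting points.\<close>

lemma rotation_count:
  assumes dense: "\<And>x e. 0 < e \<Longrightarrow> \<exists>n. cmod (R ^ n - cis x) < e" and R: "cmod R = 1" and \<eta>0: "0 < \<eta>0"
  shows "\<exists>Q. \<forall>q w \<eta>. Q \<le> q \<longrightarrow> cmod w = 1 \<longrightarrow> \<eta>0 \<le> \<eta> \<longrightarrow> real (card {j. j < q \<and> \<bar>Re (R ^ j * w)\<bar> \<le> \<eta>}) \<le> 32 * \<eta> * real q"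
proof -
  have "\<forall>K. \<exists>Q. \<forall>q w. 0 < K \<longrightarrow> cmod w = 1 \<longrightarrow> K * card {j. j < q \<and> \<bar>Re (R ^ j * w)\<bar> \<le> 1 / (8 * real K)} \<le> q + Q"
  proof
    fix K
    show "\<exists>Q. \<forall>q w. 0 < K \<longrightarrow> cmod w = 1 \<longrightarrow> K * card {j. j < q \<and> \<bar>Re (R ^ j * w)\<bar> \<le> 1 / (8 * real K)} \<le> q + Q"
      using rotation_visits[OF dense R, of K] by (cases "0 < K") auto
  qed
  from choice[OF this] obtain Q where
    Q: "\<forall>K. \<forall>q w. 0 < K \<longrightarrow> cmod w = 1 \<longrightarrow> K * card {j. j < q \<and> \<bar>Re (R ^ j * w)\<bar> \<le> 1 / (8 * real K)} \<le> q + Q K" ..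
  define K0 where "K0 = nat \<lfloor>1 / (8 * \<eta>0)\<rfloor>"
  have "real (card {j. j < q \<and> \<bar>Re (R ^ j * w)\<bar> \<le> \<eta>}) \<le> 32 * \<eta> * real q"
    if q: "(\<Sum>K\<le>K0. Q K) \<le> q" and w: "cmod w = 1" and \<eta>: "\<eta>0 \<le> \<eta>" for q w \<eta>
  proof (cases "1 \<le> 32 * \<eta>")
    case True
    have "card {j. j < q \<and> \<bar>Re (R ^ j * w)\<bar> \<le> \<eta>} \<le> card {..<q}" by (intro card_mono) auto
    then have "real (card {j. j < q \<and> \<bar>Re (R ^ j * w)\<bar> \<le> \<eta>}) \<le> 1 * real q" by simp
    also have "\<dots> \<le> 32 * \<eta> * real q" using True by (intro mult_right_mono) auto
    finally show ?thesis .
  next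
    case False
    have pos: "0 < \<eta>" using \<eta> \<eta>0 by simp
    define K where "K = nat \<lfloor>1 / (8 * \<eta>)\<rfloor>"
    have "4 \<le> 1 / (8 * \<eta>)" using False pos by (simp add: field_simps)
    moreover have "0 \<le> \<lfloor>1 / (8 * \<eta>)\<rfloor>" using pos by simp
    then have "real K = of_int \<lfloor>1 / (8 * \<eta>)\<rfloor>" unfolding K_def by simp
    ultimately have K: "real K \<le> 1 / (8 * \<eta>)" "1 / (8 * \<eta>) - 1 < real K" "0 < K" "1 / (16 * \<eta>) \<le> real K"
      by linarith+
    have "1 / (8 * \<eta>) \<le> 1 / (8 * \<eta>0)" using \<eta> \<eta>0 by (intro divide_left_mono) auto
    then have "K \<le> K0" unfolding K_def K0_def by (intro nat_mono floor_mono)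
    then have "Q K \<le> (\<Sum>K\<le>K0. Q K)" by (intro member_le_sum) auto
    then have "Q K \<le> q" using q by simp
    let ?c = "card {j. j < q \<and> \<bar>Re (R ^ j * w)\<bar> \<le> \<eta>}"
    have "\<eta> \<le> 1 / (8 * real K)" using K(1,3) pos by (simp add: field_simps)
    then have "?c \<le> card {j. j < q \<and> \<bar>Re (R ^ j * w)\<bar> \<le> 1 / (8 * real K)}" by (intro card_mono) auto
    then have "K * ?c \<le> K * card {j. j < q \<and> \<bar>Re (R ^ j * w)\<bar> \<le> 1 / (8 * real K)}" by (rule mult_le_mono2)
    also have "\<dots> \<le> 2 * q" using Q[rule_format, OF K(3) w, of q] \<open>Q K \<le> q\<close> by linarith
    finally have "real (K * ?c) \<le> real (2 * q)" by (rule of_nat_mono)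
    then have "real K * real ?c \<le> 2 * real q" by simp
    moreover have "1 / (16 * \<eta>) * real ?c \<le> real K * real ?c" using K(4) by (rule mult_right_mono) simp
    ultimately have "1 / (16 * \<eta>) * real ?c \<le> 2 * real q" by linarith
    then show ?thesis using pos by (simp add: field_simps)
  qed
  then show ?thesis by blast
qed

section \<open>Correlation sums\<close>

definition corr_sum :: "complex measure \<Rightarrow> real \<Rightarrow> real" where
  "corr_sum \<nu> \<delta> = (LINT x|\<nu>. measure \<nu> (cball x \<delta>))"

lemma corr_sum_bounds:
  assumes "prob_space \<nu>"
  shows "0 \<le> corr_sum \<nu> \<delta>" "corr_sum \<nu> \<delta> \<le> 1"
proof -
  interpret prob_space \<nu> by fact
  show "0 \<le> corr_sum \<nu> \<delta>" unfolding corr_sum_def by (intro integral_nonneg_AE) auto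
  show "corr_sum \<nu> \<delta> \<le> 1"
  proof (cases "integrable \<nu> (\<lambda>x. measure \<nu> (cball x \<delta>))")
    case True
    then show ?thesis unfolding corr_sum_def by (intro integral_le_const) (auto intro: prob_le_1)
  qed (simp add: corr_sum_def not_integrable_integral_eq)
qed

lemma corr_sum_power_bound:
  assumes "prob_space \<nu>" "correlation_dim \<nu> > 1"
  shows "\<exists>s C. 1 < s \<and> 0 < C \<and> (\<forall>\<delta>>0. corr_sum \<nu> \<delta> \<le> C * \<delta> powr s)"
proof -
  obtain s where s: "ereal 1 < ereal s" "ereal s < correlation_dim \<nu>"
    using ereal_dense2[of 1 "correlation_dim \<nu>"] assms(2) by (auto simp: one_ereal_def)
  have "\<forall>\<^sub>F \<delta> in at_right 0. ereal s < ereal (ln (corr_sum \<nu> \<delta>) / ln \<delta>)"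
    using less_LiminfD[OF s(2)[unfolded correlation_dim_def]] by (simp only: corr_sum_def)
  then obtain b where b: "0 < b" "\<And>\<delta>. 0 < \<delta> \<Longrightarrow> \<delta> < b \<Longrightarrow> s < ln (corr_sum \<nu> \<delta>) / ln \<delta>"
    unfolding eventually_at_right_field by auto
  define d where "d = min b 1"
  have d: "0 < d" "d \<le> 1" "d \<le> b" using b(1) by (auto simp: d_def)
  have small: "corr_sum \<nu> \<delta> \<le> \<delta> powr s" if "0 < \<delta>" "\<delta> < d" for \<delta>
  proof -
    have ln: "ln \<delta> < 0" using that d by simp
    have l: "s < ln (corr_sum \<nu> \<delta>) / ln \<delta>" using b(2) that d by simp
    \<comment> \<open>Since \<open>ln 0 = 0\<close>, a vanishing correlation sum would make the
      quotient 0, which is not above \<open>s\<close>.\<close>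
    then have "corr_sum \<nu> \<delta> \<noteq> 0" using s(1) by auto
    then have pos: "0 < corr_sum \<nu> \<delta>" using corr_sum_bounds(1)[OF assms(1), of \<delta>] by linarith
    have "ln (corr_sum \<nu> \<delta>) < s * ln \<delta>" using l ln by (simp add: neg_less_divide_eq)
    then have "exp (ln (corr_sum \<nu> \<delta>)) \<le> exp (s * ln \<delta>)" by simp
    then show ?thesis using pos that by (simp add: powr_def)
  qed
  have sp: "0 < s" using s(1) by simp
  \<comment> \<open>The first summand serves \<delta> from \<open>d\<close> on, where the
    correlation sum is bounded by 1; the second serves small \<delta>.\<close>
  define C where "C = d powr (- s) + 1"
  have "corr_sum \<nu> \<delta> \<le> C * \<delta> powr s" if "0 < \<delta>" for \<delta>
  proof (cases "\<delta> < d")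
    case True
    have "\<delta> powr s \<le> C * \<delta> powr s" unfolding C_def by (simp add: distrib_right)
    then show ?thesis using small[OF that True] by linarith
  next
    case False
    have "1 = d powr (- s) * d powr s" using d by (simp add: powr_minus)
    also have "\<dots> \<le> C * \<delta> powr s" using False d sp unfolding C_def by (intro mult_mono powr_mono2) auto
    finally show ?thesis using corr_sum_bounds(2)[OF assms(1), of \<delta>] by linarith
  qed
  moreover have "0 < C" using d(1) by (simp add: C_def add_pos_nonneg)
  ultimately show ?thesis using s(1) by auto
qed

lemma corr_sum_nn_integral:
  assumes "prob_space \<nu>" and s: "sets \<nu> = sets borel"
  shows "(\<lambda>x. emeasure \<nu> (cball x \<delta>)) \<in> borel_measurable borel"
    and "ennreal (corr_sum \<nu> \<delta>) = (\<integral>\<^sup>+x. emeasure \<nu> (cball x \<delta>) \<partial>\<nu>)"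
proof -
  interpret prob_space \<nu> by fact
  have "{p :: complex \<times> complex. dist (fst p) (snd p) \<le> \<delta>} \<in> sets (borel \<Otimes>\<^sub>M borel)"
    unfolding borel_prod by (intro borel_closed closed_Collect_le continuous_intros)
  then have "{p :: complex \<times> complex. dist (fst p) (snd p) \<le> \<delta>} \<in> sets (borel \<Otimes>\<^sub>M \<nu>)"
    using sets_pair_measure_cong[OF refl s, of "borel :: complex measure"] by simp
  from measurable_emeasure_Pair[OF this]
  show m: "(\<lambda>x. emeasure \<nu> (cball x \<delta>)) \<in> borel_measurable borel"
    by (simp add: cball_def vimage_def)
  then have m': "(\<lambda>x. emeasure \<nu> (cball x \<delta>)) \<in> borel_measurable \<nu>"
    unfolding measurable_cong_sets[OF s refl] .
  then have "(\<lambda>x. measure \<nu> (cball x \<delta>)) \<in> borel_measurable \<nu>"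
    unfolding measure_def by measurable
  then have "integrable \<nu> (\<lambda>x. measure \<nu> (cball x \<delta>))"
    by (intro integrable_const_bound[of _ 1]) (auto intro: prob_le_1)
  then show "ennreal (corr_sum \<nu> \<delta>) = (\<integral>\<^sup>+x. emeasure \<nu> (cball x \<delta>) \<partial>\<nu>)"
    unfolding corr_sum_def emeasure_eq_measure by (subst nn_integral_eq_integral) auto
qed

text \<open>A point of \<nu> is the end of a walk of length \<open>n\<close> plus an independent
  tail of size at most \<open>A / (1 - cmod l) * cmod l ^ n\<close>. If two independent walks end
  within \<rho> of each other, the two points of \<nu> completing them are within \<rho> plus two
  tail sizes.\<close>

lemma prob_walk_le_corr_sum:
  assumes l: "cmod l < 1" and fin: "finite (set_pmf \<alpha>)" and A: "\<And>c. c \<in> set_pmf \<alpha> \<Longrightarrow> cmod c \<le> A"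
    and st: "stationary l \<alpha> \<nu>"
  shows "measure_pmf.prob (walk l (diff_pmf \<alpha>) n) (cball 0 \<rho>)
    \<le> corr_sum \<nu> (\<rho> + 2 * (A / (1 - cmod l)) * cmod l ^ n)"
proof -
  let ?D = "A / (1 - cmod l)"
  define \<delta> where "\<delta> = \<rho> + 2 * ?D * cmod l ^ n"
  interpret prob_space \<nu> by (rule stationary_prob_space[OF st])
  note s = stationary_sets[OF st]
  have AE: "AE x in \<nu>. cmod x \<le> ?D" by (rule stationary_AE_bound[OF l fin A st])
  have "emeasure (walk l (diff_pmf \<alpha>) n) (cball 0 \<rho>)
    = (\<integral>\<^sup>+x. \<integral>\<^sup>+y. indicator (cball 0 \<rho>) (x + - 1 * y) \<partial>walk l \<alpha> n \<partial>walk l \<alpha> n)"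
    unfolding walk_diff unfolding diff_pmf_def
    by (simp add: nn_integral_conv_pmf del: nn_integral_indicator flip: nn_integral_indicator)
  also have "\<dots> \<le> (\<integral>\<^sup>+x. \<integral>\<^sup>+u. emeasure \<nu> (cball (x + l ^ n * u) \<delta>) \<partial>\<nu> \<partial>walk l \<alpha> n)"
  proof (intro nn_integral_mono)
    fix x
    have inner: "(\<integral>\<^sup>+y. indicator (cball 0 \<rho>) (x + - 1 * y) \<partial>walk l \<alpha> n) \<le> emeasure \<nu> (cball (x + l ^ n * u) \<delta>)"
      if u: "cmod u \<le> ?D" for u
    proof -
      have pt: "(indicator (cball 0 \<rho>) (x + - 1 * y) :: ennreal) \<le> indicator (cball (x + l ^ n * u) \<delta>) (y + l ^ n * v)"
        if v: "cmod v \<le> ?D" for y v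
      proof -
        have "cmod (u - v) \<le> 2 * ?D" using norm_triangle_ineq4[of u v] u v by linarith
        then have "cmod (l ^ n * (u - v)) \<le> 2 * ?D * cmod l ^ n"
          using mult_right_mono[of "cmod (u - v)" "2 * ?D" "cmod l ^ n"] by (simp add: norm_mult norm_power mult.commute)
        moreover have "dist (x + l ^ n * u) (y + l ^ n * v) \<le> cmod (x - y) + cmod (l ^ n * (u - v))"
          unfolding dist_norm using norm_triangle_ineq[of "x - y" "l ^ n * (u - v)"] by (simp add: algebra_simps)
        ultimately have "dist (x + l ^ n * u) (y + l ^ n * v) \<le> \<delta>" if "cmod (x - y) \<le> \<rho>"
          using that unfolding \<delta>_def by linarith
        then show ?thesis by (auto split: split_indicator)
      qed
      have "(\<integral>\<^sup>+y. indicator (cball 0 \<rho>) (x + - 1 * y) \<partial>walk l \<alpha> n)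
         = (\<integral>\<^sup>+y. (\<integral>\<^sup>+v. indicator (cball 0 \<rho>) (x + - 1 * y) \<partial>\<nu>) \<partial>walk l \<alpha> n)"
        by (simp add: emeasure_space_1)
      also have "\<dots> \<le> (\<integral>\<^sup>+y. (\<integral>\<^sup>+v. indicator (cball (x + l ^ n * u) \<delta>) (y + l ^ n * v) \<partial>\<nu>) \<partial>walk l \<alpha> n)"
        by (rule nn_integral_mono, rule nn_integral_mono_AE, rule eventually_mono[OF AE], rule pt)
      also have "\<dots> = (\<integral>\<^sup>+w. indicator (cball (x + l ^ n * u) \<delta>) w \<partial>\<nu>)"
        by (rule stationary_steps[OF st, symmetric], rule borel_measurable_indicator) simp
      also have "\<dots> = emeasure \<nu> (cball (x + l ^ n * u) \<delta>)" by (simp add: s)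
      finally show ?thesis .
    qed
    have "(\<integral>\<^sup>+y. indicator (cball 0 \<rho>) (x + - 1 * y) \<partial>walk l \<alpha> n)
       = (\<integral>\<^sup>+u. (\<integral>\<^sup>+y. indicator (cball 0 \<rho>) (x + - 1 * y) \<partial>walk l \<alpha> n) \<partial>\<nu>)"
      by (simp add: emeasure_space_1)
    also have "\<dots> \<le> (\<integral>\<^sup>+u. emeasure \<nu> (cball (x + l ^ n * u) \<delta>) \<partial>\<nu>)"
      by (rule nn_integral_mono_AE, rule eventually_mono[OF AE], rule inner)
    finally show "(\<integral>\<^sup>+y. indicator (cball 0 \<rho>) (x + - 1 * y) \<partial>walk l \<alpha> n) \<le> (\<integral>\<^sup>+u. emeasure \<nu> (cball (x + l ^ n * u) \<delta>) \<partial>\<nu>)" .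
  qed
  also have "\<dots> = (\<integral>\<^sup>+w. emeasure \<nu> (cball w \<delta>) \<partial>\<nu>)"
    by (rule stationary_steps[OF st, symmetric]) (rule corr_sum_nn_integral(1)[OF prob_space_axioms s])
  also have "\<dots> = ennreal (corr_sum \<nu> \<delta>)" using corr_sum_nn_integral(2)[OF prob_space_axioms s] by simp
  finally show ?thesis
    using corr_sum_bounds(1)[OF prob_space_axioms] by (simp add: measure_pmf.emeasure_eq_measure \<delta>_def)
qed

lemma power_powr_commute: "0 < a \<Longrightarrow> (a ^ n) powr s = (a powr s :: real) ^ n"
  by (induction n) (simp_all add: powr_mult)

lemma pmf_map_times_0_ge: "pmf w 0 \<le> pmf (map_pmf ((*) (b::complex)) w) 0"
proof -
  have "measure_pmf.prob w {0} \<le> measure_pmf.prob w ((*) b -` {0})"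
    by (intro measure_pmf.finite_measure_mono) auto
  then show ?thesis by (simp add: pmf_map measure_pmf_single)
qed

text \<open>Deleting every \<open>(j+1)\<close>-st digit costs a factor \<open>pmf (diff_pmf \<alpha>) 0\<close> per block in the correlation
  sums, which for long blocks is negligible against the gain from \<open>s > 1\<close>.\<close>

lemma sparse_walk_bound:
  assumes l: "cmod l < 1" "l \<noteq> 0" and fin: "finite (set_pmf \<alpha>)" and A: "\<And>c. c \<in> set_pmf \<alpha> \<Longrightarrow> cmod c \<le> A"
    and st: "stationary l \<alpha> \<nu>" and s: "1 < s" "0 < C" "\<And>\<delta>. 0 < \<delta> \<Longrightarrow> corr_sum \<nu> \<delta> \<le> C * \<delta> powr s"
  shows "\<exists>j C' \<theta>. 0 < C' \<and> 0 < \<theta> \<and> \<theta> < cmod l ^ Suc j \<and>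
    (\<forall>n N. n \<le> N \<longrightarrow> measure_pmf.prob (walk (l ^ Suc j) (diff_pmf (walk l \<alpha> j)) N) (cball 0 (cmod l ^ (Suc j * n))) \<le> C' * \<theta> ^ n)"
proof -
  define r where "r = cmod l"
  have r: "0 < r" "r < 1" using l by (auto simp: r_def)
  define c where "c = pmf (diff_pmf \<alpha>) 0"
  have c: "0 < c" unfolding c_def by (rule pmf_diff_0_pos)
  have "r powr (s - 1) < 1" using r s(1) powr_less_mono2[of "s - 1" r 1] by simp
  then have "(\<lambda>n. (r powr (s - 1)) ^ n) \<longlonglongrightarrow> 0" by (intro LIMSEQ_power_zero) auto
  from order_tendstoD(2)[OF this c] obtain j where j: "(r powr (s - 1)) ^ j < c"
    by (auto simp: eventually_sequentially)
  have j': "(r powr (s - 1)) ^ Suc j < c"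
    using j \<open>r powr (s - 1) < 1\<close> mult_left_le_one_le[of "(r powr (s - 1)) ^ j" "r powr (s - 1)"] by auto
  define k where "k = l ^ Suc j"
  have k: "cmod k = r ^ Suc j" by (simp add: k_def r_def norm_power norm_mult)
  define W where "W = diff_pmf (walk l \<alpha> j)"
  define V where "V = map_pmf ((*) (l ^ j)) (diff_pmf \<alpha>)"
  \<comment> \<open>Per block the correlation sum of \<nu> shrinks by
    \<open>(r ^ Suc j) powr s\<close>, and the deleted digit divides this by \<open>c\<close>. That
    \<theta> stays below \<open>r ^ Suc j\<close>, which is \<open>cmod k\<close>, means that the
    sparse walk keeps a correlation exponent above 1.\<close>
  define \<theta> where "\<theta> = (r ^ Suc j) powr s / c"
  have rj: "0 < r ^ Suc j" "r ^ Suc j < 1" using r power_Suc_less_one[of r j] by (simp_all only: zero_less_power)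
  have \<theta>: "0 < \<theta>" unfolding \<theta>_def using c rj(1) by (intro divide_pos_pos) (simp_all only: powr_gt_zero)
  have "(r ^ Suc j) powr s = r ^ Suc j * (r ^ Suc j) powr (s - 1)"
    using rj(1) by (simp add: powr_diff)
  also have "(r ^ Suc j) powr (s - 1) = (r powr (s - 1)) ^ Suc j"
    by (rule power_powr_commute[OF r(1)])
  finally have "(r ^ Suc j) powr s < r ^ Suc j * c" using j' rj(1) by (simp only: mult_strict_left_mono)
  then have \<theta>1: "\<theta> < r ^ Suc j" using c by (simp add: \<theta>_def divide_less_eq)
  have split: "walk l (diff_pmf \<alpha>) (Suc j * n) = conv_pmf (walk k W n) (walk k V n)" for n
  proof -
    have "walk l (diff_pmf \<alpha>) (Suc j) = conv_pmf W V"
      using walk_add[of l "diff_pmf \<alpha>" j "Suc 0"] by (simp add: W_def V_def walk_diff)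
    then show ?thesis unfolding k_def walk_mult[symmetric] by (simp only: walk_conv)
  qed
  have V0: "c \<le> pmf V 0" unfolding c_def V_def by (rule pmf_map_times_0_ge)
  obtain A' where A': "\<And>d. d \<in> set_pmf W \<Longrightarrow> cmod d \<le> A'" "0 < A'"
  proof
    have fW: "finite (set_pmf W)" using fin by (simp add: W_def)
    show "cmod d \<le> Max (cmod ` set_pmf W) + 1" if "d \<in> set_pmf W" for d
    proof -
      have "cmod d \<le> Max (cmod ` set_pmf W)" using fW that by (intro Max_ge) auto
      then show ?thesis by simp
    qed
    show "0 < Max (cmod ` set_pmf W) + 1"
    proof -
      obtain d where d: "d \<in> set_pmf W" using set_pmf_not_empty[of W] by blast
      have "cmod d \<le> Max (cmod ` set_pmf W)" using fW d by (intro Max_ge) auto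
      then show ?thesis using norm_ge_zero[of d] by linarith
    qed
  qed
  define D where "D = A' / (1 - cmod k)"
  have kl: "cmod k < 1" using rj by (simp only: k)
  then have D: "0 < D" using A'(2) by (simp add: D_def)
  \<comment> \<open>Total radius in units of \<open>R\<close> below: 1 for the ball itself,
    \<open>D\<close> for cutting the walk from \<open>N\<close> to \<open>n\<close> steps, and the
    last term for completing walks to points of \<nu>.\<close>
  define E where "E = 1 + D + 2 * (A / (1 - r))"
  have "0 \<le> A" using A set_pmf_not_empty[of \<alpha>] norm_ge_zero order_trans by blast
  then have E: "0 < E" using D r by (simp add: E_def add_pos_nonneg)
  have main: "measure_pmf.prob (walk k W N) (cball 0 (r ^ (Suc j * n))) \<le> C * E powr s * \<theta> ^ n" if nN: "n \<le> N" for n N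
  proof -
    define R where "R = r ^ (Suc j * n)"
    have kn: "cmod k ^ n = R" by (simp only: k R_def power_mult)
    have R: "0 < R" using r by (simp add: R_def)
    have cn: "0 < c ^ n" using c by simp
    have "measure_pmf.prob (walk k W N) (cball 0 R) \<le> measure_pmf.prob (walk k W n) (cball 0 (R + D * R))"
      using prob_walk_truncate[OF A'(1) kl nN, where \<rho> = R] by (simp add: kn D_def)
    moreover have "measure_pmf.prob (walk k W n) (cball 0 (R + D * R)) * c ^ n \<le> C * E powr s * R powr s"
    proof -
      have "measure_pmf.prob (walk k W n) (cball 0 (R + D * R)) * c ^ n \<le> measure_pmf.prob (walk k W n) (cball 0 (R + D * R)) * pmf (walk k V n) 0"
        using pmf_walk_0_ge[of V n k] power_mono[OF V0, of n] c by (intro mult_left_mono) auto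
      also have "\<dots> \<le> measure_pmf.prob (walk l (diff_pmf \<alpha>) (Suc j * n)) (cball 0 (R + D * R))"
        unfolding split by (rule prob_conv_pmf_ge)
      also have "\<dots> \<le> corr_sum \<nu> (R + D * R + 2 * (A / (1 - cmod l)) * cmod l ^ (Suc j * n))"
        by (rule prob_walk_le_corr_sum[OF l(1) fin A st])
      also have "R + D * R + 2 * (A / (1 - cmod l)) * cmod l ^ (Suc j * n) = E * R"
        unfolding E_def r_def[symmetric] R_def[symmetric] by (simp add: algebra_simps)
      also have "corr_sum \<nu> (E * R) \<le> C * (E * R) powr s" using E R by (intro s(3)) simp
      also have "\<dots> = C * E powr s * R powr s" using E R by (simp add: powr_mult)
      finally show ?thesis .
    qed
    ultimately have "measure_pmf.prob (walk k W N) (cball 0 R) * c ^ n \<le> C * E powr s * R powr s"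
      using cn by (meson less_imp_le mult_right_mono order_trans)
    then have "measure_pmf.prob (walk k W N) (cball 0 R) \<le> C * E powr s * (R powr s / c ^ n)"
      using cn by (simp add: field_simps)
    also have "R powr s / c ^ n = \<theta> ^ n"
    proof -
      have "R = (r ^ Suc j) ^ n" by (simp only: R_def power_mult)
      also have "\<dots> powr s = ((r ^ Suc j) powr s) ^ n"
        by (rule power_powr_commute[OF rj(1)])
      finally show ?thesis by (simp add: \<theta>_def power_divide)
    qed
    finally show ?thesis unfolding R_def .
  qed
  have "0 < C * E powr s" using s(2) E by simp
  with main \<theta> \<theta>1 show ?thesis unfolding k_def W_def r_def by blast
qed

section \<open>Correlations of projections\<close>

text \<open>A tent instead of a sharp cutoff: a shift never raises its mean under the law of a
  difference, whereas for the indicator of an interval this can fail.\<close>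

definition tri :: "real \<Rightarrow> real" where "tri u = max 0 (1 - \<bar>u\<bar>)"

lemma tri_nonneg: "0 \<le> tri u" and tri_le_1: "tri u \<le> 1" and tri_eq_0: "1 \<le> \<bar>u\<bar> \<Longrightarrow> tri u = 0"
  by (auto simp: tri_def)

lemma tri_eq_nn_integral:
  "ennreal (tri (x - y)) = (\<integral>\<^sup>+s. indicator {x..x+1} s * indicator {y..y+1} s \<partial>lborel)"
proof -
  have "(\<integral>\<^sup>+s. indicator {x..x+1} s * indicator {y..y+1} s \<partial>lborel)
    = (\<integral>\<^sup>+s. indicator {max x y..min x y + 1} s \<partial>lborel)"
    by (intro nn_integral_cong) (auto split: split_indicator)
  also have "\<dots> = ennreal (tri (x - y))"
    by (cases "x \<le> y"; cases "\<bar>x - y\<bar> \<le> 1") (auto simp: tri_def max_def min_def ennreal_neg)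
  finally show ?thesis by simp
qed

text \<open>\<open>tri\<close> is the autocorrelation of an interval, hence positive definite.\<close>

lemma tri_shift_le:
  fixes f :: "complex \<Rightarrow> real"
  assumes fin: "finite (set_pmf w)" and f: "\<And>x y. f (x + y) = f x + f y" "\<And>x. f (- x) = - f x"
  shows "measure_pmf.expectation (diff_pmf w) (\<lambda>d. tri (c + f d)) \<le> measure_pmf.expectation (diff_pmf w) (\<lambda>d. tri (f d))"
proof -
  let ?S = "set_pmf w"
  define g where "g s = (\<Sum>x\<in>?S. ennreal (pmf w x) * indicator {f x..f x + 1} s)" for s
  have g[measurable]: "g \<in> borel_measurable borel" unfolding g_def by measurable
  have exp: "ennreal (measure_pmf.expectation (diff_pmf w) (\<lambda>d. tri (c + f d))) = (\<integral>\<^sup>+s. g (s - c) * g s \<partial>lborel)" for c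
  proof -
    have "ennreal (measure_pmf.expectation (diff_pmf w) (\<lambda>d. tri (c + f d)))
      = (\<integral>\<^sup>+d. ennreal (tri (c + f d)) \<partial>diff_pmf w)"
      using fin by (subst nn_integral_eq_integral) (auto simp: tri_nonneg intro!: integrable_measure_pmf_finite)
    also have "\<dots> = (\<Sum>x\<in>?S. \<Sum>y\<in>?S. ennreal (pmf w x) * ennreal (pmf w y) * ennreal (tri ((f x + c) - f y)))"
    proof -
      have "c + f (x + - 1 * y) = (f x + c) - f y" for x y using f(1)[of x "- y"] f(2)[of y] by simp
      then have "(\<integral>\<^sup>+d. ennreal (tri (c + f d)) \<partial>diff_pmf w) = (\<integral>\<^sup>+x. \<integral>\<^sup>+y. ennreal (tri ((f x + c) - f y)) \<partial>w \<partial>w)"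
        unfolding diff_pmf_def by (simp only: nn_integral_conv_pmf nn_integral_map_pmf)
      also have "\<dots> = (\<Sum>x\<in>?S. (\<Sum>y\<in>?S. ennreal (tri ((f x + c) - f y)) * ennreal (pmf w y)) * ennreal (pmf w x))"
        by (subst nn_integral_measure_pmf_finite[OF fin], simp)+ simp
      also have "\<dots> = (\<Sum>x\<in>?S. \<Sum>y\<in>?S. ennreal (pmf w x) * ennreal (pmf w y) * ennreal (tri ((f x + c) - f y)))"
        unfolding sum_distrib_right by (intro sum.cong refl) (simp only: mult_ac)
      finally show ?thesis .
    qed
    also have "\<dots> = (\<Sum>x\<in>?S. \<Sum>y\<in>?S. (\<integral>\<^sup>+s. ennreal (pmf w x) * ennreal (pmf w y) * (indicator {f x + c..f x + c + 1} s * indicator {f y..f y + 1} s) \<partial>lborel))"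
      unfolding tri_eq_nn_integral by (simp add: nn_integral_cmult)
    also have "\<dots> = (\<integral>\<^sup>+s. (\<Sum>x\<in>?S. \<Sum>y\<in>?S. ennreal (pmf w x) * ennreal (pmf w y) * (indicator {f x + c..f x + c + 1} s * indicator {f y..f y + 1} s)) \<partial>lborel)"
      by (simp add: nn_integral_sum)
    also have "\<dots> = (\<integral>\<^sup>+s. g (s - c) * g s \<partial>lborel)"
    proof (intro nn_integral_cong)
      fix s
      have "(indicator {f x + c..f x + c + 1} s :: ennreal) = indicator {f x..f x + 1} (s - c)" for x
        by (auto split: split_indicator)
      then show "(\<Sum>x\<in>?S. \<Sum>y\<in>?S. ennreal (pmf w x) * ennreal (pmf w y) * (indicator {f x + c..f x + c + 1} s * indicator {f y..f y + 1} s)) = g (s - c) * g s"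
        unfolding g_def sum_product by (intro sum.cong refl) (simp only: mult_ac)
    qed
    finally show ?thesis .
  qed
  have gfin: "g s < \<top>" for s
    unfolding g_def using fin by (subst ennreal_sum_less_top) (auto simp: ennreal_mult_less_top split: split_indicator)
  \<comment> \<open>This stands in for the Cauchy-Schwarz inequality. The two squares have the same
    integral by translation invariance, so nothing is lost.\<close>
  have amgm: "a * b \<le> (a * a + b * b) / 2" if ab: "a < \<top>" "b < \<top>" for a b :: ennreal
  proof -
    obtain x y where xy: "a = ennreal x" "0 \<le> x" "b = ennreal y" "0 \<le> y" using ab by (cases a; cases b) auto
    have "x * y \<le> (x * x + y * y) / 2" using sum_squares_bound[of x y] by (simp add: power2_eq_square)
    then show ?thesis
      using xy by (simp add: ennreal_mult[symmetric] ennreal_plus[symmetric] ennreal_divide_numeral ennreal_leI del: ennreal_plus)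
  qed
  have "(\<integral>\<^sup>+s. g (s - c) * g s \<partial>lborel) \<le> (\<integral>\<^sup>+s. (g (s - c) * g (s - c) + g s * g s) / 2 \<partial>lborel)"
    by (intro nn_integral_mono amgm gfin)
  also have "\<dots> = ((\<integral>\<^sup>+s. g (s - c) * g (s - c) \<partial>lborel) + (\<integral>\<^sup>+s. g s * g s \<partial>lborel)) / 2"
    by (simp add: nn_integral_divide nn_integral_add)
  also have "(\<integral>\<^sup>+s. g (s - c) * g (s - c) \<partial>lborel) = (\<integral>\<^sup>+s. g s * g s \<partial>lborel)"
    using nn_integral_real_affine[of "\<lambda>s. g s * g s" 1 "- c"] by simp
  also have "((\<integral>\<^sup>+s. g s * g s \<partial>lborel) + (\<integral>\<^sup>+s. g s * g s \<partial>lborel)) / 2 = (\<integral>\<^sup>+s. g s * g s \<partial>lborel)"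
    by (subst mult_2_right[symmetric], subst mult_divide_eq_ennreal) auto
  finally have "ennreal (measure_pmf.expectation (diff_pmf w) (\<lambda>d. tri (c + f d))) \<le> ennreal (measure_pmf.expectation (diff_pmf w) (\<lambda>d. tri (f d)))"
    using exp[of c] exp[of 0] by simp
  then show ?thesis by (subst (asm) ennreal_le_iff) (auto intro!: integral_nonneg_AE simp: tri_nonneg)
qed

text \<open>When \<open>v\<close> is the law of a difference, this is a smoothed correlation sum at
  scale \<rho> for the projection in direction \<open>z\<close>.\<close>

definition proj_corr :: "complex pmf \<Rightarrow> real \<Rightarrow> complex \<Rightarrow> real" where
  "proj_corr v \<rho> z = measure_pmf.expectation v (\<lambda>d. tri (Re (z * cnj d) / \<rho>))"

definition strip_prob :: "complex pmf \<Rightarrow> real \<Rightarrow> complex \<Rightarrow> real" where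
  "strip_prob v \<rho> z = measure_pmf.prob v {d. \<bar>Re (z * cnj d)\<bar> \<le> \<rho>}"

text \<open>Condition on the sample \<open>x\<close> of \<open>v\<close>. If its projection exceeds
  \<open>(1 + D) * cmod b\<close>, the second summand cannot bring it back to scale
  \<open>cmod b * \<rho>\<close>, since \<rho> is at most 1. Otherwise \<open>x\<close> merely
  shifts the tent, and \<open>tri_shift_le\<close> removes the shift. The direction turns because
  the projection of \<open>b * y\<close> along \<open>z\<close> is \<open>cmod b\<close> times that
  of \<open>y\<close> along \<open>z\<close> rotated by the argument of
  \<open>cnj b\<close>.\<close>

lemma proj_corr_conv_le:
  assumes fv: "finite (set_pmf v)" and fw: "finite (set_pmf w)" and z: "cmod z = 1" and b: "b \<noteq> 0" and \<rho>: "0 < \<rho>" "\<rho> \<le> 1"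
    and D: "\<And>d. d \<in> set_pmf (diff_pmf w) \<Longrightarrow> cmod d \<le> D"
  shows "proj_corr (conv_pmf v (map_pmf ((*) b) (diff_pmf w))) (cmod b * \<rho>) z
     \<le> strip_prob v ((1 + D) * cmod b) z * proj_corr (diff_pmf w) \<rho> (z * (cnj b / of_real (cmod b)))"
proof -
  let ?z' = "z * (cnj b / of_real (cmod b))"
  have cb: "0 < cmod b" using b by simp
  have eq: "Re (z * cnj (x + b * y)) / (cmod b * \<rho>) = Re (z * cnj x) / (cmod b * \<rho>) + Re (?z' * cnj y) / \<rho>" for x y
  proof -
    have "z * cnj (x + b * y) = z * cnj x + of_real (cmod b) * (?z' * cnj y)" using b by (simp add: algebra_simps)
    then have "Re (z * cnj (x + b * y)) = Re (z * cnj x) + cmod b * Re (?z' * cnj y)" by (simp only: plus_complex.simps Re_complex_of_real times_complex.simps Im_complex_of_real mult_zero_left diff_zero)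
    then show ?thesis using cb \<rho> by (simp only: add_divide_distrib) simp
  qed
  have "proj_corr (conv_pmf v (map_pmf ((*) b) (diff_pmf w))) (cmod b * \<rho>) z
    = measure_pmf.expectation v (\<lambda>x. measure_pmf.expectation (diff_pmf w) (\<lambda>y. tri (Re (z * cnj x) / (cmod b * \<rho>) + Re (?z' * cnj y) / \<rho>)))"
    unfolding proj_corr_def by (subst expectation_conv_pmf) (simp_all only: fv fw finite_set_diff_pmf set_map_pmf finite_imageI integral_map_pmf eq)
  also have "\<dots> \<le> measure_pmf.expectation v (\<lambda>x. indicator {d. \<bar>Re (z * cnj d)\<bar> \<le> (1 + D) * cmod b} x * proj_corr (diff_pmf w) \<rho> ?z')"
  proof (intro integral_mono)
    fix x
    show "measure_pmf.expectation (diff_pmf w) (\<lambda>y. tri (Re (z * cnj x) / (cmod b * \<rho>) + Re (?z' * cnj y) / \<rho>))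
      \<le> indicator {d. \<bar>Re (z * cnj d)\<bar> \<le> (1 + D) * cmod b} x * proj_corr (diff_pmf w) \<rho> ?z'"
    proof (cases "\<bar>Re (z * cnj x)\<bar> \<le> (1 + D) * cmod b")
      case True
      then show ?thesis
        using tri_shift_le[OF fw, of "\<lambda>y. Re (?z' * cnj y) / \<rho>" "Re (z * cnj x) / (cmod b * \<rho>)"]
        by (simp add: proj_corr_def distrib_left add_divide_distrib diff_divide_distrib)
    next
      case False
      have "tri (Re (z * cnj x) / (cmod b * \<rho>) + Re (?z' * cnj y) / \<rho>) = 0" if y: "y \<in> set_pmf (diff_pmf w)" for y
      proof (rule tri_eq_0)
        have "(1 + D) < \<bar>Re (z * cnj x)\<bar> / cmod b" using False cb by (simp add: field_simps)
        moreover have "\<bar>Re (?z' * cnj y)\<bar> \<le> D"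
          using abs_Re_le_cmod[of "?z' * cnj y"] D[OF y] z b by (simp add: norm_mult norm_divide)
        ultimately have "1 \<le> \<bar>Re (z * cnj x) / cmod b\<bar> - \<bar>Re (?z' * cnj y)\<bar>" using cb by simp
        also have "\<dots> \<le> \<bar>Re (z * cnj x) / cmod b + Re (?z' * cnj y)\<bar>" by linarith
        also have "\<dots> \<le> \<bar>Re (z * cnj x) / cmod b + Re (?z' * cnj y)\<bar> / \<rho>"
          using \<rho> by (simp add: le_divide_eq mult_left_le)
        also have "\<dots> = \<bar>Re (z * cnj x) / (cmod b * \<rho>) + Re (?z' * cnj y) / \<rho>\<bar>"
        proof -
          have "Re (z * cnj x) / (cmod b * \<rho>) + Re (?z' * cnj y) / \<rho> = (Re (z * cnj x) / cmod b + Re (?z' * cnj y)) / \<rho>"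
            by (simp only: add_divide_distrib divide_divide_eq_left)
          then show ?thesis by (simp only: abs_divide abs_of_pos[OF \<rho>(1)])
        qed
        finally show "1 \<le> \<bar>Re (z * cnj x) / (cmod b * \<rho>) + Re (?z' * cnj y) / \<rho>\<bar>" .
      qed
      then have "measure_pmf.expectation (diff_pmf w) (\<lambda>y. tri (Re (z * cnj x) / (cmod b * \<rho>) + Re (?z' * cnj y) / \<rho>)) = 0"
        by (intro integral_eq_zero_AE) (auto simp: AE_measure_pmf_iff)
      then show ?thesis using False by simp
    qed
  qed (auto intro!: integrable_measure_pmf_finite fv)
  also have "\<dots> = strip_prob v ((1 + D) * cmod b) z * proj_corr (diff_pmf w) \<rho> ?z'"
    by (simp add: strip_prob_def)
  finally show ?thesis .
qed

text \<open>Each block of \<open>M\<close> digits contributes a strip probability at its own scale;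
  the blocks after it are then seen in a direction turned by \<open>R\<close>.\<close>

lemma proj_corr_walk_le:
  fixes k :: complex and M :: nat
  defines "R \<equiv> (cnj k / of_real (cmod k)) ^ M"
  assumes fin: "finite (set_pmf w)" and k: "k \<noteq> 0" "cmod k < 1" and z: "cmod z = 1"
    and D: "\<And>n d. d \<in> set_pmf (walk k (diff_pmf w) n) \<Longrightarrow> cmod d \<le> D"
  shows "proj_corr (walk k (diff_pmf w) (M * q)) (cmod k ^ (M * q)) z
    \<le> (\<Prod>j<q. strip_prob (walk k (diff_pmf w) M) ((1 + D) * cmod k ^ M) (z * R ^ j))"
  using z
proof (induction q arbitrary: z)
  case 0
  then show ?case by (simp add: proj_corr_def tri_le_1)
next
  case (Suc q)
  have R: "cmod R = 1" using k by (simp add: R_def norm_power norm_divide)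
  have Rk: "cnj (k ^ M) / of_real (cmod (k ^ M)) = R" by (simp add: R_def norm_power power_divide)
  have "walk k (diff_pmf w) (M * Suc q) = conv_pmf (walk k (diff_pmf w) M) (map_pmf ((*) (k ^ M)) (diff_pmf (walk k w (M * q))))"
    using walk_add[of k "diff_pmf w" M "M * q"] by (simp add: walk_diff)
  moreover have "cmod k ^ (M * Suc q) = cmod (k ^ M) * cmod k ^ (M * q)" by (simp add: norm_power power_add)
  ultimately have "proj_corr (walk k (diff_pmf w) (M * Suc q)) (cmod k ^ (M * Suc q)) z
    \<le> strip_prob (walk k (diff_pmf w) M) ((1 + D) * cmod (k ^ M)) z * proj_corr (diff_pmf (walk k w (M * q))) (cmod k ^ (M * q)) (z * R)"
    using proj_corr_conv_le[of "walk k (diff_pmf w) M" "walk k w (M * q)" z "k ^ M" "cmod k ^ (M * q)" D]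
      Suc.prems fin k D unfolding Rk by (simp add: power_le_one walk_diff[symmetric] del: walk.simps)
  also have "\<dots> \<le> strip_prob (walk k (diff_pmf w) M) ((1 + D) * cmod k ^ M) z * (\<Prod>j<q. strip_prob (walk k (diff_pmf w) M) ((1 + D) * cmod k ^ M) (z * R * R ^ j))"
    unfolding walk_diff[symmetric] norm_power
    by (intro mult_left_mono Suc.IH) (use Suc.prems R in \<open>auto simp: norm_mult strip_prob_def\<close>)
  also have "\<dots> = (\<Prod>j<Suc q. strip_prob (walk k (diff_pmf w) M) ((1 + D) * cmod k ^ M) (z * R ^ j))"
    by (simp only: prod.lessThan_Suc_shift power_0 mult_1_right power_Suc mult.assoc)
  finally show ?case .
qed

section \<open>Averages of strip probabilities along a rotation orbit\<close>

lemma prod_strip_prob_le: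
  assumes q: "0 < q" and avg: "(\<Sum>j<q. f j) \<le> real q * B" and f: "\<And>j. 0 \<le> f j"
  shows "(\<Prod>j<q. f j) \<le> (B::real) ^ q"
proof -
  have "(\<Prod>j<q. f j) powr (1 / real q) \<le> (\<Sum>j<q. f j / real q)"
    using arith_geom_mean[of "{..<q}" f] f q by (auto simp: lessThan_empty_iff)
  also have "\<dots> = (\<Sum>j<q. f j) / real q" by (simp add: sum_divide_distrib)
  also have "\<dots> \<le> B" using avg q by (simp add: divide_le_eq mult.commute)
  finally have 1: "(\<Prod>j<q. f j) powr (1 / real q) \<le> B" .
  have 2: "0 \<le> (\<Prod>j<q. f j)" by (intro prod_nonneg f)
  have "(\<Prod>j<q. f j) = ((\<Prod>j<q. f j) powr (1 / real q)) ^ q"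
  proof (cases "(\<Prod>j<q. f j) = 0")
    case False
    then have "0 < (\<Prod>j<q. f j)" using 2 by linarith
    then have "((\<Prod>j<q. f j) powr (1 / real q)) ^ q = ((\<Prod>j<q. f j) powr (1 / real q)) powr real q"
      by (intro powr_realpow[symmetric]) (simp only: powr_gt_zero)
    then show ?thesis using q 2 by (simp add: powr_powr)
  next
    case True
    show ?thesis unfolding True using q by simp
  qed
  also have "\<dots> \<le> B ^ q" using 1 by (intro power_mono) auto
  finally show ?thesis .
qed

lemma strip_prob_sum:
  fixes q :: nat
  assumes "finite (set_pmf v)"
  shows "(\<Sum>j<q. strip_prob v \<rho> (z j)) = measure_pmf.expectation v (\<lambda>d. real (card {j. j < q \<and> \<bar>Re (z j * cnj d)\<bar> \<le> \<rho>}))"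
proof -
  have "(\<Sum>j<q. strip_prob v \<rho> (z j)) = (\<Sum>j<q. measure_pmf.expectation v (indicator {d. \<bar>Re (z j * cnj d)\<bar> \<le> \<rho>}))"
    by (simp add: strip_prob_def)
  also have "\<dots> = measure_pmf.expectation v (\<lambda>d. \<Sum>j<q. indicator {d. \<bar>Re (z j * cnj d)\<bar> \<le> \<rho>} d)"
    by (rule Bochner_Integration.integral_sum[symmetric]) (rule integrable_measure_pmf_finite[OF assms])
  also have "(\<lambda>d. \<Sum>j<q. indicator {d. \<bar>Re (z j * cnj d)\<bar> \<le> \<rho>} d) = (\<lambda>d. real (card {j. j < q \<and> \<bar>Re (z j * cnj d)\<bar> \<le> \<rho>}))"
  proof
    fix d
    have "(\<Sum>j<q. indicator {d. \<bar>Re (z j * cnj d)\<bar> \<le> \<rho>} d) = (\<Sum>j<q. if \<bar>Re (z j * cnj d)\<bar> \<le> \<rho> then 1 else 0 :: real)"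
      by (intro sum.cong refl) (simp only: indicator_def mem_Collect_eq of_bool_def)
    also have "\<dots> = real (card ({..<q} \<inter> {j. \<bar>Re (z j * cnj d)\<bar> \<le> \<rho>}))"
      by (subst sum.If_cases) simp_all
    also have "{..<q} \<inter> {j. \<bar>Re (z j * cnj d)\<bar> \<le> \<rho>} = {j. j < q \<and> \<bar>Re (z j * cnj d)\<bar> \<le> \<rho>}" by blast
    finally show "(\<Sum>j<q. indicator {d. \<bar>Re (z j * cnj d)\<bar> \<le> \<rho>} d) = real (card {j. j < q \<and> \<bar>Re (z j * cnj d)\<bar> \<le> \<rho>})" .
  qed
  finally show ?thesis .
qed

text \<open>For \<open>x\<close> at most 1, the summand with \<open>r ^ Suc n < x\<close> and
  \<open>x \<le> r ^ n\<close> is already at least \<open>1 / x\<close>; the constant 1 covers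
  larger \<open>x\<close>. This turns a mean of \<open>1 / cmod d\<close> into ball
  probabilities.\<close>

lemma inverse_le_geometric_sum:
  fixes r x :: real
  assumes r: "0 < r" "r < 1" and x: "r ^ M < x"
  shows "1 / x \<le> 1 + (\<Sum>n<M. (1 / r ^ Suc n) * (if x \<le> r ^ n then 1 else 0))"
proof -
  have x0: "0 < x" using r x by (meson zero_less_power less_trans)
  have nn: "0 \<le> (\<Sum>n<M. (1 / r ^ Suc n) * (if x \<le> r ^ n then 1 else 0))"
    using r by (intro sum_nonneg) auto
  show ?thesis
  proof (cases "1 < x")
    case True
    then have "1 / x \<le> 1" by simp
    then show ?thesis using nn by linarith
  next
    case False
    define m where "m = (LEAST m. r ^ m < x)"
    have m: "r ^ m < x" "m \<le> M" unfolding m_def using x by (auto intro: LeastI Least_le)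
    have "m \<noteq> 0" using m(1) False by (intro notI) simp
    then obtain n where n: "m = Suc n" by (cases m) auto
    have "\<not> r ^ n < x" using not_less_Least[of n "\<lambda>m. r ^ m < x"] n unfolding m_def by simp
    then have "1 / r ^ Suc n = (1 / r ^ Suc n) * (if x \<le> r ^ n then 1 else 0)" by simp
    also have "\<dots> \<le> (\<Sum>n<M. (1 / r ^ Suc n) * (if x \<le> r ^ n then 1 else 0))"
      using r n m(2) by (intro member_le_sum) auto
    finally have "1 / r ^ Suc n \<le> (\<Sum>n<M. (1 / r ^ Suc n) * (if x \<le> r ^ n then 1 else 0))" .
    moreover have "1 / x \<le> 1 / r ^ Suc n" using m(1) n r x0 by (intro divide_left_mono) auto
    ultimately show ?thesis by linarith
  qed
qed

text \<open>The sum over the orbit and the mean over \<open>d\<close> are interchanged. For fixed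
  \<open>d\<close>, lying in the strip means that a unit vector turned by \<open>R ^ j\<close> has
  real part at most \<rho> / |d|, so \<open>rotation_count\<close> bounds the frequency by 32 \<rho>
  / |d|. The mean of 1 / |d| is then controlled by a geometric series of ratio
  \<open>\<theta> / r\<close>, which converges because \<theta> is below \<open>r\<close>.\<close>

lemma strip_prob_average:
  assumes dense: "\<And>x e. 0 < e \<Longrightarrow> \<exists>n. cmod (R ^ n - cis x) < e" and R: "cmod R = 1"
    and fin: "finite (set_pmf v)" and D: "\<And>d. d \<in> set_pmf v \<Longrightarrow> cmod d \<le> D"
    and r: "0 < r" "r < 1" and \<theta>: "0 < \<theta>" "\<theta> < r" and C: "0 < C" and C0: "0 < C0"
    and prob: "\<And>n. n \<le> M \<Longrightarrow> measure_pmf.prob v (cball 0 (r ^ n)) \<le> C * \<theta> ^ n"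
  shows "\<exists>Q. \<forall>q z. Q \<le> q \<longrightarrow> cmod z = 1 \<longrightarrow>
    (\<Sum>j<q. strip_prob v (C0 * r ^ M) (z * R ^ j)) \<le> real q * ((C + 32 * C0 * (1 + C / r * (1 / (1 - \<theta> / r)))) * r ^ M)"
proof -
  define \<rho> where "\<rho> = C0 * r ^ M"
  have \<rho>: "0 < \<rho>" using C0 r by (simp add: \<rho>_def)
  define D' where "D' = max D 1"
  have D': "0 < D'" by (simp add: D'_def)
  obtain Q where Q: "\<And>q w \<eta>. Q \<le> q \<Longrightarrow> cmod w = 1 \<Longrightarrow> \<rho> / D' \<le> \<eta> \<Longrightarrow> real (card {j. j < q \<and> \<bar>Re (R ^ j * w)\<bar> \<le> \<eta>}) \<le> 32 * \<eta> * real q"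
    using rotation_count[OF dense R, of "\<rho> / D'"] \<rho> D' by auto
  \<comment> \<open>Majorant for the visiting frequency of a single \<open>d\<close>: 1 on the
    smallest ball and 32 \<rho> / |d| elsewhere, the latter expressed by ball indicators.\<close>
  define \<phi> where "\<phi> d = indicator (cball 0 (r ^ M)) d + 32 * \<rho> * (1 + (\<Sum>n<M. (1 / r ^ Suc n) * indicator (cball 0 (r ^ n)) d))" for d :: complex
  have "(\<Sum>j<q. strip_prob v \<rho> (z * R ^ j)) \<le> real q * ((C + 32 * C0 * (1 + C / r * (1 / (1 - \<theta> / r)))) * r ^ M)"
    if q: "Q \<le> q" and z: "cmod z = 1" for q z
  proof -
    have pt: "real (card {j. j < q \<and> \<bar>Re (z * R ^ j * cnj d)\<bar> \<le> \<rho>}) \<le> real q * \<phi> d" if d: "d \<in> set_pmf v" for d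
    proof (cases "cmod d \<le> r ^ M")
      case True
      have "card {j. j < q \<and> \<bar>Re (z * R ^ j * cnj d)\<bar> \<le> \<rho>} \<le> card {..<q}" by (intro card_mono) auto
      then have "real (card {j. j < q \<and> \<bar>Re (z * R ^ j * cnj d)\<bar> \<le> \<rho>}) \<le> real q * 1" by simp
      also have "\<dots> \<le> real q * \<phi> d"
        using True r \<rho> unfolding \<phi>_def by (intro mult_left_mono) (auto intro!: sum_nonneg mult_nonneg_nonneg add_nonneg_nonneg)
      finally show ?thesis .
    next
      case False
      then have d0: "0 < cmod d" using r by (meson not_less zero_less_power less_trans less_le_trans linorder_not_le)
      define w where "w = z * cnj d / of_real (cmod d)"
      have w: "cmod w = 1" using z d0 by (simp add: w_def norm_mult norm_divide)
      have "\<rho> / D' \<le> \<rho> / cmod d" using D[OF d] \<rho> d0 by (intro divide_left_mono) (auto simp: D'_def)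
      from Q[OF q w this] have "real (card {j. j < q \<and> \<bar>Re (R ^ j * w)\<bar> \<le> \<rho> / cmod d}) \<le> 32 * (\<rho> / cmod d) * real q" .
      moreover have "\<bar>Re (R ^ j * w)\<bar> \<le> \<rho> / cmod d \<longleftrightarrow> \<bar>Re (z * R ^ j * cnj d)\<bar> \<le> \<rho>" for j
      proof -
        have "R ^ j * w = z * R ^ j * cnj d / of_real (cmod d)" by (simp add: w_def)
        then have "Re (R ^ j * w) = Re (z * R ^ j * cnj d) / cmod d" by (simp only: Re_divide_of_real)
        then show ?thesis using d0 by (simp only: abs_divide abs_norm_cancel divide_le_cancel) auto
      qed
      ultimately have "real (card {j. j < q \<and> \<bar>Re (z * R ^ j * cnj d)\<bar> \<le> \<rho>}) \<le> real q * (32 * \<rho> * (1 / cmod d))"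
        by (simp add: mult.commute mult.left_commute del: times_complex.simps)
      also have "\<dots> \<le> real q * (32 * \<rho> * (1 + (\<Sum>n<M. (1 / r ^ Suc n) * indicator (cball 0 (r ^ n)) d)))"
        using inverse_le_geometric_sum[OF r, of M "cmod d"] False \<rho>
        by (intro mult_left_mono) (auto simp: indicator_def of_bool_def)
      also have "\<dots> \<le> real q * \<phi> d" unfolding \<phi>_def by (intro mult_left_mono) auto
      finally show ?thesis .
    qed
    have "(\<Sum>j<q. strip_prob v \<rho> (z * R ^ j)) = measure_pmf.expectation v (\<lambda>d. real (card {j. j < q \<and> \<bar>Re (z * R ^ j * cnj d)\<bar> \<le> \<rho>}))"
      by (rule strip_prob_sum[OF fin])
    also have "\<dots> \<le> measure_pmf.expectation v (\<lambda>d. real q * \<phi> d)"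
      using pt fin by (intro integral_mono_AE) (auto simp: AE_measure_pmf_iff intro!: integrable_measure_pmf_finite simp del: times_complex.simps)
    also have "\<dots> = real q * measure_pmf.expectation v \<phi>" by simp
    also have "measure_pmf.expectation v \<phi> = measure_pmf.prob v (cball 0 (r ^ M)) + 32 * \<rho> * (1 + (\<Sum>n<M. (1 / r ^ Suc n) * measure_pmf.prob v (cball 0 (r ^ n))))"
      unfolding \<phi>_def by (simp add: integrable_measure_pmf_finite[OF fin] Bochner_Integration.integral_add Bochner_Integration.integral_sum)
    also have "real q * \<dots> \<le> real q * ((C + 32 * C0 * (1 + C / r * (1 / (1 - \<theta> / r)))) * r ^ M)"
    proof (intro mult_left_mono)
      have "measure_pmf.prob v (cball 0 (r ^ M)) \<le> C * \<theta> ^ M" by (rule prob) simp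
      also have "\<dots> \<le> C * r ^ M" using C \<theta> by (intro mult_left_mono power_mono) auto
      finally have 1: "measure_pmf.prob v (cball 0 (r ^ M)) \<le> C * r ^ M" .
      have "(\<Sum>n<M. (1 / r ^ Suc n) * measure_pmf.prob v (cball 0 (r ^ n))) \<le> (\<Sum>n<M. (1 / r ^ Suc n) * (C * \<theta> ^ n))"
        using prob r by (intro sum_mono mult_left_mono) auto
      also have "\<dots> = C / r * (\<Sum>n<M. (\<theta> / r) ^ n)"
        by (simp add: sum_distrib_left power_divide mult_ac)
      also have "\<dots> \<le> C / r * (1 / (1 - \<theta> / r))"
      proof (intro mult_left_mono)
        have "norm (\<theta> / r) < 1" using \<theta> r by simp
        then have "(\<Sum>n<M. (\<theta> / r) ^ n) \<le> (\<Sum>n. (\<theta> / r) ^ n)" using \<theta> r by (intro sum_le_suminf summable_geometric) auto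
        also have "\<dots> = 1 / (1 - \<theta> / r)" using \<open>norm (\<theta> / r) < 1\<close> by (rule suminf_geometric)
        finally show "(\<Sum>n<M. (\<theta> / r) ^ n) \<le> 1 / (1 - \<theta> / r)" .
      qed (use C r in auto)
      finally have 2: "(\<Sum>n<M. (1 / r ^ Suc n) * measure_pmf.prob v (cball 0 (r ^ n))) \<le> C / r * (1 / (1 - \<theta> / r))" .
      have "measure_pmf.prob v (cball 0 (r ^ M)) + 32 * \<rho> * (1 + (\<Sum>n<M. (1 / r ^ Suc n) * measure_pmf.prob v (cball 0 (r ^ n))))
        \<le> C * r ^ M + 32 * \<rho> * (1 + C / r * (1 / (1 - \<theta> / r)))"
        using 1 2 \<rho> by (intro add_mono mult_left_mono) auto
      also have "\<dots> = (C + 32 * C0 * (1 + C / r * (1 / (1 - \<theta> / r)))) * r ^ M" by (simp add: \<rho>_def algebra_simps)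
      finally show "measure_pmf.prob v (cball 0 (r ^ M)) + 32 * \<rho> * (1 + (\<Sum>n<M. (1 / r ^ Suc n) * measure_pmf.prob v (cball 0 (r ^ n))))
        \<le> (C + 32 * C0 * (1 + C / r * (1 / (1 - \<theta> / r)))) * r ^ M" .
    qed simp
    finally show ?thesis .
  qed
  then show ?thesis unfolding \<rho>_def by blast
qed

text \<open>The constant of \<open>strip_prob_average\<close> enters once per block and is raised to
  the power \<open>q\<close>. It does not depend on the block length \<open>M\<close>, so for long
  blocks it is smaller than the inverse of \<open>(r powr \<epsilon>) ^ M\<close>. This is the
  origin of the loss \<epsilon> and of the restriction to scales that are powers of
  \<open>cmod k ^ M\<close>.\<close>

lemma proj_corr_decay:
  assumes k: "k \<noteq> 0" "cmod k < 1" and fin: "finite (set_pmf w)"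
    and dense: "\<And>M x e. 0 < M \<Longrightarrow> 0 < e \<Longrightarrow> \<exists>n. cmod (((cnj k / of_real (cmod k)) ^ M) ^ n - cis x) < e"
    and \<theta>: "0 < \<theta>" "\<theta> < cmod k" and C: "0 < C"
    and prob: "\<And>n N. n \<le> N \<Longrightarrow> measure_pmf.prob (walk k (diff_pmf w) N) (cball 0 (cmod k ^ n)) \<le> C * \<theta> ^ n"
    and \<epsilon>: "0 < \<epsilon>"
  shows "\<exists>M>0. \<exists>Q. \<forall>q z. Q \<le> q \<longrightarrow> cmod z = 1 \<longrightarrow>
    proj_corr (walk k (diff_pmf w) (M * q)) (cmod k ^ (M * q)) z \<le> (cmod k ^ (M * q)) powr (1 - \<epsilon>)"
proof -
  define r where "r = cmod k"
  have r: "0 < r" "r < 1" using k by (auto simp: r_def)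
  define A where "A = Max (cmod ` set_pmf (diff_pmf w))"
  have "cmod d \<le> A" if "d \<in> set_pmf (diff_pmf w)" for d
    unfolding A_def using that fin by (intro Max_ge) auto
  from walk_bound[OF this k(2)]
  have D: "cmod d \<le> \<bar>A / (1 - cmod k)\<bar>" if "d \<in> set_pmf (walk k (diff_pmf w) n)" for n d
    using that by (meson abs_ge_self order_trans)
  define D where "D = \<bar>A / (1 - cmod k)\<bar>"
  note D = D[folded D_def]
  have D0: "0 \<le> D" by (simp add: D_def)
  define C1 where "C1 = C + 32 * (1 + D) * (1 + C / r * (1 / (1 - \<theta> / r)))"
  have C1: "0 < C1" unfolding C1_def using C \<theta> r by (intro add_pos_nonneg mult_nonneg_nonneg) (auto simp: D_def r_def)
  have "(\<lambda>M. (r powr \<epsilon>) ^ M) \<longlonglongrightarrow> 0"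
    using r \<epsilon> powr_less_mono2[of \<epsilon> r 1] by (intro LIMSEQ_power_zero) auto
  then have "\<forall>\<^sub>F M in sequentially. (r powr \<epsilon>) ^ M < 1 / C1" using C1 by (intro order_tendstoD(2)) auto
  then obtain M where M: "(r powr \<epsilon>) ^ M < 1 / C1" "0 < M"
    using eventually_gt_at_top[of 0] by (metis (mono_tags, lifting) eventually_conj eventually_happens sequentially_bot)
  define R where "R = (cnj k / of_real (cmod k)) ^ M"
  have R: "cmod R = 1" using k by (simp add: R_def norm_power norm_divide)
  have "\<exists>Q. \<forall>q z. Q \<le> q \<longrightarrow> cmod z = 1 \<longrightarrow>
    (\<Sum>j<q. strip_prob (walk k (diff_pmf w) M) ((1 + D) * r ^ M) (z * R ^ j)) \<le> real q * (C1 * r ^ M)"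
    unfolding C1_def
  proof (rule strip_prob_average[OF _ R _ D r \<theta>(1) _ C])
    show "\<exists>n. cmod (R ^ n - cis x) < e" if "0 < e" for x e unfolding R_def using dense[OF M(2) that] .
    show "measure_pmf.prob (walk k (diff_pmf w) M) (cball 0 (r ^ n)) \<le> C * \<theta> ^ n" if "n \<le> M" for n
      using prob[OF that] by (simp add: r_def)
  qed (use fin \<theta> D0 in \<open>auto simp: r_def\<close>)
  then obtain Q where Q: "\<And>q z. Q \<le> q \<Longrightarrow> cmod z = 1 \<Longrightarrow>
    (\<Sum>j<q. strip_prob (walk k (diff_pmf w) M) ((1 + D) * r ^ M) (z * R ^ j)) \<le> real q * (C1 * r ^ M)"
    by blast
  have "proj_corr (walk k (diff_pmf w) (M * q)) (cmod k ^ (M * q)) z \<le> (cmod k ^ (M * q)) powr (1 - \<epsilon>)"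
    if q: "max Q 1 \<le> q" and z: "cmod z = 1" for q z
  proof -
    have "proj_corr (walk k (diff_pmf w) (M * q)) (cmod k ^ (M * q)) z
      \<le> (\<Prod>j<q. strip_prob (walk k (diff_pmf w) M) ((1 + D) * r ^ M) (z * R ^ j))"
      unfolding R_def r_def by (rule proj_corr_walk_le[OF fin k z D])
    also have "\<dots> \<le> (C1 * r ^ M) ^ q"
      using q Q[OF _ z, of q] by (intro prod_strip_prob_le) (auto simp: strip_prob_def)
    also have "\<dots> \<le> ((r ^ M) powr (1 - \<epsilon>)) ^ q"
    proof (rule power_mono)
      have "(r ^ M) powr (1 - \<epsilon>) = r ^ M / (r powr \<epsilon>) ^ M"
        using r by (simp add: powr_diff power_powr_commute)
      moreover have "C1 \<le> 1 / (r powr \<epsilon>) ^ M" using M(1) C1 r by (simp add: field_simps)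
      then have "C1 * r ^ M \<le> 1 / (r powr \<epsilon>) ^ M * r ^ M" using r by (intro mult_right_mono) auto
      ultimately show "C1 * r ^ M \<le> (r ^ M) powr (1 - \<epsilon>)" by simp
    qed (use C1 r in auto)
    also have "\<dots> = (cmod k ^ (M * q)) powr (1 - \<epsilon>)"
      using r by (simp add: r_def power_mult power_powr_commute)
    finally show ?thesis .
  qed
  then show ?thesis using M(2) by blast
qed

section \<open>Gaussian averages of characteristic functions\<close>

text \<open>The Gaussian is the characteristic function of the standard normal law, so two exchanges
  of integration turn its mean over differences into the normal mean of the squared
  transform.\<close>

lemma gauss_char_identity:
  assumes "real_distribution M"
  shows "(LINT t|std_normal_distribution. (cmod (char M t))\<^sup>2) = (LINT x|M. LINT y|M. exp (- (x - y)\<^sup>2 / 2))"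
proof -
  interpret M: real_distribution M by fact
  interpret N: real_distribution std_normal_distribution by (rule real_dist_normal_dist)
  let ?N = std_normal_distribution
  interpret MN: pair_prob_space M ?N ..
  interpret MM: pair_prob_space M M ..
  have [measurable_cong]: "sets M = sets borel" "sets ?N = sets borel" by auto
  have [measurable]: "(\<lambda>t. cnj (char M t)) \<in> borel_measurable borel"
    by (intro borel_measurable_continuous_onI continuous_on_cnj continuous_at_imp_continuous_on) (auto intro: M.isCont_char)
  have i1: "integrable (M \<Otimes>\<^sub>M ?N) (\<lambda>(y, t). iexp (t * (x - y)))" for x
    by (rule MN.P.integrable_const_bound[of _ 1]) (auto simp: split_beta)
  have i2: "integrable (M \<Otimes>\<^sub>M ?N) (\<lambda>(x, t). iexp (t * x) * cnj (char M t))"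
    by (rule MN.P.integrable_const_bound[of _ 1])
      (auto simp: split_beta norm_mult intro!: M.cmod_char_le_1)
  have g: "complex_of_real (exp (- (u\<^sup>2) / 2)) = (CLINT t|?N. iexp (t * u))" for u
    using fun_cong[OF char_std_normal_distribution, of u] by (simp add: char_def mult.commute)
  have inner: "(CLINT y|M. complex_of_real (exp (- (x - y)\<^sup>2 / 2))) = (CLINT t|?N. iexp (t * x) * cnj (char M t))" for x
  proof -
    have "(CLINT y|M. complex_of_real (exp (- (x - y)\<^sup>2 / 2))) = (CLINT y|M. CLINT t|?N. iexp (t * (x - y)))"
      unfolding g ..
    also have "\<dots> = (CLINT t|?N. CLINT y|M. iexp (t * (x - y)))"
      by (rule MN.Fubini_integral[symmetric, OF i1])
    also have "\<dots> = (CLINT t|?N. iexp (t * x) * cnj (char M t))"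
    proof (intro Bochner_Integration.integral_cong refl)
      fix t
      have "iexp (t * (x - y)) = iexp (t * x) * cnj (iexp (t * y))" for y
        by (simp add: exp_cnj right_diff_distrib exp_diff exp_minus field_simps)
      then show "(CLINT y|M. iexp (t * (x - y))) = iexp (t * x) * cnj (char M t)"
        by (simp add: char_def)
    qed
    finally show ?thesis .
  qed
  have "complex_of_real (LINT x|M. LINT y|M. exp (- (x - y)\<^sup>2 / 2)) = (CLINT x|M. CLINT y|M. complex_of_real (exp (- (x - y)\<^sup>2 / 2)))"
    by simp
  also have "\<dots> = (CLINT x|M. CLINT t|?N. iexp (t * x) * cnj (char M t))" unfolding inner ..
  also have "\<dots> = (CLINT t|?N. CLINT x|M. iexp (t * x) * cnj (char M t))"
    by (rule MN.Fubini_integral[symmetric, OF i2])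
  also have "\<dots> = (CLINT t|?N. complex_of_real ((cmod (char M t))\<^sup>2))"
    unfolding complex_norm_square by (simp add: char_def)
  also have "\<dots> = complex_of_real (LINT t|?N. (cmod (char M t))\<^sup>2)"
    by (rule integral_complex_of_real)
  finally show ?thesis by (simp only: of_real_eq_iff)
qed

lemma gauss_char_nn:
  assumes "real_distribution M"
  shows "(\<integral>\<^sup>+t. ennreal (std_normal_density t * (cmod (char M t))\<^sup>2) \<partial>lborel) = ennreal (LINT x|M. LINT y|M. exp (- (x - y)\<^sup>2 / 2))"
proof -
  interpret M: real_distribution M by fact
  interpret N: real_distribution std_normal_distribution by (rule real_dist_normal_dist)
  have cm[measurable]: "char M \<in> borel_measurable borel"
    by (rule M.char_measurable)
  have "integrable std_normal_distribution (\<lambda>t. (cmod (char M t))\<^sup>2)"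
    by (rule N.integrable_const_bound[of _ 1]) (auto intro!: power_le_one M.cmod_char_le_1)
  then have "ennreal (LINT t|std_normal_distribution. (cmod (char M t))\<^sup>2) = (\<integral>\<^sup>+t. ennreal ((cmod (char M t))\<^sup>2) \<partial>std_normal_distribution)"
    by (subst nn_integral_eq_integral) auto
  also have "\<dots> = (\<integral>\<^sup>+t. ennreal (std_normal_density t * (cmod (char M t))\<^sup>2) \<partial>lborel)"
    by (subst nn_integral_density) (auto simp: ennreal_mult'')
  finally show ?thesis unfolding gauss_char_identity[OF assms] ..
qed

text \<open>Integer translates of the tent sum to 1, and at |y| only those at the integer part
  \<open>n\<close> and at \<open>Suc n\<close> count. For both, -y^2 / 2 is at most 1/2 - |y|, hence
  at most 3/2 - m. Both signs of the shift appear so that the sum involves \<open>y\<close> and not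
  |y|; \<open>gauss_le_tri\<close> needs this in order to use the additivity of its
  \<open>f\<close>.\<close>

lemma gauss_le_tri_sum:
  fixes y :: real
  assumes "\<bar>y\<bar> + 1 \<le> real K"
  shows "exp (- y\<^sup>2 / 2) \<le> exp (3 / 2) * (\<Sum>n\<le>K. exp (- real n) * (tri (- real n + y) + tri (real n + y)))"
proof -
  define n where "n = nat \<lfloor>\<bar>y\<bar>\<rfloor>"
  have n: "real n \<le> \<bar>y\<bar>" "\<bar>y\<bar> < real n + 1" unfolding n_def by linarith+
  have even: "tri (\<bar>y\<bar> - real m) \<le> tri (- real m + y) + tri (real m + y)" for m
    using tri_nonneg[of "- real m + y"] tri_nonneg[of "real m + y"] by (cases "0 \<le> y") (auto simp: tri_def)
  have e: "exp (- y\<^sup>2 / 2) \<le> exp (3 / 2) * exp (- real m)" if "real m \<le> \<bar>y\<bar> + 1" for m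
  proof -
    have "0 \<le> (\<bar>y\<bar> - 1)\<^sup>2" by simp
    then have "- y\<^sup>2 / 2 \<le> 1 / 2 - \<bar>y\<bar>" by (simp add: power2_diff)
    then show ?thesis using that by (simp flip: exp_add)
  qed
  have "exp (- y\<^sup>2 / 2) = exp (- y\<^sup>2 / 2) * tri (\<bar>y\<bar> - real n) + exp (- y\<^sup>2 / 2) * tri (\<bar>y\<bar> - real (Suc n))"
    using n by (auto simp: tri_def simp flip: distrib_left)
  also have "\<dots> \<le> exp (3 / 2) * exp (- real n) * (tri (- real n + y) + tri (real n + y)) + exp (3 / 2) * exp (- real (Suc n)) * (tri (- real (Suc n) + y) + tri (real (Suc n) + y))"
    using n by (intro add_mono mult_mono e even) (auto simp: tri_nonneg)
  also have "\<dots> = exp (3 / 2) * (\<Sum>m\<in>{n, Suc n}. exp (- real m) * (tri (- real m + y) + tri (real m + y)))"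
    by (simp add: algebra_simps)
  also have "\<dots> \<le> exp (3 / 2) * (\<Sum>m\<le>K. exp (- real m) * (tri (- real m + y) + tri (real m + y)))"
    using n assms by (intro mult_left_mono sum_mono2) (auto simp: tri_nonneg intro!: mult_nonneg_nonneg add_nonneg_nonneg)
  finally show ?thesis .
qed

text \<open>The factor \<open>exp (3 / 2)\<close> comes from \<open>gauss_le_tri_sum\<close>, the 2
  from the two signs of the shift, the rest is the sum of the weights exp(-n).\<close>

definition gauss_const :: real where "gauss_const = exp (3 / 2) * (2 / (1 - exp (- 1)))"

lemma gauss_const_pos: "0 < gauss_const"
  by (simp add: gauss_const_def)

text \<open>The Gaussian is dominated by shifted tents with summable weights, and by
  \<open>tri_shift_le\<close> no shifted tent has a larger mean than the centred one. The support is
  finite, so finitely many shifts suffice.\<close>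

lemma gauss_le_tri:
  fixes f :: "complex \<Rightarrow> real"
  assumes fin: "finite (set_pmf w)" and f: "\<And>x y. f (x + y) = f x + f y" "\<And>x. f (- x) = - f x"
  shows "measure_pmf.expectation (diff_pmf w) (\<lambda>d. exp (- (f d)\<^sup>2 / 2)) \<le> gauss_const * measure_pmf.expectation (diff_pmf w) (\<lambda>d. tri (f d))"
proof -
  let ?E = "measure_pmf.expectation (diff_pmf w)"
  let ?B = "?E (\<lambda>d. tri (f d))"
  have fd: "finite (set_pmf (diff_pmf w))" using fin by simp
  note int[simp] = integrable_measure_pmf_finite[OF fd]
  define K where "K = nat \<lceil>Max ((\<lambda>d. \<bar>f d\<bar>) ` set_pmf (diff_pmf w)) + 1\<rceil>"
  have K: "\<bar>f d\<bar> + 1 \<le> real K" if "d \<in> set_pmf (diff_pmf w)" for d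
  proof -
    have "\<bar>f d\<bar> \<le> Max ((\<lambda>d. \<bar>f d\<bar>) ` set_pmf (diff_pmf w))" using fd that by (intro Max_ge) auto
    then show ?thesis unfolding K_def by linarith
  qed
  have B0: "0 \<le> ?B" by (intro integral_nonneg_AE) (auto simp: tri_nonneg)
  have "?E (\<lambda>d. exp (- (f d)\<^sup>2 / 2)) \<le> ?E (\<lambda>d. exp (3 / 2) * (\<Sum>n\<le>K. exp (- real n) * (tri (- real n + f d) + tri (real n + f d))))"
    by (intro integral_mono_AE int, unfold AE_measure_pmf_iff, intro ballI gauss_le_tri_sum K)
  also have "\<dots> = exp (3 / 2) * (\<Sum>n\<le>K. exp (- real n) * (?E (\<lambda>d. tri (- real n + f d)) + ?E (\<lambda>d. tri (real n + f d))))"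
    by (simp add: Bochner_Integration.integral_sum Bochner_Integration.integral_add)
  also have "\<dots> \<le> exp (3 / 2) * (\<Sum>n\<le>K. exp (- real n) * (?B + ?B))"
    by (intro mult_left_mono sum_mono add_mono tri_shift_le[OF fin f]) auto
  also have "\<dots> = exp (3 / 2) * 2 * ?B * (\<Sum>n\<le>K. exp (- 1) ^ n)"
    by (simp add: sum_distrib_left sum_distrib_right mult_ac flip: exp_of_nat_mult)
  also have "\<dots> \<le> exp (3 / 2) * 2 * ?B * (1 / (1 - exp (- 1)))"
  proof (intro mult_left_mono)
    have "norm (exp (- 1) :: real) < 1" by simp
    then have "(\<Sum>n\<le>K. exp (- 1 :: real) ^ n) \<le> (\<Sum>n. exp (- 1) ^ n)" by (intro sum_le_suminf summable_geometric) auto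
    then show "(\<Sum>n\<le>K. exp (- 1 :: real) ^ n) \<le> 1 / (1 - exp (- 1))"
      using suminf_geometric[OF \<open>norm (exp (- 1) :: real) < 1\<close>] by simp
  qed (use B0 in auto)
  finally show ?thesis by (simp add: gauss_const_def mult_ac)
qed

text \<open>Frequencies up to \<open>T\<close> see the law at scale \<open>1 / T\<close>. After
  rescaling by \<open>T\<close>, the indicator of [-1, 1] is dominated by the normal density times
  \<open>sqrt (2 * pi) * exp (1 / 2)\<close>, and the resulting Gaussian mean by a tent
  mean.\<close>

lemma measure_fourier_ball_le:
  assumes fin: "finite (set_pmf w)" and T: "0 < T"
  shows "(\<integral>\<^sup>+t. ennreal ((cmod (measure_fourier w (of_real t * z)))\<^sup>2) * indicator {-T..T} t \<partial>lborel)
    \<le> ennreal (sqrt (2 * pi) * exp (1 / 2) * gauss_const * T * proj_corr (diff_pmf w) (1 / T) z)"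
proof -
  define X where "X d = T * Re (z * cnj d)" for d
  have X: "X (x + y) = X x + X y" "X (- x) = - X x" for x y by (auto simp: X_def algebra_simps)
  define M where "M = distr (measure_pmf w) borel X"
  have M: "real_distribution M" unfolding M_def by (rule prob_space.real_distribution_distr[OF measure_pmf.prob_space_axioms]) simp
  then interpret M: real_distribution M .
  have [measurable]: "char M \<in> borel_measurable borel" by (rule M.char_measurable)
  have char: "char M t = measure_fourier w (of_real (T * t) * z)" for t
  proof -
    have "char M t = measure_pmf.expectation w (\<lambda>d. iexp (t * X d))"
      unfolding char_def M_def by (subst integral_distr) auto
    also have "\<dots> = measure_fourier w (of_real (T * t) * z)"
      unfolding measure_fourier_def
    proof (intro Bochner_Integration.integral_cong refl)
      fix d
      have "t * X d = Re (of_real (T * t) * z * cnj d)" by (simp add: X_def algebra_simps)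
      then show "iexp (t * X d) = cis (Re (of_real (T * t) * z * cnj d))" by (simp only: cis_conv_exp)
    qed
    finally show ?thesis .
  qed
  have G: "(LINT x|M. LINT y|M. exp (- (x - y)\<^sup>2 / 2)) = measure_pmf.expectation (diff_pmf w) (\<lambda>d. exp (- (X d)\<^sup>2 / 2))"
  proof -
    have 1: "(LINT y|M. exp (- (x - y)\<^sup>2 / 2)) = measure_pmf.expectation w (\<lambda>b. exp (- (x - X b)\<^sup>2 / 2))" for x
      unfolding M_def by (subst integral_distr) auto
    have "(LINT x|M. LINT y|M. exp (- (x - y)\<^sup>2 / 2)) = measure_pmf.expectation w (\<lambda>a. measure_pmf.expectation w (\<lambda>b. exp (- (X a - X b)\<^sup>2 / 2)))"
      unfolding 1 unfolding M_def
    proof (subst integral_distr)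
      show "(\<lambda>x. measure_pmf.expectation w (\<lambda>b. exp (- (x - X b)\<^sup>2 / 2))) \<in> borel_measurable borel"
        by (subst integral_measure_pmf_real[OF fin]) auto
    qed auto
    also have "\<dots> = measure_pmf.expectation (diff_pmf w) (\<lambda>d. exp (- (X d)\<^sup>2 / 2))"
      unfolding diff_pmf_def by (subst expectation_conv_pmf) (auto simp: fin X)
    finally show ?thesis .
  qed
  have "(\<integral>\<^sup>+t. ennreal ((cmod (measure_fourier w (of_real t * z)))\<^sup>2) * indicator {-T..T} t \<partial>lborel)
    = ennreal T * (\<integral>\<^sup>+t. ennreal ((cmod (char M t))\<^sup>2) * indicator {-1..1} t \<partial>lborel)"
  proof -
    have m: "(\<lambda>t. ennreal ((cmod (char M (t / T)))\<^sup>2) * indicator {-T..T} t) \<in> borel_measurable borel" by measurable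
    have "(\<integral>\<^sup>+t. ennreal ((cmod (measure_fourier w (of_real t * z)))\<^sup>2) * indicator {-T..T} t \<partial>lborel)
      = (\<integral>\<^sup>+t. ennreal ((cmod (char M (t / T)))\<^sup>2) * indicator {-T..T} t \<partial>lborel)"
      using T by (simp add: char)
    also have "\<dots> = ennreal T * (\<integral>\<^sup>+t. ennreal ((cmod (char M ((0 + T * t) / T)))\<^sup>2) * indicator {-T..T} (0 + T * t) \<partial>lborel)"
      using nn_integral_real_affine[OF m, of T 0] T by simp
    also have "(\<lambda>t. ennreal ((cmod (char M ((0 + T * t) / T)))\<^sup>2) * indicator {-T..T} (0 + T * t)) = (\<lambda>t. ennreal ((cmod (char M t))\<^sup>2) * indicator {-1..1} t)"
      using T mult_le_cancel_left_pos[OF T, of "-1"] mult_le_cancel_left_pos[OF T, of _ 1] by (auto simp: fun_eq_iff indicator_def)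
    finally show ?thesis .
  qed
  also have "\<dots> \<le> ennreal T * (\<integral>\<^sup>+t. ennreal (sqrt (2 * pi) * exp (1 / 2)) * ennreal (std_normal_density t * (cmod (char M t))\<^sup>2) \<partial>lborel)"
  proof (intro mult_left_mono nn_integral_mono)
    fix t :: real
    show "ennreal ((cmod (char M t))\<^sup>2) * indicator {-1..1} t \<le> ennreal (sqrt (2 * pi) * exp (1 / 2)) * ennreal (std_normal_density t * (cmod (char M t))\<^sup>2)"
    proof (cases "t \<in> {-1..1}")
      case True
      then have "\<bar>t\<bar> \<le> 1" by auto
      then have "t\<^sup>2 \<le> 1" by (simp add: abs_square_le_1)
      then have "exp 0 \<le> exp (1 / 2 + - t\<^sup>2 / 2)" by simp
      then have "1 \<le> sqrt (2 * pi) * exp (1 / 2) * std_normal_density t"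
        unfolding std_normal_density_def exp_add by simp
      then have "1 * (cmod (char M t))\<^sup>2 \<le> (sqrt (2 * pi) * exp (1 / 2) * std_normal_density t) * (cmod (char M t))\<^sup>2"
        by (intro mult_right_mono) auto
      then show ?thesis using True by (simp add: mult.assoc flip: ennreal_mult)
    qed simp
  qed simp
  also have "\<dots> = ennreal T * (ennreal (sqrt (2 * pi) * exp (1 / 2)) * ennreal (measure_pmf.expectation (diff_pmf w) (\<lambda>d. exp (- (X d)\<^sup>2 / 2))))"
    by (subst nn_integral_cmult, measurable) (simp only: gauss_char_nn[OF M] G)
  also have "\<dots> = ennreal (T * (sqrt (2 * pi) * exp (1 / 2) * measure_pmf.expectation (diff_pmf w) (\<lambda>d. exp (- (X d)\<^sup>2 / 2))))"
    using T by (simp add: ennreal_mult integral_nonneg_AE)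
  also have "\<dots> \<le> ennreal (T * (sqrt (2 * pi) * exp (1 / 2) * (gauss_const * measure_pmf.expectation (diff_pmf w) (\<lambda>d. tri (X d)))))"
    using T by (intro ennreal_leI mult_left_mono gauss_le_tri[OF fin X]) auto
  also have "measure_pmf.expectation (diff_pmf w) (\<lambda>d. tri (X d)) = proj_corr (diff_pmf w) (1 / T) z"
    by (simp add: proj_corr_def X_def mult.commute)
  finally show ?thesis by (simp add: mult_ac)
qed

section \<open>Square-integrable characteristic functions\<close>

lemma ennreal_amgm: "2 * (a * b) \<le> a * a + b * (b :: ennreal)"
proof (cases "a = \<top> \<or> b = \<top>")
  case True
  then have "a * a + b * b = \<top>" by (auto simp: ennreal_top_mult)
  then show ?thesis by (simp only: top_greatest)
next
  case False
  then obtain x y where xy: "a = ennreal x" "0 \<le> x" "b = ennreal y" "0 \<le> y" by (cases a; cases b) auto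
  have "2 * (x * y) \<le> x * x + y * y" using sum_squares_bound[of x y] by (simp add: power2_eq_square mult.assoc)
  then have "ennreal (2 * (x * y)) \<le> ennreal (x * x + y * y)" by (rule ennreal_leI)
  then show ?thesis using xy by (simp add: ennreal_mult)
qed

lemma emeasure_window:
  fixes M :: "real measure"
  assumes "sets M = sets borel"
  shows "emeasure M {s - \<rho>..s} = (\<integral>\<^sup>+x. indicator {x..x + \<rho>} s \<partial>M)"
proof -
  have "(indicator {s - \<rho>..s} x :: ennreal) = indicator {x..x + \<rho>} s" for x by (auto simp: indicator_def)
  then show ?thesis using nn_integral_indicator[of "{s - \<rho>..s}" M] assms by simp
qed

text \<open>The density \<open>s \<mapsto> M {s - \<rho>..s} / \<rho>\<close> of the convolution of \<open>M\<close> with the uniform measure on \<open>[0, \<rho>]\<close>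
  has \<open>L\<^sup>2\<close> norm controlled by that of the characteristic function.\<close>

lemma smoothed_density_L2:
  assumes M: "real_distribution M" and \<rho>: "0 < \<rho>"
  shows "(\<integral>\<^sup>+s. emeasure M {s - \<rho>..s} * emeasure M {s - \<rho>..s} \<partial>lborel)
    \<le> ennreal (\<rho> * \<rho>) * (\<integral>\<^sup>+t. ennreal ((cmod (char M t))\<^sup>2) \<partial>lborel)"
proof -
  interpret M: real_distribution M by fact
  have [measurable]: "char M \<in> borel_measurable borel" by (rule M.char_measurable)
  have ms[measurable_cong]: "sets M = sets borel" by simp
  have em: "emeasure M {s - \<rho>..s} = (\<integral>\<^sup>+x. indicator {x..x + \<rho>} s \<partial>M)" for s
    by (rule emeasure_window) simp
  have [measurable]: "Measurable.pred (borel \<Otimes>\<^sub>M borel) (\<lambda>p. snd p \<in> {fst p..fst p + \<rho>})"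
    "Measurable.pred (borel \<Otimes>\<^sub>M borel) (\<lambda>p :: real \<times> real. fst p \<in> {snd p..snd p + \<rho>})"
    by simp_all
  have meas1[measurable]: "(\<lambda>(x, s). indicator {x..x + \<rho>} s :: ennreal) \<in> borel_measurable (borel \<Otimes>\<^sub>M borel)"
    unfolding indicator_def by (simp add: split_beta)
  interpret LM: pair_sigma_finite M lborel ..
  let ?G = "LINT x|M. LINT y|M. exp (- ((x - y) / \<rho>)\<^sup>2 / 2)"
  have "(\<integral>\<^sup>+s. emeasure M {s - \<rho>..s} * emeasure M {s - \<rho>..s} \<partial>lborel)
    = (\<integral>\<^sup>+s. \<integral>\<^sup>+x. \<integral>\<^sup>+y. indicator {x..x + \<rho>} s * indicator {y..y + \<rho>} s \<partial>M \<partial>M \<partial>lborel)"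
    unfolding em by (intro nn_integral_cong) (simp add: nn_integral_cmult nn_integral_multc)
  also have "\<dots> = (\<integral>\<^sup>+x. \<integral>\<^sup>+s. \<integral>\<^sup>+y. indicator {x..x + \<rho>} s * indicator {y..y + \<rho>} s \<partial>M \<partial>lborel \<partial>M)"
    by (rule LM.Fubini') measurable
  also have "\<dots> = (\<integral>\<^sup>+x. \<integral>\<^sup>+y. \<integral>\<^sup>+s. indicator {x..x + \<rho>} s * indicator {y..y + \<rho>} s \<partial>lborel \<partial>M \<partial>M)"
    by (intro nn_integral_cong LM.Fubini') measurable
  \<comment> \<open>The windows overlap in length at most \<rho>, and only if |x - y| is at most
    \<rho>, where the Gaussian is at least exp(-1/2).\<close>
  also have "\<dots> \<le> (\<integral>\<^sup>+x. \<integral>\<^sup>+y. ennreal (\<rho> * exp (1 / 2) * exp (- ((x - y) / \<rho>)\<^sup>2 / 2)) \<partial>M \<partial>M)"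
  proof (intro nn_integral_mono)
    fix x y
    show "(\<integral>\<^sup>+s. indicator {x..x + \<rho>} s * indicator {y..y + \<rho>} s \<partial>lborel) \<le> ennreal (\<rho> * exp (1 / 2) * exp (- ((x - y) / \<rho>)\<^sup>2 / 2))"
    proof (cases "\<bar>x - y\<bar> \<le> \<rho>")
      case True
      have "(\<integral>\<^sup>+s. indicator {x..x + \<rho>} s * indicator {y..y + \<rho>} s \<partial>lborel) \<le> (\<integral>\<^sup>+s. indicator {x..x + \<rho>} s \<partial>lborel)"
        by (intro nn_integral_mono) (auto split: split_indicator)
      also have "\<dots> = ennreal (\<rho> * 1)" using \<rho> by simp
      also have "\<dots> \<le> ennreal (\<rho> * (exp (1 / 2) * exp (- ((x - y) / \<rho>)\<^sup>2 / 2)))"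
      proof (intro ennreal_leI mult_left_mono)
        have "\<bar>(x - y) / \<rho>\<bar> \<le> 1" using True \<rho> by simp
        then have "((x - y) / \<rho>)\<^sup>2 \<le> 1" by (simp only: abs_square_le_1)
        then have "exp 0 \<le> exp (1 / 2 + - ((x - y) / \<rho>)\<^sup>2 / 2)" by (intro exp_le_cancel_iff[THEN iffD2]) linarith
        then show "1 \<le> exp (1 / 2) * exp (- ((x - y) / \<rho>)\<^sup>2 / 2)" by (simp only: exp_add exp_zero)
      qed (use \<rho> in auto)
      finally show ?thesis by (simp only: mult.assoc)
    next
      case False
      then have "(\<lambda>s. indicator {x..x + \<rho>} s * indicator {y..y + \<rho>} s :: ennreal) = (\<lambda>_. 0)"
        by (auto simp: fun_eq_iff indicator_def)
      then show ?thesis by simp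
    qed
  qed
  also have "\<dots> = ennreal (\<rho> * exp (1 / 2) * ?G)"
  proof -
    have int: "integrable M (\<lambda>y. exp (- ((x - y) / \<rho>)\<^sup>2 / 2))" for x
      by (rule M.integrable_const_bound[of _ 1]) auto
    have ge1: "(LINT y|M. exp (- ((x - y) / \<rho>)\<^sup>2 / 2)) \<le> 1" for x
      by (rule M.integral_le_const[OF int]) auto
    have nn: "0 \<le> (LINT y|M. exp (- ((x - y) / \<rho>)\<^sup>2 / 2))" for x by (intro integral_nonneg_AE) auto
    have int2: "integrable M (\<lambda>x. LINT y|M. exp (- ((x - y) / \<rho>)\<^sup>2 / 2))"
    proof (rule M.integrable_const_bound[of _ 1])
      show "AE x in M. norm (LINT y|M. exp (- ((x - y) / \<rho>)\<^sup>2 / 2)) \<le> 1" using ge1 nn by auto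
      show "(\<lambda>x. LINT y|M. exp (- ((x - y) / \<rho>)\<^sup>2 / 2)) \<in> borel_measurable M"
        by (rule M.borel_measurable_lebesgue_integral) measurable
    qed
    have "(\<integral>\<^sup>+y. ennreal (\<rho> * exp (1 / 2) * exp (- ((x - y) / \<rho>)\<^sup>2 / 2)) \<partial>M)
      = ennreal (\<rho> * exp (1 / 2) * (LINT y|M. exp (- ((x - y) / \<rho>)\<^sup>2 / 2)))" for x
      using \<rho> int[of x] by (subst nn_integral_eq_integral) auto
    then show ?thesis
      using \<rho> int2 nn by (simp add: nn_integral_eq_integral)
  qed
  also have "?G = (LINT x|distr M borel (\<lambda>x. x / \<rho>). LINT y|distr M borel (\<lambda>x. x / \<rho>). exp (- (x - y)\<^sup>2 / 2))"
  proof -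
    have 1: "(LINT y|distr M borel (\<lambda>x. x / \<rho>). exp (- (x - y)\<^sup>2 / 2)) = (LINT y|M. exp (- (x - y / \<rho>)\<^sup>2 / 2))" for x
      by (subst integral_distr) auto
    have "(LINT x|distr M borel (\<lambda>x. x / \<rho>). LINT y|M. exp (- (x - y / \<rho>)\<^sup>2 / 2)) = (LINT x|M. LINT y|M. exp (- (x / \<rho> - y / \<rho>)\<^sup>2 / 2))"
    proof (subst integral_distr)
      show "(\<lambda>x. LINT y|M. exp (- (x - y / \<rho>)\<^sup>2 / 2)) \<in> borel_measurable borel"
        by (rule M.borel_measurable_lebesgue_integral) measurable
    qed auto
    then show ?thesis unfolding 1 by (simp only: diff_divide_distrib)
  qed
  also have "ennreal (\<rho> * exp (1 / 2) * \<dots>) = ennreal (\<rho> * exp (1 / 2)) * (\<integral>\<^sup>+t. ennreal (std_normal_density t * (cmod (char (distr M borel (\<lambda>x. x / \<rho>)) t))\<^sup>2) \<partial>lborel)"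
  proof -
    have "real_distribution (distr M borel (\<lambda>x. x / \<rho>))" by (rule M.real_distribution_distr) simp
    from gauss_char_nn[OF this] show ?thesis using \<rho> by (simp add: ennreal_mult'')
  qed
  also have "\<dots> \<le> ennreal (\<rho> * exp (1 / 2)) * (\<integral>\<^sup>+t. ennreal (1 / sqrt (2 * pi)) * ennreal ((cmod (char M ((1 / \<rho>) * t)))\<^sup>2) \<partial>lborel)"
  proof (intro mult_left_mono nn_integral_mono)
    fix t
    have "char (distr M borel (\<lambda>x. x / \<rho>)) t = char M ((1 / \<rho>) * t)"
      unfolding char_def by (subst integral_distr) auto
    moreover have "std_normal_density t \<le> 1 / sqrt (2 * pi)" unfolding std_normal_density_def by (simp add: divide_le_cancel)
    moreover from this have "std_normal_density t * (cmod (char M ((1 / \<rho>) * t)))\<^sup>2 \<le> 1 / sqrt (2 * pi) * (cmod (char M ((1 / \<rho>) * t)))\<^sup>2"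
      by (intro mult_right_mono) auto
    moreover have "ennreal (1 / sqrt (2 * pi)) * ennreal ((cmod (char M ((1 / \<rho>) * t)))\<^sup>2) = ennreal (1 / sqrt (2 * pi) * (cmod (char M ((1 / \<rho>) * t)))\<^sup>2)"
      by (rule ennreal_mult[symmetric]) auto
    ultimately show "ennreal (std_normal_density t * (cmod (char (distr M borel (\<lambda>x. x / \<rho>)) t))\<^sup>2) \<le> ennreal (1 / sqrt (2 * pi)) * ennreal ((cmod (char M ((1 / \<rho>) * t)))\<^sup>2)"
      by (simp only: ennreal_leI)
  qed simp
  also have "\<dots> = ennreal (\<rho> * exp (1 / 2)) * (ennreal (1 / sqrt (2 * pi)) * (\<integral>\<^sup>+t. ennreal ((cmod (char M ((1 / \<rho>) * t)))\<^sup>2) \<partial>lborel))"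
    by (subst nn_integral_cmult) auto
  also have "(\<integral>\<^sup>+t. ennreal ((cmod (char M ((1 / \<rho>) * t)))\<^sup>2) \<partial>lborel) = ennreal \<rho> * (\<integral>\<^sup>+t. ennreal ((cmod (char M t))\<^sup>2) \<partial>lborel)"
    using \<rho> nn_integral_real_affine[of "\<lambda>t. ennreal ((cmod (char M ((1 / \<rho>) * t)))\<^sup>2)" \<rho> 0] by simp
  also have "ennreal (\<rho> * exp (1 / 2)) * (ennreal (1 / sqrt (2 * pi)) * (ennreal \<rho> * (\<integral>\<^sup>+t. ennreal ((cmod (char M t))\<^sup>2) \<partial>lborel)))
     = ennreal (\<rho> * \<rho> * (exp (1 / 2) / sqrt (2 * pi))) * (\<integral>\<^sup>+t. ennreal ((cmod (char M t))\<^sup>2) \<partial>lborel)"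
    using \<rho> by (simp add: mult.assoc[symmetric] ennreal_mult[symmetric]) (simp add: mult_ac)
  also have "\<dots> \<le> ennreal (\<rho> * \<rho>) * (\<integral>\<^sup>+t. ennreal ((cmod (char M t))\<^sup>2) \<partial>lborel)"
  proof (intro mult_right_mono ennreal_leI)
    have "exp (1 / 2 :: real) \<le> sqrt (2 * pi)"
    proof (rule real_le_rsqrt)
      have "exp (1 / 2 :: real) ^ 2 = exp 1" by (simp add: power2_eq_square flip: exp_add)
      also have "\<dots> \<le> 3" by (rule exp_le)
      also have "\<dots> \<le> 2 * pi" using pi_gt3 by linarith
      finally show "(exp (1 / 2 :: real))\<^sup>2 \<le> 2 * pi" .
    qed
    then have "exp (1 / 2) / sqrt (2 * pi) \<le> 1" by simp
    then have "\<rho> * \<rho> * (exp (1 / 2) / sqrt (2 * pi)) \<le> \<rho> * \<rho> * 1" using \<rho> by (intro mult_left_mono) auto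
    then show "\<rho> * \<rho> * (exp (1 / 2) / sqrt (2 * pi)) \<le> \<rho> * \<rho>" by simp
  qed simp
  finally show ?thesis .
qed

text \<open>Smoothing \<open>M\<close> over \<open>[0, \<rho>]\<close> gives a density
  \<open>g / \<rho>\<close> whose square integral is controlled by
  \<open>smoothed_density_L2\<close>, and twice \<open>h * (g / \<rho>)\<close> is at most the sum
  of the two squares. As \<rho> tends to 0, Fatou's lemma recovers the integral of \<open>h\<close>;
  the smoothing moves points to the right, hence the form of the semicontinuity assumption. The
  cutoff is allowed because \<open>g\<close> vanishes outside
  \<open>[-D, D + \<rho>]\<close>.\<close>

lemma L2_char_test_function:
  fixes h :: "real \<Rightarrow> ennreal"
  assumes M: "real_distribution M" and supp: "AE x in M. \<bar>x\<bar> \<le> D" and h[measurable]: "h \<in> borel_measurable borel"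
    and lsc: "\<And>x u. 0 \<le> u \<Longrightarrow> u \<le> 1 \<Longrightarrow> h x \<le> liminf (\<lambda>n. h (x + u / real (Suc n)))"
  shows "2 * (\<integral>\<^sup>+x. h x \<partial>M) \<le> (\<integral>\<^sup>+s. h s * h s * indicator {-D-1..D+1} s \<partial>lborel) + (\<integral>\<^sup>+t. ennreal ((cmod (char M t))\<^sup>2) \<partial>lborel)"
proof -
  interpret M: real_distribution M by fact
  have ms[measurable_cong]: "sets M = sets borel" by simp
  interpret LM: pair_sigma_finite M lborel ..
  let ?R = "(\<integral>\<^sup>+s. h s * h s * indicator {-D-1..D+1} s \<partial>lborel) + (\<integral>\<^sup>+t. ennreal ((cmod (char M t))\<^sup>2) \<partial>lborel)"
  define I where "I n = (\<integral>\<^sup>+x. \<integral>\<^sup>+u. h (x + u / real (Suc n)) * indicator {0..1} u \<partial>lborel \<partial>M)" for n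
  have bound: "2 * I n \<le> ?R" for n
  proof -
    define \<rho> where "\<rho> = 1 / real (Suc n)"
    have \<rho>: "0 < \<rho>" "\<rho> \<le> 1" by (auto simp: \<rho>_def)
    define g where "g s = emeasure M {s - \<rho>..s}" for s
    have g: "g s = (\<integral>\<^sup>+x. indicator {x..x + \<rho>} s \<partial>M)" for s
      unfolding g_def by (rule emeasure_window) simp
    have meas1[measurable]: "(\<lambda>(x, s). indicator {x..x + \<rho>} s :: ennreal) \<in> borel_measurable (borel \<Otimes>\<^sub>M borel)"
      unfolding indicator_def by (simp add: split_beta)
    have [measurable]: "g \<in> borel_measurable borel"
      unfolding g[abs_def] by measurable
    have gz: "g s = 0" if "s \<notin> {-D-1..D+1}" for s
    proof -
      have "AE x in M. x \<notin> {s - \<rho>..s}" using supp by eventually_elim (use that \<rho> in auto)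
      then have "emeasure M {x \<in> space M. x \<in> {s - \<rho>..s}} = 0" by (rule emeasure_eq_0_AE)
      moreover have "{x \<in> space M. x \<in> {s - \<rho>..s}} = {s - \<rho>..s}" by auto
      ultimately show ?thesis unfolding g_def by simp
    qed
    have "I n = (\<integral>\<^sup>+x. ennreal (1 / \<rho>) * (\<integral>\<^sup>+s. h s * indicator {x..x + \<rho>} s \<partial>lborel) \<partial>M)"
      unfolding I_def
    proof (intro nn_integral_cong)
      fix x
      have "(\<integral>\<^sup>+s. h s * indicator {x..x + \<rho>} s \<partial>lborel) = ennreal \<rho> * (\<integral>\<^sup>+u. h (x + \<rho> * u) * indicator {x..x + \<rho>} (x + \<rho> * u) \<partial>lborel)"
        using \<rho> nn_integral_real_affine[of "\<lambda>s. h s * indicator {x..x + \<rho>} s" \<rho> x] by simp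
      also have "(\<lambda>u. h (x + \<rho> * u) * indicator {x..x + \<rho>} (x + \<rho> * u)) = (\<lambda>u. h (x + u / real (Suc n)) * indicator {0..1} u)"
      proof
        fix u
        have "(indicator {x..x + \<rho>} (x + \<rho> * u) :: ennreal) = indicator {0..1} u"
          using \<rho> mult_le_cancel_left_pos[OF \<rho>(1), of u 1] by (auto simp: indicator_def zero_le_mult_iff)
        moreover have "x + \<rho> * u = x + u / real (Suc n)" by (simp add: \<rho>_def)
        ultimately show "h (x + \<rho> * u) * indicator {x..x + \<rho>} (x + \<rho> * u) = h (x + u / real (Suc n)) * indicator {0..1} u"
          by (simp only:)
      qed
      finally show "(\<integral>\<^sup>+u. h (x + u / real (Suc n)) * indicator {0..1} u \<partial>lborel) = ennreal (1 / \<rho>) * (\<integral>\<^sup>+s. h s * indicator {x..x + \<rho>} s \<partial>lborel)"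
        using \<rho> by (simp add: mult.assoc[symmetric] ennreal_mult[symmetric])
    qed
    also have "\<dots> = ennreal (1 / \<rho>) * (\<integral>\<^sup>+x. \<integral>\<^sup>+s. h s * indicator {x..x + \<rho>} s \<partial>lborel \<partial>M)"
      by (rule nn_integral_cmult) measurable
    also have "(\<integral>\<^sup>+x. \<integral>\<^sup>+s. h s * indicator {x..x + \<rho>} s \<partial>lborel \<partial>M) = (\<integral>\<^sup>+s. \<integral>\<^sup>+x. h s * indicator {x..x + \<rho>} s \<partial>M \<partial>lborel)"
      by (rule LM.Fubini'[symmetric]) measurable
    also have "\<dots> = (\<integral>\<^sup>+s. h s * g s \<partial>lborel)"
      unfolding g by (intro nn_integral_cong nn_integral_cmult) measurable
    also have "ennreal (1 / \<rho>) * \<dots> = (\<integral>\<^sup>+s. ennreal (1 / \<rho>) * (h s * g s) \<partial>lborel)"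
      by (rule nn_integral_cmult[symmetric]) measurable
    finally have I: "2 * I n = (\<integral>\<^sup>+s. 2 * (ennreal (1 / \<rho>) * (h s * g s)) \<partial>lborel)"
      by (simp add: nn_integral_cmult)
    also have "\<dots> \<le> (\<integral>\<^sup>+s. h s * h s * indicator {-D-1..D+1} s + ennreal (1 / (\<rho> * \<rho>)) * (g s * g s) \<partial>lborel)"
    proof (intro nn_integral_mono)
      fix s
      show "2 * (ennreal (1 / \<rho>) * (h s * g s)) \<le> h s * h s * indicator {-D-1..D+1} s + ennreal (1 / (\<rho> * \<rho>)) * (g s * g s)"
      proof (cases "s \<in> {-D-1..D+1}")
        case True
        have "2 * (h s * (ennreal (1 / \<rho>) * g s)) \<le> h s * h s + (ennreal (1 / \<rho>) * g s) * (ennreal (1 / \<rho>) * g s)" by (rule ennreal_amgm)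
        also have "(ennreal (1 / \<rho>) * g s) * (ennreal (1 / \<rho>) * g s) = (ennreal (1 / \<rho>) * ennreal (1 / \<rho>)) * (g s * g s)" by (simp only: mult_ac)
        also have "ennreal (1 / \<rho>) * ennreal (1 / \<rho>) = ennreal (1 / (\<rho> * \<rho>))" using \<rho> by (simp flip: ennreal_mult)
        finally show ?thesis using True by (simp add: mult_ac)
      qed (simp add: gz)
    qed
    also have "\<dots> = (\<integral>\<^sup>+s. h s * h s * indicator {-D-1..D+1} s \<partial>lborel) + ennreal (1 / (\<rho> * \<rho>)) * (\<integral>\<^sup>+s. g s * g s \<partial>lborel)"
      by (subst nn_integral_add) (auto simp: nn_integral_cmult)
    also have "\<dots> \<le> (\<integral>\<^sup>+s. h s * h s * indicator {-D-1..D+1} s \<partial>lborel) + ennreal (1 / (\<rho> * \<rho>)) * (ennreal (\<rho> * \<rho>) * (\<integral>\<^sup>+t. ennreal ((cmod (char M t))\<^sup>2) \<partial>lborel))"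
      unfolding g_def by (intro add_left_mono mult_left_mono smoothed_density_L2 M \<rho>) simp
    also have "\<dots> = ?R" using \<rho> by (simp add: mult.assoc[symmetric] ennreal_mult[symmetric])
    finally show ?thesis .
  qed
  have "(\<integral>\<^sup>+x. h x \<partial>M) = (\<integral>\<^sup>+x. \<integral>\<^sup>+u. h x * indicator {0..1::real} u \<partial>lborel \<partial>M)"
    by (intro nn_integral_cong) (subst nn_integral_cmult, auto)
  also have "\<dots> \<le> (\<integral>\<^sup>+x. \<integral>\<^sup>+u. liminf (\<lambda>n. h (x + u / real (Suc n)) * indicator {0..1} u) \<partial>lborel \<partial>M)"
  proof (intro nn_integral_mono)
    fix x u :: real
    show "h x * indicator {0..1} u \<le> liminf (\<lambda>n. h (x + u / real (Suc n)) * indicator {0..1} u)"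
      using lsc[of u x] by (cases "u \<in> {0..1}") (simp_all del: of_nat_Suc)
  qed
  also have "\<dots> \<le> (\<integral>\<^sup>+x. liminf (\<lambda>n. \<integral>\<^sup>+u. h (x + u / real (Suc n)) * indicator {0..1} u \<partial>lborel) \<partial>M)"
    by (intro nn_integral_mono nn_integral_liminf) measurable
  also have "\<dots> \<le> liminf I"
    unfolding I_def by (intro nn_integral_liminf) measurable
  finally have 1: "(\<integral>\<^sup>+x. h x \<partial>M) \<le> liminf I" .
  have "2 * (\<integral>\<^sup>+x. h x \<partial>M) = (\<integral>\<^sup>+x. h x \<partial>M) + (\<integral>\<^sup>+x. h x \<partial>M)" by (rule mult_2)
  also have "\<dots> \<le> liminf I + liminf I" by (intro add_mono 1)
  also have "\<dots> = 2 * liminf I" by (rule mult_2[symmetric])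
  also have "\<dots> \<le> ?R"
  proof -
    have "I n \<le> ?R / 2" for n
    proof -
      have "I n * 2 / 2 \<le> ?R / 2" using bound[of n] by (intro divide_right_mono_ennreal) (simp only: mult.commute)
      then show ?thesis by (subst (asm) mult_divide_eq_ennreal) auto
    qed
    then have "liminf I \<le> ?R / 2"
      by (intro Liminf_le) (auto simp: eventually_sequentially)
    then have "2 * liminf I \<le> 2 * (?R / 2)" by (rule mult_left_mono) simp
    also have "\<dots> = ?R" unfolding ennreal_times_divide mult.commute[of 2] by (rule mult_divide_eq_ennreal) auto
    finally show ?thesis .
  qed
  finally show ?thesis .
qed

lemma tendsto_shrinking_shift: "(\<lambda>n. x + u / real (Suc n)) \<longlonglongrightarrow> x"
  using tendsto_add[OF tendsto_const[of x] tendsto_mult[OF tendsto_const[of u] LIMSEQ_inverse_real_of_nat]]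
  by (simp add: divide_inverse)

text \<open>The test function is \<open>c\<close> times the indicator of an open \<open>U\<close>
  that contains the null set and has Lebesgue measure at most 1 / c^2. Its square integral is at
  most 1 whatever \<open>c\<close> is, so \<open>c * measure M U\<close> stays below
  \<open>1 + K'\<close>, and \<open>c\<close> may be as large as desired.\<close>

lemma L2_char_absolutely_continuous:
  assumes M: "real_distribution M" and supp: "AE x in M. \<bar>x\<bar> \<le> D"
    and fin: "(\<integral>\<^sup>+t. ennreal ((cmod (char M t))\<^sup>2) \<partial>lborel) \<le> ennreal K"
  shows "absolutely_continuous lborel M"
  unfolding absolutely_continuous_def
proof
  fix A :: "real set" assume A: "A \<in> null_sets lborel"
  interpret M: real_distribution M by fact
  have As[measurable]: "A \<in> sets borel" "emeasure lborel A = 0" using A by (auto simp: null_sets_def)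
  define K' where "K' = max K 0"
  have K': "0 \<le> K'" "(\<integral>\<^sup>+t. ennreal ((cmod (char M t))\<^sup>2) \<partial>lborel) \<le> ennreal K'"
    using fin order_trans[OF fin ennreal_leI[of K K']] by (auto simp: K'_def)
  have "measure M A \<le> e" if e: "0 < e" for e
  proof -
    define c where "c = (K' + 1) / e"
    have c: "0 < c" using K' e by (simp add: c_def)
    have "0 < 1 / (c * c)" using c by simp
    then obtain U where U: "open U" "A \<subseteq> U" "emeasure lborel (U - A) < ennreal (1 / (c * c))"
      using outer_regular_lborel[OF As(1)] by blast
    have Us[measurable]: "U \<in> sets borel" using U(1) by simp
    have lU: "emeasure lborel U \<le> ennreal (1 / (c * c))"
    proof -
      have "emeasure lborel U = emeasure lborel (A \<union> (U - A))" using U(2) by (simp add: Un_absorb1)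
      also have "\<dots> \<le> emeasure lborel A + emeasure lborel (U - A)" by (rule emeasure_subadditive) auto
      also have "\<dots> \<le> ennreal (1 / (c * c))" using U(3) As(2) by simp
      finally show ?thesis .
    qed
    let ?h = "\<lambda>x. ennreal c * indicator U x"
    have lsc: "?h x \<le> liminf (\<lambda>n. ?h (x + u / real (Suc n)))" if "0 \<le> u" "u \<le> 1" for x u
    proof (cases "x \<in> U")
      case True
      then have "\<forall>\<^sub>F n in sequentially. x + u / real (Suc n) \<in> U"
        using topological_tendstoD[OF tendsto_shrinking_shift U(1)] by blast
      then have "\<forall>\<^sub>F n in sequentially. ?h x \<le> ?h (x + u / real (Suc n))"
        by eventually_elim (use True in simp)
      then show ?thesis by (rule Liminf_bounded)
    qed simp
    have "2 * (\<integral>\<^sup>+x. ?h x \<partial>M) \<le> (\<integral>\<^sup>+s. ?h s * ?h s * indicator {-D-1..D+1} s \<partial>lborel) + (\<integral>\<^sup>+t. ennreal ((cmod (char M t))\<^sup>2) \<partial>lborel)"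
      by (rule L2_char_test_function[OF M supp _ lsc]) measurable
    also have "(\<integral>\<^sup>+s. ?h s * ?h s * indicator {-D-1..D+1} s \<partial>lborel) \<le> (\<integral>\<^sup>+s. ennreal (c * c) * indicator U s \<partial>lborel)"
      using c by (intro nn_integral_mono) (auto split: split_indicator simp: ennreal_mult)
    also have "\<dots> = ennreal (c * c) * emeasure lborel U" by (simp add: nn_integral_cmult)
    also have "\<dots> \<le> ennreal (c * c) * ennreal (1 / (c * c))" by (intro mult_left_mono lU) simp
    also have "\<dots> = 1" using c by (simp flip: ennreal_mult)
    finally have "2 * (ennreal c * emeasure M U) \<le> 1 + ennreal K'"
      using K'(2) by (simp add: nn_integral_cmult add_mono order_trans)
    then have "ennreal (2 * (c * measure M U)) \<le> ennreal (1 + K')"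
      using c K'(1) by (simp add: M.emeasure_eq_measure ennreal_mult)
    then have s2: "2 * (c * measure M U) \<le> 1 + K'" using K'(1) by (subst (asm) ennreal_le_iff) auto
    moreover have "0 \<le> c * measure M U" using c by simp
    ultimately have "c * measure M U \<le> 1 + K'" by linarith
    also have "1 + K' = c * e" using e by (simp add: c_def)
    finally have "measure M U \<le> e" using c by simp
    moreover have "measure M A \<le> measure M U" using U(2) by (intro M.finite_measure_mono) auto
    ultimately show ?thesis by linarith
  qed
  then have "measure M A \<le> 0" using field_le_epsilon[of "measure M A" 0] by simp
  then have "measure M A = 0" using measure_nonneg[of M A] by linarith
  then show "A \<in> null_sets M" using As by (auto intro!: null_setsI simp: M.emeasure_eq_measure)
qed

definition line_density :: "real measure \<Rightarrow> real \<Rightarrow> real" where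
  "line_density M x = enn2real (RN_deriv lborel M x)"

lemma line_density:
  assumes M: "real_distribution M" and ac: "absolutely_continuous lborel M"
  shows "line_density M \<in> borel_measurable borel" "0 \<le> line_density M x"
    and "density lborel (\<lambda>x. ennreal (line_density M x)) = M"
proof -
  interpret M: real_distribution M by fact
  show "line_density M \<in> borel_measurable borel" "0 \<le> line_density M x"
    unfolding line_density_def[abs_def] by auto
  have "AE x in lborel. RN_deriv lborel M x \<noteq> \<infinity>"
    by (rule sigma_finite_measure.RN_deriv_finite[OF lborel.sigma_finite_measure_axioms]) (auto intro: ac M.sigma_finite_measure_axioms)
  then have "density lborel (\<lambda>x. ennreal (line_density M x)) = density lborel (RN_deriv lborel M)"
    by (intro density_cong) (auto simp: line_density_def less_top)
  also have "\<dots> = M" by (rule sigma_finite_measure.density_RN_deriv[OF lborel.sigma_finite_measure_axioms]) (auto intro: ac)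
  finally show "density lborel (\<lambda>x. ennreal (line_density M x)) = M" .
qed

lemma lebesgue_density_eq: "lebesgue_density M x = complex_of_real (line_density M x)"
  by (simp add: lebesgue_density_def line_density_def)

text \<open>Testing against continuous approximations of the truncated density itself.\<close>

lemma L2_char_density_truncated:
  assumes M: "real_distribution M" and supp: "AE x in M. \<bar>x\<bar> \<le> D"
    and fin: "(\<integral>\<^sup>+t. ennreal ((cmod (char M t))\<^sup>2) \<partial>lborel) \<le> ennreal K" and m: "0 < m"
  shows "(\<integral>\<^sup>+x. ennreal ((min (line_density M x) m)\<^sup>2) \<partial>lborel) \<le> (\<integral>\<^sup>+t. ennreal ((cmod (char M t))\<^sup>2) \<partial>lborel)"
proof -
  interpret M: real_distribution M by fact
  note ac = L2_char_absolutely_continuous[OF M supp fin]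
  note ld = line_density[OF M ac]
  have [measurable]: "line_density M \<in> borel_measurable borel" by (rule ld)
  let ?B = "\<integral>\<^sup>+t. ennreal ((cmod (char M t))\<^sup>2) \<partial>lborel"
  let ?J = "{-D-1..D+1}"
  \<comment> \<open>Truncation at \<open>m\<close> keeps the integral of \<open>F\<close> against
    \<open>M\<close> finite, so that it can be cancelled at the end.\<close>
  define F where "F x = min (line_density M x) m" for x
  have F: "0 \<le> F x" "F x \<le> m" for x using ld(2)[of x] m by (auto simp: F_def)
  have [measurable]: "F \<in> borel_measurable borel" unfolding F_def[abs_def] by measurable
  then have "F \<in> borel_measurable lebesgue" by (intro measurable_completion) simp
  \<comment> \<open>This yields continuous functions converging to \<open>F\<close> off a negligible
    set; continuity gives the semicontinuity that \<open>L2_char_test_function\<close>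
    requires.\<close>
  then have "F measurable_on UNIV" by (rule lebesgue_measurable_imp_measurable_on) simp
  then obtain N g where N: "negligible N" and g: "\<And>n. continuous_on UNIV (g n)"
    and lim: "\<And>x. x \<notin> N \<Longrightarrow> (\<lambda>n. g n x) \<longlonglongrightarrow> F x"
    unfolding measurable_on_def by auto
  have AEl: "AE x in lebesgue. x \<notin> N"
    using N by (intro AE_not_in) (simp add: negligible_iff_null_sets)
  then have AE1: "AE x in lborel. x \<notin> N" by (simp add: AE_completion_iff)
  \<comment> \<open>Fatou's lemma is applied under \<open>M\<close>, so the convergence has to hold
    \<open>M\<close>-almost everywhere as well; absolute continuity provides this.\<close>
  have AE2: "AE x in M. x \<notin> N"
  proof -
    obtain N' where N': "N' \<in> null_sets lborel" "{x \<in> space lborel. \<not> x \<notin> N} \<subseteq> N'"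
      using AE1 by (auto elim!: AE_E simp: null_sets_def)
    then have "N' \<in> null_sets M" using ac unfolding absolutely_continuous_def by blast
    then show ?thesis by (rule AE_I') (use N'(2) in auto)
  qed
  define G where "G n x = max 0 (min (g n x) m)" for n x
  have Gc: "continuous_on UNIV (G n)" for n
    unfolding G_def using g by (intro continuous_intros)
  have [measurable]: "G n \<in> borel_measurable borel" for n
    by (rule borel_measurable_continuous_onI[OF Gc])
  have G: "0 \<le> G n x" "G n x \<le> m" for n x using m by (auto simp: G_def)
  have Glim: "(\<lambda>n. G n x) \<longlonglongrightarrow> F x" if "x \<notin> N" for x
  proof -
    have "(\<lambda>n. G n x) \<longlonglongrightarrow> max 0 (min (F x) m)" unfolding G_def by (intro tendsto_intros lim that)
    then show ?thesis using F[of x] by simp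
  qed
  have ineq: "2 * (\<integral>\<^sup>+x. ennreal (G n x) \<partial>M) \<le> (\<integral>\<^sup>+s. ennreal (G n s) * ennreal (G n s) * indicator ?J s \<partial>lborel) + ?B" for n
  proof (rule L2_char_test_function[OF M supp])
    fix x u :: real
    have "isCont (G n) x" using Gc continuous_on_eq_continuous_at by blast
    then have "(\<lambda>k. ennreal (G n (x + u / real (Suc k)))) \<longlonglongrightarrow> ennreal (G n x)"
      by (intro tendsto_ennrealI isCont_tendsto_compose[OF _ tendsto_shrinking_shift])
    then show "ennreal (G n x) \<le> liminf (\<lambda>k. ennreal (G n (x + u / real (Suc k))))"
      by (simp add: lim_imp_Liminf)
  qed measurable
  let ?X = "\<integral>\<^sup>+x. ennreal (F x) \<partial>M"
  let ?Y = "\<integral>\<^sup>+s. ennreal (F s) * ennreal (F s) * indicator ?J s \<partial>lborel"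
  have "2 * ?X = (\<integral>\<^sup>+x. 2 * ennreal (F x) \<partial>M)" by (subst nn_integral_cmult) auto
  also have "\<dots> = (\<integral>\<^sup>+x. liminf (\<lambda>n. 2 * ennreal (G n x)) \<partial>M)"
  proof (rule nn_integral_cong_AE, rule eventually_mono[OF AE2])
    fix x assume "x \<notin> N"
    from tendsto_ennrealI[OF tendsto_mult[OF tendsto_const[of 2] Glim[OF this]]]
    have "(\<lambda>n. 2 * ennreal (G n x)) \<longlonglongrightarrow> 2 * ennreal (F x)" by (simp add: ennreal_mult')
    then show "2 * ennreal (F x) = liminf (\<lambda>n. 2 * ennreal (G n x))" by (simp add: lim_imp_Liminf)
  qed
  also have "\<dots> \<le> liminf (\<lambda>n. \<integral>\<^sup>+x. 2 * ennreal (G n x) \<partial>M)" by (rule nn_integral_liminf) simp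
  also have "\<dots> = liminf (\<lambda>n. 2 * \<integral>\<^sup>+x. ennreal (G n x) \<partial>M)" by (subst nn_integral_cmult) auto
  finally have X: "2 * ?X \<le> liminf (\<lambda>n. 2 * \<integral>\<^sup>+x. ennreal (G n x) \<partial>M)" .
  have Y: "(\<lambda>n. \<integral>\<^sup>+s. ennreal (G n s) * ennreal (G n s) * indicator ?J s \<partial>lborel) \<longlonglongrightarrow> ?Y"
  proof (rule nn_integral_dominated_convergence[where w="\<lambda>s. ennreal (m * m) * indicator ?J s"])
    show "AE s in lborel. ennreal (G n s) * ennreal (G n s) * indicator ?J s \<le> ennreal (m * m) * indicator ?J s" for n
    proof (rule AE_I2)
      fix s
      have "G n s * G n s \<le> m * m" using G[of n s] m by (intro mult_mono) auto
      then show "ennreal (G n s) * ennreal (G n s) * indicator ?J s \<le> ennreal (m * m) * indicator ?J s"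
        using G[of n s] by (intro mult_right_mono) (auto simp: ennreal_leI simp flip: ennreal_mult)
    qed
    show "(\<integral>\<^sup>+s. ennreal (m * m) * indicator ?J s \<partial>lborel) < \<infinity>"
      by (simp add: nn_integral_cmult ennreal_mult_less_top emeasure_lborel_Icc_eq)
    show "AE s in lborel. (\<lambda>n. ennreal (G n s) * ennreal (G n s) * indicator ?J s) \<longlonglongrightarrow> ennreal (F s) * ennreal (F s) * indicator ?J s"
    proof (rule eventually_mono[OF AE1])
      fix s assume "s \<notin> N"
      then have "(\<lambda>n. ennreal (G n s * G n s)) \<longlonglongrightarrow> ennreal (F s * F s)" by (intro tendsto_ennrealI tendsto_mult Glim)
      then show "(\<lambda>n. ennreal (G n s) * ennreal (G n s) * indicator ?J s) \<longlonglongrightarrow> ennreal (F s) * ennreal (F s) * indicator ?J s"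
        using G F by (cases "s \<in> ?J") (simp_all flip: ennreal_mult)
    qed
  qed measurable
  have "2 * ?X \<le> liminf (\<lambda>n. (\<integral>\<^sup>+s. ennreal (G n s) * ennreal (G n s) * indicator ?J s \<partial>lborel) + ?B)"
    by (rule order_trans[OF X Liminf_mono]) (simp add: ineq)
  also have "\<dots> = ?Y + ?B"
    by (rule lim_imp_Liminf[OF _ tendsto_add[OF Y tendsto_const]]) simp
  finally have XY: "?X + ?X \<le> ?Y + ?B" unfolding mult_2 .
  \<comment> \<open>As \<open>F\<close> is at most the density, the integral of its square lies
    between \<open>?Y\<close> and \<open>?X\<close>. The tested inequality, in which
    \<open>?X\<close> occurs twice on the left and \<open>?Y + ?B\<close> on the right, then reduces
    to \<open>?X \<le> ?B\<close>.\<close>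
  have FF: "?Y \<le> (\<integral>\<^sup>+x. ennreal ((F x)\<^sup>2) \<partial>lborel)"
    by (intro nn_integral_mono) (auto split: split_indicator simp: power2_eq_square F ennreal_mult)
  have XF: "(\<integral>\<^sup>+x. ennreal ((F x)\<^sup>2) \<partial>lborel) \<le> ?X"
  proof -
    have "?X = (\<integral>\<^sup>+x. ennreal (line_density M x) * ennreal (F x) \<partial>lborel)"
      by (subst ld(3)[symmetric], subst nn_integral_density) auto
    also have "\<dots> \<ge> (\<integral>\<^sup>+x. ennreal ((F x)\<^sup>2) \<partial>lborel)"
      unfolding power2_eq_square using F
      by (intro nn_integral_mono) (auto simp: ennreal_mult[symmetric] F_def intro!: ennreal_leI mult_right_mono simp del: ennreal_mult)
    finally show ?thesis .
  qed
  have "?X \<le> (\<integral>\<^sup>+x. ennreal m \<partial>M)" using F by (intro nn_integral_mono ennreal_leI)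
  also have "\<dots> = ennreal m" using M.emeasure_space_1 by simp
  finally have Xfin: "?X < \<top>" using ennreal_less_top le_less_trans by blast
  have "?X + ?X \<le> ?X + ?B" by (rule order_trans[OF XY add_right_mono[OF order_trans[OF FF XF]]])
  then have "?X \<le> ?B" using Xfin by (auto simp: ennreal_add_left_cancel_le)
  then show ?thesis using XF unfolding F_def by (rule order_trans[rotated])
qed

lemma L2_char_density:
  assumes M: "real_distribution M" and supp: "AE x in M. \<bar>x\<bar> \<le> D"
    and fin: "(\<integral>\<^sup>+t. ennreal ((cmod (char M t))\<^sup>2) \<partial>lborel) \<le> ennreal K"
  shows "(\<integral>\<^sup>+x. ennreal ((line_density M x)\<^sup>2) \<partial>lborel) \<le> ennreal K"
proof -
  note ac = L2_char_absolutely_continuous[OF M supp fin]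
  note ld = line_density[OF M ac]
  have [measurable]: "line_density M \<in> borel_measurable borel" by (rule ld)
  have "(\<integral>\<^sup>+x. ennreal ((line_density M x)\<^sup>2) \<partial>lborel)
    \<le> (\<integral>\<^sup>+x. liminf (\<lambda>n. ennreal ((min (line_density M x) (real (Suc n)))\<^sup>2)) \<partial>lborel)"
  proof (intro nn_integral_mono)
    fix x
    have "\<forall>\<^sub>F n in sequentially. ennreal ((line_density M x)\<^sup>2) \<le> ennreal ((min (line_density M x) (real (Suc n)))\<^sup>2)"
      using eventually_ge_at_top[of "nat \<lceil>line_density M x\<rceil>"]
    proof eventually_elim
      case (elim n)
      then have "line_density M x \<le> real (Suc n)" by linarith
      then show ?case by simp
    qed
    then show "ennreal ((line_density M x)\<^sup>2) \<le> liminf (\<lambda>n. ennreal ((min (line_density M x) (real (Suc n)))\<^sup>2))"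
      by (rule Liminf_bounded)
  qed
  also have "\<dots> \<le> liminf (\<lambda>n. \<integral>\<^sup>+x. ennreal ((min (line_density M x) (real (Suc n)))\<^sup>2) \<partial>lborel)"
    by (rule nn_integral_liminf) measurable
  also have "\<dots> \<le> ennreal K"
  proof (rule Liminf_le)
    show "\<forall>\<^sub>F n in sequentially. (\<integral>\<^sup>+x. ennreal ((min (line_density M x) (real (Suc n)))\<^sup>2) \<partial>lborel) \<le> ennreal K"
      by (intro always_eventually allI order_trans[OF L2_char_density_truncated[OF M supp fin] fin]) simp
  qed simp
  finally show ?thesis .
qed

section \<open>Sobolev norms of projections\<close>

text \<open>For a compactly supported function the truncated transforms are eventually constant, so the
  choice in \<^const>\<open>L2_fourier\<close> returns this constant up to a null set.\<close>

lemma L2_fourier_eventually_const: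
  assumes h: "h \<in> L2_line"
    and tr: "\<And>R \<xi>. R0 \<le> R \<Longrightarrow> (LINT x:{-R..R}|lborel. cis (\<xi> * x) * g x) = h \<xi>"
  shows "L2_fourier g \<in> L2_line" "AE \<xi> in lborel. L2_fourier g \<xi> = h \<xi>"
proof -
  have ev: "\<forall>\<^sub>F R in at_top. (\<integral>\<^sup>+\<xi>. ennreal ((cmod (k \<xi> - h \<xi>))\<^sup>2) \<partial>lborel)
      = (\<integral>\<^sup>+\<xi>. ennreal ((cmod (k \<xi> - (LINT x:{-R..R}|lborel. cis (\<xi> * x) * g x)))\<^sup>2) \<partial>lborel)" for k
    using eventually_ge_at_top[of R0] by eventually_elim (simp add: tr)
  have "((\<lambda>R. \<integral>\<^sup>+\<xi>. ennreal ((cmod (h \<xi> - h \<xi>))\<^sup>2) \<partial>lborel) \<longlongrightarrow> 0) at_top" by simp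
  then have "is_L2_fourier g h"
    unfolding is_L2_fourier_def using h Lim_transform_eventually[OF _ ev[of h]] by blast
  then have L: "is_L2_fourier g (L2_fourier g)" unfolding L2_fourier_def by (rule someI[of "is_L2_fourier g"])
  then show L2: "L2_fourier g \<in> L2_line" by (simp add: is_L2_fourier_def)
  have ev': "\<forall>\<^sub>F R in at_top. (\<integral>\<^sup>+\<xi>. ennreal ((cmod (L2_fourier g \<xi> - (LINT x:{-R..R}|lborel. cis (\<xi> * x) * g x)))\<^sup>2) \<partial>lborel)
    = (\<integral>\<^sup>+\<xi>. ennreal ((cmod (L2_fourier g \<xi> - h \<xi>))\<^sup>2) \<partial>lborel)"
    using ev[of "L2_fourier g"] by eventually_elim simp
  have "((\<lambda>R::real. \<integral>\<^sup>+\<xi>. ennreal ((cmod (L2_fourier g \<xi> - h \<xi>))\<^sup>2) \<partial>lborel) \<longlongrightarrow> 0) at_top"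
    using L Lim_transform_eventually[OF _ ev'] unfolding is_L2_fourier_def by blast
  then have "(\<integral>\<^sup>+\<xi>. ennreal ((cmod (L2_fourier g \<xi> - h \<xi>))\<^sup>2) \<partial>lborel) = 0"
    by (simp add: tendsto_const_iff)
  moreover have "L2_fourier g \<in> borel_measurable lborel" "h \<in> borel_measurable lborel"
    using L2 h by (auto simp: L2_line_def)
  ultimately have "AE \<xi> in lborel. ennreal ((cmod (L2_fourier g \<xi> - h \<xi>))\<^sup>2) = 0"
    by (subst (asm) nn_integral_0_iff_AE) auto
  then show "AE \<xi> in lborel. L2_fourier g \<xi> = h \<xi>" by eventually_elim simp
qed

lemma lebesgue_density_transform:
  assumes M: "real_distribution M" and ac: "absolutely_continuous lborel M" and supp: "AE x in M. \<bar>x\<bar> \<le> D" and R: "D \<le> R"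
  shows "set_integrable lborel {-R..R} (\<lambda>x. cis (\<xi> * x) * lebesgue_density M x)"
    and "(LINT x:{-R..R}|lborel. cis (\<xi> * x) * lebesgue_density M x) = char M \<xi>"
proof -
  interpret M: real_distribution M by fact
  note ld = line_density[OF M ac]
  have [measurable]: "line_density M \<in> borel_measurable borel" by (rule ld)
  let ?f = "\<lambda>x. indicator {-R..R} x *\<^sub>R cis (\<xi> * x)"
  have "(\<lambda>x. cis (\<xi> * x)) \<in> borel_measurable borel"
    by (intro borel_measurable_continuous_onI continuous_intros)
  then have m[measurable]: "?f \<in> borel_measurable borel" by measurable
  have eq: "indicator {-R..R} x *\<^sub>R (cis (\<xi> * x) * lebesgue_density M x) = line_density M x *\<^sub>R ?f x" for x
    by (simp add: lebesgue_density_eq scaleR_conv_of_real mult_ac)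
  have "integrable M ?f"
  proof (rule M.integrable_const_bound[of _ 1])
    show "?f \<in> borel_measurable M" using m by simp
  qed (auto simp: indicator_def)
  then have "integrable (density lborel (\<lambda>x. ennreal (line_density M x))) ?f" unfolding ld(3) .
  then have "integrable lborel (\<lambda>x. line_density M x *\<^sub>R ?f x)"
    by (subst (asm) integrable_density) (auto simp: ld(2))
  then show "set_integrable lborel {-R..R} (\<lambda>x. cis (\<xi> * x) * lebesgue_density M x)"
    unfolding set_integrable_def eq .
  have "(LINT x:{-R..R}|lborel. cis (\<xi> * x) * lebesgue_density M x) = (LINT x|lborel. line_density M x *\<^sub>R ?f x)"
    unfolding set_lebesgue_integral_def eq ..
  also have "\<dots> = (LINT x|density lborel (\<lambda>x. ennreal (line_density M x)). ?f x)"
    by (subst integral_density) (auto simp: ld(2))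
  also have "\<dots> = (LINT x|M. ?f x)" unfolding ld(3) ..
  also have "\<dots> = char M \<xi>"
    unfolding char_def
  proof (rule integral_cong_AE)
    show "AE x in M. ?f x = iexp (\<xi> * x)" using supp by eventually_elim (use R in \<open>auto simp: cis_conv_exp indicator_def\<close>)
  qed (use m in simp_all)
  finally show "(LINT x:{-R..R}|lborel. cis (\<xi> * x) * lebesgue_density M x) = char M \<xi>" .
qed

lemma char_proj_measure:
  assumes "prob_space \<nu>" "sets \<nu> = sets borel"
  shows "char (proj_measure z \<nu>) t = measure_fourier \<nu> (of_real t * z)" "real_distribution (proj_measure z \<nu>)"
proof -
  interpret prob_space \<nu> by fact
  have "(\<lambda>w. Re (z * cnj w)) \<in> borel_measurable borel"
    by (intro borel_measurable_continuous_onI continuous_intros)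
  then have m: "(\<lambda>w. Re (z * cnj w)) \<in> borel_measurable \<nu>" unfolding measurable_cong_sets[OF assms(2) refl] .
  show "real_distribution (proj_measure z \<nu>)" unfolding proj_measure_def by (rule real_distribution_distr[OF m])
  have "char (proj_measure z \<nu>) t = (LINT w|\<nu>. iexp (t * Re (z * cnj w)))"
    unfolding char_def proj_measure_def by (subst integral_distr[OF m]) auto
  also have "\<dots> = measure_fourier \<nu> (of_real t * z)"
    unfolding measure_fourier_def
  proof (intro Bochner_Integration.integral_cong refl)
    fix w
    have "t * Re (z * cnj w) = Re (of_real t * z * cnj w)" by (simp add: algebra_simps)
    then show "iexp (t * Re (z * cnj w)) = cis (Re (of_real t * z * cnj w))" by (simp only: cis_conv_exp)
  qed
  finally show "char (proj_measure z \<nu>) t = measure_fourier \<nu> (of_real t * z)" .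
qed

lemma proj_measure_AE:
  assumes "sets \<nu> = sets borel" "AE w in \<nu>. cmod w \<le> D" "cmod z = 1"
  shows "AE x in proj_measure z \<nu>. \<bar>x\<bar> \<le> D"
proof -
  have "(\<lambda>w. Re (z * cnj w)) \<in> borel_measurable borel"
    by (intro borel_measurable_continuous_onI continuous_intros)
  then have m: "(\<lambda>w. Re (z * cnj w)) \<in> borel_measurable \<nu>" unfolding measurable_cong_sets[OF assms(1) refl] .
  have "AE w in \<nu>. \<bar>Re (z * cnj w)\<bar> \<le> D"
    using assms(2)
  proof eventually_elim
    case (elim w)
    then show ?case using abs_Re_le_cmod[of "z * cnj w"] assms(3) by (simp add: norm_mult del: times_complex.simps)
  qed
  then show ?thesis unfolding proj_measure_def by (subst AE_distr_iff[OF m]) auto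
qed

lemma measure_fourier_lipschitz:
  assumes "prob_space \<nu>" "sets \<nu> = sets borel" "AE w in \<nu>. cmod w \<le> D"
  shows "cmod (measure_fourier \<nu> \<xi> - measure_fourier \<nu> \<zeta>) \<le> D * cmod (\<xi> - \<zeta>)"
proof -
  interpret prob_space \<nu> by fact
  have i: "integrable \<nu> (\<lambda>w. cis (Re (\<xi> * cnj w)))" for \<xi>
    by (rule integrable_cis_inner[OF finite_measure_axioms assms(2)])
  have "cmod (measure_fourier \<nu> \<xi> - measure_fourier \<nu> \<zeta>) = cmod (LINT w|\<nu>. cis (Re (\<xi> * cnj w)) - cis (Re (\<zeta> * cnj w)))"
    unfolding measure_fourier_def by (simp only: Bochner_Integration.integral_diff[OF i i])
  also have "\<dots> \<le> (LINT w|\<nu>. cmod (cis (Re (\<xi> * cnj w)) - cis (Re (\<zeta> * cnj w))))" by (rule integral_norm_bound)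
  also have "\<dots> \<le> D * cmod (\<xi> - \<zeta>)"
  proof (rule integral_le_const)
    show "integrable \<nu> (\<lambda>w. cmod (cis (Re (\<xi> * cnj w)) - cis (Re (\<zeta> * cnj w))))" using i by (intro integrable_norm Bochner_Integration.integrable_diff)
    show "AE w in \<nu>. cmod (cis (Re (\<xi> * cnj w)) - cis (Re (\<zeta> * cnj w))) \<le> D * cmod (\<xi> - \<zeta>)"
      using assms(3)
    proof eventually_elim
      case (elim w)
      have "cmod (cis (Re (\<xi> * cnj w)) - cis (Re (\<zeta> * cnj w))) \<le> \<bar>Re (\<xi> * cnj w) - Re (\<zeta> * cnj w)\<bar>" by (rule cmod_cis_diff_le)
      also have "\<dots> = \<bar>Re ((\<xi> - \<zeta>) * cnj w)\<bar>" by (simp only: left_diff_distrib minus_complex.simps)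
      also have "\<dots> \<le> cmod (\<xi> - \<zeta>) * cmod w" using abs_Re_le_cmod[of "(\<xi> - \<zeta>) * cnj w"] by (simp only: norm_mult complex_mod_cnj)
      also have "\<dots> \<le> D * cmod (\<xi> - \<zeta>)" using mult_left_mono[OF elim, of "cmod (\<xi> - \<zeta>)"] by (simp add: mult.commute)
      finally show ?case .
    qed
  qed
  finally show ?thesis .
qed

lemma continuous_measure_fourier:
  assumes "prob_space \<nu>" "sets \<nu> = sets borel" "AE w in \<nu>. cmod w \<le> D"
  shows "continuous_on UNIV (measure_fourier \<nu>)"
proof -
  have "(\<bar>D\<bar>)-lipschitz_on UNIV (measure_fourier \<nu>)"
  proof (rule lipschitz_onI)
    fix x y
    have "cmod (measure_fourier \<nu> x - measure_fourier \<nu> y) \<le> D * cmod (x - y)" by (rule measure_fourier_lipschitz[OF assms])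
    also have "\<dots> \<le> \<bar>D\<bar> * cmod (x - y)" by (intro mult_right_mono) auto
    finally show "dist (measure_fourier \<nu> x) (measure_fourier \<nu> y) \<le> \<bar>D\<bar> * dist x y" by (simp add: dist_norm)
  qed simp
  then show ?thesis by (rule lipschitz_on_continuous_on)
qed

lemma ennreal_integral_le_nn_integral:
  assumes "f \<in> borel_measurable M" "\<And>x. 0 \<le> f x"
  shows "ennreal (LINT x|M. f x) \<le> (\<integral>\<^sup>+x. ennreal (f x) \<partial>M)"
proof (cases "integrable M f")
  case True
  then show ?thesis using assms by (simp add: nn_integral_eq_integral)
qed (simp add: not_integrable_integral_eq)

text \<open>The assumption carries the exponent 2 \<gamma>, the conclusion \<gamma>. The surplus
  makes the tails small uniformly in \<open>z\<close>: outside \<open>[-T, T]\<close> the weight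
  with exponent \<gamma> is at most \<open>W T powr (- \<gamma>)\<close> times the one with exponent
  2 \<gamma>. Inside, the transforms for \<open>z\<close> and \<open>z\<^sub>0\<close> are close by
  the Lipschitz bound.\<close>

lemma sobolev_of_fourier_bound:
  assumes ps: "prob_space \<nu>" and s: "sets \<nu> = sets borel" and supp: "AE w in \<nu>. cmod w \<le> D"
    and \<gamma>: "0 < \<gamma>" and K: "\<And>z. cmod z = 1 \<Longrightarrow> (\<integral>\<^sup>+t. ennreal ((cmod (measure_fourier \<nu> (of_real t * z)))\<^sup>2 * (1 + t\<^sup>2) powr (2 * \<gamma>)) \<partial>lborel) \<le> ennreal K"
  shows "(\<forall>z\<in>sphere 0 1. measure_in_sobolev \<gamma> (proj_measure z \<nu>)) \<and>
           (\<forall>z\<^sub>0\<in>sphere 0 1.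
              ((\<lambda>z. sobolev_norm \<gamma>
                      (\<lambda>x. lebesgue_density (proj_measure z \<nu>) x
                           - lebesgue_density (proj_measure z\<^sub>0 \<nu>) x))
                 \<longlongrightarrow> 0) (at z\<^sub>0 within sphere 0 1))"
proof -
  define F where "F z t = measure_fourier \<nu> (of_real t * z)" for z t
  define W where "W t = 1 + t\<^sup>2" for t :: real
  have W1: "1 \<le> W t" for t by (simp add: W_def)
  have Fc: "continuous_on UNIV (F z)" for z
    unfolding F_def by (intro continuous_on_compose2[OF continuous_measure_fourier[OF ps s supp]] continuous_intros) auto
  have [measurable]: "F z \<in> borel_measurable borel" for z by (rule borel_measurable_continuous_onI[OF Fc])
  have [measurable]: "W \<in> borel_measurable borel" unfolding W_def by measurable
  have mono: "1 \<le> W t powr \<gamma>" "W t powr \<gamma> \<le> W t powr (2 * \<gamma>)" for t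
    using W1[of t] \<gamma> by (auto intro!: ge_one_powr_ge_zero powr_mono)
  have K': "(\<integral>\<^sup>+t. ennreal ((cmod (F z t))\<^sup>2 * W t powr (2 * \<gamma>)) \<partial>lborel) \<le> ennreal K" if "cmod z = 1" for z
    using K[OF that] by (simp add: F_def W_def)
  have Kg: "(\<integral>\<^sup>+t. ennreal ((cmod (F z t))\<^sup>2 * W t powr \<gamma>) \<partial>lborel) \<le> ennreal K" if "cmod z = 1" for z
    by (rule order_trans[OF nn_integral_mono K'[OF that]]) (intro ennreal_leI mult_left_mono mono, simp)
  have K0: "(\<integral>\<^sup>+t. ennreal ((cmod (F z t))\<^sup>2) \<partial>lborel) \<le> ennreal K" if "cmod z = 1" for z
    by (rule order_trans[OF nn_integral_mono Kg[OF that]]) (intro ennreal_leI, use mult_left_mono[OF mono(1)] in force)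
  have Fint: "integrable lborel (\<lambda>t. (cmod (F z t))\<^sup>2)" if "cmod z = 1" for z
    using K0[OF that] by (intro integrableI_bounded) (auto intro: le_less_trans)
  have FL2: "F z \<in> L2_line" if "cmod z = 1" for z
    using Fint[OF that] by (simp add: L2_line_def)
  have Fw: "integrable lborel (\<lambda>t. (cmod (F z t))\<^sup>2 * W t powr \<gamma>)" if "cmod z = 1" for z
    using Kg[OF that] by (intro integrableI_bounded) (auto intro: le_less_trans)
  have char: "char (proj_measure z \<nu>) = F z" for z
    using char_proj_measure(1)[OF ps s] by (auto simp: F_def)
  note rd = char_proj_measure(2)[OF ps s]
  note sp = proj_measure_AE[OF s supp]
  have ac: "absolutely_continuous lborel (proj_measure z \<nu>)" if "cmod z = 1" for z
    by (rule L2_char_absolutely_continuous[OF rd sp[OF that], of K]) (simp add: char K0[OF that])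
  have "measure_in_sobolev \<gamma> (proj_measure z \<nu>)" if z: "cmod z = 1" for z
  proof -
    let ?M = "proj_measure z \<nu>"
    note ld = line_density[OF rd ac[OF z]]
    have [measurable]: "line_density ?M \<in> borel_measurable borel" by (rule ld)
    have "(\<integral>\<^sup>+x. ennreal ((line_density ?M x)\<^sup>2) \<partial>lborel) \<le> ennreal K"
      by (rule L2_char_density[OF rd sp[OF z]]) (simp add: char K0[OF z])
    then have "integrable lborel (\<lambda>x. (line_density ?M x)\<^sup>2)"
      by (intro integrableI_bounded) (auto intro: le_less_trans)
    then have g: "lebesgue_density ?M \<in> L2_line"
      unfolding L2_line_def by (simp add: lebesgue_density_eq[abs_def])
    have tr: "(LINT x:{-R..R}|lborel. cis (\<xi> * x) * lebesgue_density ?M x) = F z \<xi>" if "D \<le> R" for R \<xi>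
      using lebesgue_density_transform(2)[OF rd ac[OF z] sp[OF z] that] by (simp add: char)
    have L: "L2_fourier (lebesgue_density ?M) \<in> L2_line" "AE \<xi> in lborel. L2_fourier (lebesgue_density ?M) \<xi> = F z \<xi>"
      by (rule L2_fourier_eventually_const[OF FL2[OF z] tr]; assumption)+
    have [measurable]: "L2_fourier (lebesgue_density ?M) \<in> borel_measurable lborel"
      using L(1) by (simp add: L2_line_def)
    have "integrable lborel (\<lambda>\<xi>. (cmod (L2_fourier (lebesgue_density ?M) \<xi>))\<^sup>2 * W \<xi> powr \<gamma>)"
    proof (rule integrable_cong_AE_imp[OF Fw[OF z]])
      show "AE \<xi> in lborel. (cmod (F z \<xi>))\<^sup>2 * W \<xi> powr \<gamma> = (cmod (L2_fourier (lebesgue_density ?M) \<xi>))\<^sup>2 * W \<xi> powr \<gamma>"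
        using L(2) by eventually_elim simp
    qed measurable
    then show ?thesis
      using g ac[OF z] unfolding measure_in_sobolev_def sobolev_def W_def by blast
  qed
  moreover have "((\<lambda>z. sobolev_norm \<gamma> (\<lambda>x. lebesgue_density (proj_measure z \<nu>) x - lebesgue_density (proj_measure z\<^sub>0 \<nu>) x)) \<longlongrightarrow> 0) (at z\<^sub>0 within sphere 0 1)"
    if z0: "cmod z\<^sub>0 = 1" for z\<^sub>0
  proof -
    define N where "N z = (LINT t|lborel. (cmod (F z t - F z\<^sub>0 t))\<^sup>2 * W t powr \<gamma>)" for z
    have sq: "(cmod (F z t - F z\<^sub>0 t))\<^sup>2 \<le> 2 * (cmod (F z t))\<^sup>2 + 2 * (cmod (F z\<^sub>0 t))\<^sup>2" for z t
    proof -
      have "(cmod (F z t - F z\<^sub>0 t))\<^sup>2 \<le> (cmod (F z t) + cmod (F z\<^sub>0 t))\<^sup>2" by (intro power_mono norm_triangle_ineq4) simp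
      also have "\<dots> \<le> 2 * (cmod (F z t))\<^sup>2 + 2 * (cmod (F z\<^sub>0 t))\<^sup>2"
        using sum_squares_bound[of "cmod (F z t)" "cmod (F z\<^sub>0 t)"] by (simp add: power2_sum)
      finally show ?thesis .
    qed
    have norm: "sobolev_norm \<gamma> (\<lambda>x. lebesgue_density (proj_measure z \<nu>) x - lebesgue_density (proj_measure z\<^sub>0 \<nu>) x) = sqrt (N z)"
      if z: "cmod z = 1" for z
    proof -
      let ?g = "\<lambda>x. lebesgue_density (proj_measure z \<nu>) x - lebesgue_density (proj_measure z\<^sub>0 \<nu>) x"
      let ?h = "\<lambda>t. F z t - F z\<^sub>0 t"
      have "integrable lborel (\<lambda>t. (cmod (?h t))\<^sup>2)"
        by (rule Bochner_Integration.integrable_bound[OF Bochner_Integration.integrable_add[OF integrable_mult_right[OF Fint[OF z], of 2] integrable_mult_right[OF Fint[OF z0], of 2]]])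
          (use sq in auto)
      then have hL2: "?h \<in> L2_line" by (simp add: L2_line_def)
      have tr: "(LINT x:{-R..R}|lborel. cis (\<xi> * x) * ?g x) = ?h \<xi>" if "D \<le> R" for R \<xi>
        using lebesgue_density_transform[OF rd ac[OF z] sp[OF z] that, of \<xi>] lebesgue_density_transform[OF rd ac[OF z0] sp[OF z0] that, of \<xi>]
        by (simp add: right_diff_distrib set_integral_diff char)
      have L: "L2_fourier ?g \<in> L2_line" "AE \<xi> in lborel. L2_fourier ?g \<xi> = ?h \<xi>"
        by (rule L2_fourier_eventually_const[OF hL2 tr]; assumption)+
      have [measurable]: "L2_fourier ?g \<in> borel_measurable lborel"
        using L(1) by (simp add: L2_line_def)
      have "(LINT \<xi>|lborel. (cmod (L2_fourier ?g \<xi>))\<^sup>2 * W \<xi> powr \<gamma>) = N z"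
        unfolding N_def
      proof (rule integral_cong_AE)
        show "AE \<xi> in lborel. (cmod (L2_fourier ?g \<xi>))\<^sup>2 * W \<xi> powr \<gamma> = (cmod (F z \<xi> - F z\<^sub>0 \<xi>))\<^sup>2 * W \<xi> powr \<gamma>"
          using L(2) by eventually_elim simp
      qed measurable
      then show ?thesis by (simp add: sobolev_norm_def W_def)
    qed
    \<comment> \<open>\<open>K\<close> is an arbitrary real number; the passage from extended to
      real inequalities below uses a nonnegative bound.\<close>
    define K1 where "K1 = max K 0"
    have K1: "0 \<le> K1" "\<And>z. cmod z = 1 \<Longrightarrow> (\<integral>\<^sup>+t. ennreal ((cmod (F z t))\<^sup>2 * W t powr (2 * \<gamma>)) \<partial>lborel) \<le> ennreal K1"
      using order_trans[OF K' ennreal_leI[of K K1]] by (auto simp: K1_def)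
    have bound: "N z \<le> W T powr (- \<gamma>) * (4 * K1) + 2 * T * (D * T * cmod (z - z\<^sub>0))\<^sup>2 * W T powr \<gamma>"
      if z: "cmod z = 1" and T: "0 < T" for z T
    proof -
      have pt: "(cmod (F z t - F z\<^sub>0 t))\<^sup>2 * W t powr \<gamma> \<le> W T powr (- \<gamma>) * (2 * ((cmod (F z t))\<^sup>2 * W t powr (2 * \<gamma>)) + 2 * ((cmod (F z\<^sub>0 t))\<^sup>2 * W t powr (2 * \<gamma>)))
          + (D * T * cmod (z - z\<^sub>0))\<^sup>2 * W T powr \<gamma> * indicator {-T..T} t" for t
      proof (cases "t \<in> {-T..T}")
        case True
        then have tT: "\<bar>t\<bar> \<le> T" by auto
        have "cmod (F z t - F z\<^sub>0 t) \<le> D * cmod (of_real t * z - of_real t * z\<^sub>0)"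
          unfolding F_def by (rule measure_fourier_lipschitz[OF ps s supp])
        also have "\<dots> = D * (\<bar>t\<bar> * cmod (z - z\<^sub>0))" by (simp add: norm_mult flip: right_diff_distrib)
        also have "\<dots> \<le> D * (T * cmod (z - z\<^sub>0))"
        proof (rule mult_left_mono)
          show "0 \<le> D"
          proof (rule ccontr)
            assume "\<not> 0 \<le> D"
            then have "AE w in \<nu>. False" using supp by (auto elim!: eventually_mono dest: order_trans[OF norm_ge_zero])
            then show False using prob_space.AE_False[OF ps] by simp
          qed
        qed (use tT in \<open>auto intro: mult_right_mono\<close>)
        finally have "(cmod (F z t - F z\<^sub>0 t))\<^sup>2 \<le> (D * T * cmod (z - z\<^sub>0))\<^sup>2" by (intro power_mono) (auto simp: mult.assoc)
        moreover have "t\<^sup>2 \<le> T\<^sup>2" using tT T by (simp add: abs_le_square_iff[symmetric])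
        then have "W t powr \<gamma> \<le> W T powr \<gamma>" using \<gamma> W1[of t] by (intro powr_mono2) (auto simp: W_def)
        ultimately have "(cmod (F z t - F z\<^sub>0 t))\<^sup>2 * W t powr \<gamma> \<le> (D * T * cmod (z - z\<^sub>0))\<^sup>2 * W T powr \<gamma>" by (intro mult_mono) auto
        moreover have "0 \<le> W T powr (- \<gamma>) * (2 * ((cmod (F z t))\<^sup>2 * W t powr (2 * \<gamma>)) + 2 * ((cmod (F z\<^sub>0 t))\<^sup>2 * W t powr (2 * \<gamma>)))" by simp
        ultimately show ?thesis using True by (simp add: add_increasing)
      next
        case False
        then have "T\<^sup>2 \<le> t\<^sup>2" using T by (simp add: abs_le_square_iff[symmetric]) linarith
        then have "W T \<le> W t" by (simp add: W_def)
        then have "1 \<le> W T powr (- \<gamma>) * W t powr \<gamma>"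
          using \<gamma> W1[of T] powr_mono2[of \<gamma> "W T" "W t"] by (simp add: powr_minus field_simps)
        then have "1 * W t powr \<gamma> \<le> (W T powr (- \<gamma>) * W t powr \<gamma>) * W t powr \<gamma>" by (intro mult_right_mono) auto
        also have "\<dots> = W T powr (- \<gamma>) * W t powr (2 * \<gamma>)" by (simp add: mult.assoc flip: powr_add)
        finally have "(cmod (F z t - F z\<^sub>0 t))\<^sup>2 * W t powr \<gamma> \<le> (2 * (cmod (F z t))\<^sup>2 + 2 * (cmod (F z\<^sub>0 t))\<^sup>2) * (W T powr (- \<gamma>) * W t powr (2 * \<gamma>))"
          using sq[of z t] by (intro mult_mono) auto
        then show ?thesis using False by (simp add: algebra_simps)
      qed
      have "ennreal (N z) \<le> (\<integral>\<^sup>+t. ennreal ((cmod (F z t - F z\<^sub>0 t))\<^sup>2 * W t powr \<gamma>) \<partial>lborel)"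
        unfolding N_def by (rule ennreal_integral_le_nn_integral) auto
      also have "\<dots> \<le> (\<integral>\<^sup>+t. ennreal (W T powr (- \<gamma>) * (2 * ((cmod (F z t))\<^sup>2 * W t powr (2 * \<gamma>)) + 2 * ((cmod (F z\<^sub>0 t))\<^sup>2 * W t powr (2 * \<gamma>)))
          + (D * T * cmod (z - z\<^sub>0))\<^sup>2 * W T powr \<gamma> * indicator {-T..T} t) \<partial>lborel)"
        by (intro nn_integral_mono ennreal_leI pt)
      also have "\<dots> = (\<integral>\<^sup>+t. ennreal (W T powr (- \<gamma>)) * (2 * ennreal ((cmod (F z t))\<^sup>2 * W t powr (2 * \<gamma>)) + 2 * ennreal ((cmod (F z\<^sub>0 t))\<^sup>2 * W t powr (2 * \<gamma>)))
          + ennreal ((D * T * cmod (z - z\<^sub>0))\<^sup>2 * W T powr \<gamma>) * indicator {-T..T} t \<partial>lborel)"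
        by (intro nn_integral_cong) (simp add: ennreal_mult'' ennreal_mult' ennreal_indicator[symmetric])
      also have "\<dots> = ennreal (W T powr (- \<gamma>)) * (2 * (\<integral>\<^sup>+t. ennreal ((cmod (F z t))\<^sup>2 * W t powr (2 * \<gamma>)) \<partial>lborel) + 2 * (\<integral>\<^sup>+t. ennreal ((cmod (F z\<^sub>0 t))\<^sup>2 * W t powr (2 * \<gamma>)) \<partial>lborel))
          + ennreal ((D * T * cmod (z - z\<^sub>0))\<^sup>2 * W T powr \<gamma>) * emeasure lborel {-T..T}"
        by (simp add: nn_integral_add nn_integral_cmult)
      also have "\<dots> \<le> ennreal (W T powr (- \<gamma>)) * (2 * ennreal K1 + 2 * ennreal K1) + ennreal ((D * T * cmod (z - z\<^sub>0))\<^sup>2 * W T powr \<gamma>) * ennreal (2 * T)"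
        using T by (intro add_mono mult_left_mono K1 z z0) auto
      also have "\<dots> = ennreal (W T powr (- \<gamma>) * (4 * K1) + 2 * T * (D * T * cmod (z - z\<^sub>0))\<^sup>2 * W T powr \<gamma>)"
      proof -
        have "ennreal w * (2 * ennreal K1 + 2 * ennreal K1) + ennreal X * ennreal (2 * T) = ennreal (w * (4 * K1) + X * (2 * T))"
          if "0 \<le> w" "0 \<le> X" for w X
        proof -
          have "2 * ennreal K1 + 2 * ennreal K1 = ennreal (2 * K1) + ennreal (2 * K1)" using K1(1) by (simp add: ennreal_mult')
          also have "\<dots> = ennreal (4 * K1)" using K1(1) by (subst ennreal_plus[symmetric]) auto
          finally show ?thesis using that K1(1) T by (simp add: ennreal_mult)
        qed
        from this[of "W T powr (- \<gamma>)" "(D * T * cmod (z - z\<^sub>0))\<^sup>2 * W T powr \<gamma>"] show ?thesis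
          by (simp add: mult_ac)
      qed
      finally show ?thesis using T K1(1) by (subst (asm) ennreal_le_iff) auto
    qed
    have N0: "0 \<le> N z" for z unfolding N_def by (intro integral_nonneg_AE) auto
    have "(N \<longlongrightarrow> 0) (at z\<^sub>0 within sphere 0 1)"
    proof (rule tendstoI)
      fix e :: real assume e: "0 < e"
      have "((\<lambda>T. W T powr (- \<gamma>) * (4 * K1)) \<longlongrightarrow> 0) at_top"
      proof -
        have "filterlim W at_top at_top"
          unfolding W_def by (intro filterlim_tendsto_add_at_top[OF tendsto_const] filterlim_pow_at_top filterlim_ident) auto
        then have "((\<lambda>T. W T powr (- \<gamma>)) \<longlongrightarrow> 0) at_top" using \<gamma> by (intro tendsto_neg_powr) auto
        then show ?thesis by (rule tendsto_mult_left_zero)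
      qed
      from order_tendstoD(2)[OF this, of "e / 2"] e
      have "\<forall>\<^sub>F T in at_top. W T powr (- \<gamma>) * (4 * K1) < e / 2" by simp
      then have "\<forall>\<^sub>F T in at_top. W T powr (- \<gamma>) * (4 * K1) < e / 2 \<and> 0 < T" using eventually_gt_at_top[of 0] by (rule eventually_conj)
      then obtain T where T: "W T powr (- \<gamma>) * (4 * K1) < e / 2" "0 < T"
        by (auto simp: eventually_at_top_linorder)
      have "((\<lambda>z. 2 * T * (D * T * cmod (z - z\<^sub>0))\<^sup>2 * W T powr \<gamma>) \<longlongrightarrow> 2 * T * (D * T * cmod (z\<^sub>0 - z\<^sub>0))\<^sup>2 * W T powr \<gamma>) (at z\<^sub>0 within sphere 0 1)"
        by (intro tendsto_intros)
      from order_tendstoD(2)[OF this, of "e / 2"] e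
      have "\<forall>\<^sub>F z in at z\<^sub>0 within sphere 0 1. 2 * T * (D * T * cmod (z - z\<^sub>0))\<^sup>2 * W T powr \<gamma> < e / 2" by simp
      moreover have "\<forall>\<^sub>F z in at z\<^sub>0 within sphere 0 1. cmod z = 1"
        unfolding eventually_at_filter by (auto simp: sphere_def dist_norm)
      ultimately show "\<forall>\<^sub>F z in at z\<^sub>0 within sphere 0 1. dist (N z) 0 < e"
      proof eventually_elim
        case (elim z)
        then show ?case using bound[OF elim(2) T(2)] T(1) N0[of z] by (simp add: dist_norm)
      qed
    qed
    then have "((\<lambda>z. sqrt (N z)) \<longlongrightarrow> sqrt 0) (at z\<^sub>0 within sphere 0 1)" by (rule tendsto_real_sqrt)
    then have "((\<lambda>z. sqrt (N z)) \<longlongrightarrow> 0) (at z\<^sub>0 within sphere 0 1)" by simp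
    then show ?thesis
    proof (rule Lim_transform_eventually)
      show "\<forall>\<^sub>F z in at z\<^sub>0 within sphere 0 1. sqrt (N z) = sobolev_norm \<gamma> (\<lambda>x. lebesgue_density (proj_measure z \<nu>) x - lebesgue_density (proj_measure z\<^sub>0 \<nu>) x)"
        unfolding eventually_at_filter using norm by (auto simp: sphere_def dist_norm)
    qed
  qed
  ultimately show ?thesis by (auto simp: sphere_def dist_norm)
qed

section \<open>Summing the Fourier mass over geometric annuli\<close>

lemma exists_geometric_bracket:
  fixes \<rho> c x :: real
  assumes \<rho>: "0 < \<rho>" "\<rho> < 1" and c: "0 < c" and x: "c / \<rho> ^ Q < x"
  shows "\<exists>q. c / \<rho> ^ (Q + q) \<le> x \<and> x \<le> c / \<rho> ^ Suc (Q + q)"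
proof -
  have "0 < c / \<rho> ^ Q" using \<rho> c by simp
  then have "0 < x" using x by linarith
  then have "0 < c / x" using c by simp
  then obtain m0 where m0: "\<rho> ^ m0 < c / x" using real_arch_pow_inv[OF _ \<rho>(2)] by blast
  have iff: "x \<le> c / \<rho> ^ n \<longleftrightarrow> \<rho> ^ n \<le> c / x" for n using \<rho> \<open>0 < x\<close> by (simp add: field_simps)
  define m where "m = (LEAST m. x \<le> c / \<rho> ^ m)"
  have m: "x \<le> c / \<rho> ^ m" unfolding m_def by (rule LeastI[of _ m0]) (use m0 iff in simp)
  have "\<not> m \<le> Q"
  proof
    assume "m \<le> Q"
    then have "c / \<rho> ^ m \<le> c / \<rho> ^ Q" using \<rho> c by (intro divide_left_mono power_decreasing) auto
    then show False using m x by linarith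
  qed
  then obtain q where q: "m = Suc (Q + q)" by (metis add_Suc_right less_imp_Suc_add not_le)
  have "\<not> x \<le> c / \<rho> ^ (Q + q)" using not_less_Least[of "Q + q" "\<lambda>m. x \<le> c / \<rho> ^ m"] q unfolding m_def by simp
  then show ?thesis using m q by (intro exI[of _ q]) auto
qed

text \<open>\<open>F\<close> stands for the transform of the full measure, \<open>F2\<close> for
  that of the factor with decay. For |t| of order \<open>1 / cmod k ^ (M * m)\<close> the point
  \<open>cnj k ^ (M * m) * \<xi>\<close> is so close to 0 that \<open>F2\<close> is at least 1/2
  there, so the finite walk of \<open>v\<close> inherits the decay of \<open>F2\<close> up to a
  factor 2. The powers of |t| are -2 \<gamma> from the squared decay, \<gamma> from the weight and
  \<gamma> / 2 from the correlation bound for \<open>w\<close>. An annulus thus contributes the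
  order of |t| to the power -\<gamma> / 2, and these form a geometric series.\<close>

lemma fourier_weighted_bound:
  fixes F F2 :: "complex \<Rightarrow> complex"
  assumes k: "k \<noteq> 0" "cmod k < 1" and fin: "finite (set_pmf w)"
    and Fc: "continuous_on UNIV F" and F1: "\<And>\<xi>. cmod (F \<xi>) \<le> 1"
    and F: "\<And>n \<xi>. cmod (F \<xi>) \<le> cmod (measure_fourier (walk k w n) \<xi>) * cmod (measure_fourier (walk k v n) \<xi>)"
    and F2: "\<And>n \<xi>. F2 \<xi> = measure_fourier (walk k v n) \<xi> * F2 (cnj k ^ n * \<xi>)"
    and c: "0 < c" "\<And>\<eta>. cmod \<eta> \<le> c \<Longrightarrow> 1 / 2 \<le> cmod (F2 \<eta>)"
    and decay: "0 < C2" "0 < \<gamma>" "\<And>\<xi>. \<xi> \<noteq> 0 \<Longrightarrow> cmod (F2 \<xi>) \<le> C2 * cmod \<xi> powr (- \<gamma>)"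
    and corr: "0 < M" "\<And>q z. Q \<le> q \<Longrightarrow> cmod z = 1 \<Longrightarrow>
      proj_corr (walk k (diff_pmf w) (M * q)) (cmod k ^ (M * q)) z \<le> (cmod k ^ (M * q)) powr (1 - \<gamma> / 2)"
  shows "\<exists>K. \<forall>z. cmod z = 1 \<longrightarrow> (\<integral>\<^sup>+t. ennreal ((cmod (F (of_real t * z)))\<^sup>2 * (1 + t\<^sup>2) powr (\<gamma> / 2)) \<partial>lborel) \<le> ennreal K"
proof -
  define \<rho> where "\<rho> = cmod k ^ M"
  have \<rho>: "0 < \<rho>" "\<rho> < 1" using k corr(1) by (auto simp: \<rho>_def power_less_one_iff)
  \<comment> \<open>The cap at 1 keeps the annuli inside the intervals \<open>[-T, T]\<close> to
    which \<open>measure_fourier_ball_le\<close> is applied.\<close>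
  define c0 where "c0 = min c 1"
  have c0: "0 < c0" "c0 \<le> c" "c0 \<le> 1" using c(1) by (auto simp: c0_def)
  obtain Q0 where Q0: "\<rho> ^ Q0 < c0" using real_arch_pow_inv[OF c0(1) \<rho>(2)] by blast
  \<comment> \<open>\<open>Q\<close> makes the correlation bound available; \<open>Q0\<close> puts
    all annuli beyond |t| = 1, where 1 + t^2 is at most 2 t^2.\<close>
  define Q1 where "Q1 = max Q Q0"
  define a where "a q = c0 / \<rho> ^ (Q1 + q)" for q
  have a1: "1 \<le> a q" for q
  proof -
    have "\<rho> ^ (Q1 + q) \<le> \<rho> ^ Q0" using \<rho> by (intro power_decreasing) (auto simp: Q1_def)
    then have "\<rho> ^ (Q1 + q) \<le> c0" using Q0 by linarith
    then show ?thesis using \<rho> unfolding a_def by (subst le_divide_eq_1_pos) auto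
  qed
  define A where "A q = {t. a q \<le> \<bar>t\<bar> \<and> \<bar>t\<bar> \<le> a (Suc q)}" for q
  define G where "G = sqrt (2 * pi) * exp (1 / 2) * gauss_const"
  have G: "0 < G" using gauss_const_pos by (simp add: G_def)
  define B where "B = (2 * C2)\<^sup>2 * (2 powr (\<gamma> / 2) * c0 powr (- \<gamma>)) * G"
  have B: "0 < B" using decay(1) c0(1) G by (simp add: B_def)
  define f where "f z t = (cmod (F (of_real t * z)))\<^sup>2 * (1 + t\<^sup>2) powr (\<gamma> / 2)" for z t
  define T1 where "T1 = a 0"
  have T1: "1 \<le> T1" unfolding T1_def by (rule a1)
  define s where "s = \<rho> powr (\<gamma> / 2)"
  have s: "0 < s" "s < 1" using \<rho> decay(2) powr_less_mono2[of "\<gamma> / 2" \<rho> 1] by (auto simp: s_def)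
  have meas: "(\<lambda>t. ennreal ((cmod (measure_fourier (walk k w n) (of_real t * z)))\<^sup>2) * indicator {-T..T} t) \<in> borel_measurable borel" for n z T
  proof -
    have "measure_fourier (walk k w n) \<xi> = (\<Sum>d\<in>set_pmf (walk k w n). pmf (walk k w n) d *\<^sub>R cis (Re (\<xi> * cnj d)))" for \<xi>
      unfolding measure_fourier_def by (rule integral_measure_pmf) (use fin in auto)
    then have "continuous_on UNIV (\<lambda>t. measure_fourier (walk k w n) (of_real t * z))"
      by (simp only:) (intro continuous_intros)
    then have [measurable]: "(\<lambda>t. measure_fourier (walk k w n) (of_real t * z)) \<in> borel_measurable borel"
      by (rule borel_measurable_continuous_onI)
    show ?thesis by measurable
  qed
  have annulus: "(\<integral>\<^sup>+t. ennreal (f z t) * indicator (A q) t \<partial>lborel) \<le> ennreal (B * s powr (- 1) * s ^ (Q1 + q))"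
    if z: "cmod z = 1" for z q
  proof -
    \<comment> \<open>The scale belongs to the outer radius: |t| is at most
      \<open>a (Suc q)\<close>, which is \<open>c0 / \<rho> ^ m\<close>, so multiplication by
      \<open>cnj k ^ (M * m)\<close> brings the frequency to modulus at most
      \<open>c0\<close>.\<close>
    define m where "m = Suc (Q1 + q)"
    define T where "T = 1 / \<rho> ^ m"
    have T: "0 < T" using \<rho> by (simp add: T_def)
    have rm: "cmod k ^ (M * m) = \<rho> ^ m" by (simp add: \<rho>_def power_mult)
    let ?\<chi> = "\<lambda>t. cmod (measure_fourier (walk k w (M * m)) (of_real t * z))"
    define b where "b = (2 * C2)\<^sup>2 * (2 powr (\<gamma> / 2) * a q powr (- \<gamma>))"
    have b: "0 \<le> b" by (simp add: b_def)
    have pt: "f z t \<le> b * (?\<chi> t)\<^sup>2" "t \<in> {-T..T}" if t: "t \<in> A q" for t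
    proof -
      have t1: "1 \<le> \<bar>t\<bar>" "a q \<le> \<bar>t\<bar>" "\<bar>t\<bar> \<le> a (Suc q)" using t a1[of q] by (auto simp: A_def)
      have am: "a (Suc q) = c0 * T" by (simp add: a_def T_def m_def)
      have "c0 * T \<le> 1 * T" using c0 T by (intro mult_right_mono) auto
      then show "t \<in> {-T..T}" using t1 am by auto
      have nz: "of_real t * z \<noteq> 0" using t1 z by auto
      have cm: "cmod (of_real t * z) = \<bar>t\<bar>" using z by (simp add: norm_mult)
      have "cmod (cnj k ^ (M * m) * (of_real t * z)) = \<rho> ^ m * \<bar>t\<bar>"
        by (simp add: norm_mult norm_power rm z)
      also have "\<dots> \<le> \<rho> ^ m * (c0 * T)" using t1 am \<rho> by (intro mult_left_mono) auto
      also have "\<dots> = c0" using \<rho> by (simp add: T_def)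
      finally have "1 / 2 \<le> cmod (F2 (cnj k ^ (M * m) * (of_real t * z)))" using c0 by (intro c(2)) simp
      then have "cmod (measure_fourier (walk k v (M * m)) (of_real t * z)) * (1 / 2)
        \<le> cmod (measure_fourier (walk k v (M * m)) (of_real t * z)) * cmod (F2 (cnj k ^ (M * m) * (of_real t * z)))"
        by (rule mult_left_mono) simp
      also have "\<dots> = cmod (F2 (of_real t * z))" using F2[of "of_real t * z" "M * m"] by (simp add: norm_mult)
      also have "\<dots> \<le> C2 * \<bar>t\<bar> powr (- \<gamma>)" using decay(3)[OF nz] by (simp only: cm)
      finally have "cmod (measure_fourier (walk k v (M * m)) (of_real t * z)) \<le> 2 * C2 * \<bar>t\<bar> powr (- \<gamma>)" by simp
      then have "?\<chi> t * cmod (measure_fourier (walk k v (M * m)) (of_real t * z)) \<le> ?\<chi> t * (2 * C2 * \<bar>t\<bar> powr (- \<gamma>))"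
        by (rule mult_left_mono) simp
      then have "cmod (F (of_real t * z)) \<le> ?\<chi> t * (2 * C2 * \<bar>t\<bar> powr (- \<gamma>))"
        using F[of "of_real t * z" "M * m"] by linarith
      then have "(cmod (F (of_real t * z)))\<^sup>2 \<le> (?\<chi> t * (2 * C2 * \<bar>t\<bar> powr (- \<gamma>)))\<^sup>2" by (intro power_mono) auto
      then have 1: "(cmod (F (of_real t * z)))\<^sup>2 \<le> (?\<chi> t)\<^sup>2 * (2 * C2)\<^sup>2 * (\<bar>t\<bar> powr (- \<gamma>))\<^sup>2" by (simp add: power_mult_distrib mult.assoc)
      have "1 \<le> t\<^sup>2" using t1(1) by (metis abs_1 abs_le_square_iff one_power2)
      then have "(1 + t\<^sup>2) powr (\<gamma> / 2) \<le> (2 * t\<^sup>2) powr (\<gamma> / 2)" using decay(2) by (intro powr_mono2) auto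
      also have "\<dots> = 2 powr (\<gamma> / 2) * \<bar>t\<bar> powr \<gamma>"
      proof -
        have "t\<^sup>2 = \<bar>t\<bar> powr 2" using t1(1) powr_realpow[of "\<bar>t\<bar>" 2] by simp
        then have "t\<^sup>2 powr (\<gamma> / 2) = \<bar>t\<bar> powr (2 * (\<gamma> / 2))" by (simp only: powr_powr)
        then have "t\<^sup>2 powr (\<gamma> / 2) = \<bar>t\<bar> powr \<gamma>" by simp
        then show ?thesis by (simp add: powr_mult)
      qed
      finally have 2: "(1 + t\<^sup>2) powr (\<gamma> / 2) \<le> 2 powr (\<gamma> / 2) * \<bar>t\<bar> powr \<gamma>" .
      have "f z t \<le> ((?\<chi> t)\<^sup>2 * (2 * C2)\<^sup>2 * (\<bar>t\<bar> powr (- \<gamma>))\<^sup>2) * (2 powr (\<gamma> / 2) * \<bar>t\<bar> powr \<gamma>)"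
        unfolding f_def using 1 2 by (intro mult_mono) auto
      also have "\<dots> = (?\<chi> t)\<^sup>2 * (2 * C2)\<^sup>2 * 2 powr (\<gamma> / 2) * ((\<bar>t\<bar> powr (- \<gamma>))\<^sup>2 * \<bar>t\<bar> powr \<gamma>)" by (simp only: mult_ac)
      also have "(\<bar>t\<bar> powr (- \<gamma>))\<^sup>2 * \<bar>t\<bar> powr \<gamma> = \<bar>t\<bar> powr (- \<gamma>)"
        by (simp only: power2_eq_square powr_add[symmetric]) simp
      also have "(?\<chi> t)\<^sup>2 * (2 * C2)\<^sup>2 * 2 powr (\<gamma> / 2) * \<bar>t\<bar> powr (- \<gamma>) \<le> (?\<chi> t)\<^sup>2 * (2 * C2)\<^sup>2 * 2 powr (\<gamma> / 2) * a q powr (- \<gamma>)"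
        using t1(2) a1[of q] decay(2) by (intro mult_left_mono powr_mono2') auto
      finally show "f z t \<le> b * (?\<chi> t)\<^sup>2" by (simp add: b_def mult_ac)
    qed
    have "(\<integral>\<^sup>+t. ennreal (f z t) * indicator (A q) t \<partial>lborel) \<le> (\<integral>\<^sup>+t. ennreal b * (ennreal ((?\<chi> t)\<^sup>2) * indicator {-T..T} t) \<partial>lborel)"
    proof (intro nn_integral_mono)
      fix t
      show "ennreal (f z t) * indicator (A q) t \<le> ennreal b * (ennreal ((?\<chi> t)\<^sup>2) * indicator {-T..T} t)"
        using pt[of t] b by (cases "t \<in> A q") (simp_all add: ennreal_mult[symmetric] ennreal_leI)
    qed
    also have "\<dots> = ennreal b * (\<integral>\<^sup>+t. ennreal ((?\<chi> t)\<^sup>2) * indicator {-T..T} t \<partial>lborel)"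
      using meas by (intro nn_integral_cmult) simp
    also have "\<dots> \<le> ennreal b * ennreal (G * T * proj_corr (diff_pmf (walk k w (M * m))) (1 / T) z)"
      unfolding G_def using fin T by (intro mult_left_mono measure_fourier_ball_le) auto
    also have "\<dots> \<le> ennreal b * ennreal (G * T * (\<rho> ^ m) powr (1 - \<gamma> / 2))"
    proof (intro mult_left_mono ennreal_leI)
      have "Q \<le> m" by (simp add: m_def Q1_def)
      from corr(2)[OF this z] show "proj_corr (diff_pmf (walk k w (M * m))) (1 / T) z \<le> (\<rho> ^ m) powr (1 - \<gamma> / 2)"
        unfolding rm walk_diff by (simp add: T_def)
    qed (use G T in auto)
    also have "\<dots> = ennreal (b * (G * T * (\<rho> ^ m) powr (1 - \<gamma> / 2)))" using b by (simp add: ennreal_mult')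
    also have "b * (G * T * (\<rho> ^ m) powr (1 - \<gamma> / 2)) = B * s powr (- 1) * s ^ (Q1 + q)"
    proof -
      have e1: "T * (\<rho> ^ m) powr (1 - \<gamma> / 2) = 1 / s ^ m"
        using \<rho> by (simp add: T_def s_def powr_diff power_powr_commute)
      have e2: "a q powr (- \<gamma>) = c0 powr (- \<gamma>) * (s ^ (Q1 + q) * s ^ (Q1 + q))"
      proof -
        have "(\<rho> ^ (Q1 + q)) powr \<gamma> = (\<rho> powr \<gamma>) ^ (Q1 + q)" by (rule power_powr_commute[OF \<rho>(1)])
        also have "\<rho> powr \<gamma> = s * s" unfolding s_def by (simp flip: powr_add)
        finally have "(\<rho> ^ (Q1 + q)) powr \<gamma> = s ^ (Q1 + q) * s ^ (Q1 + q)" by (simp add: power_mult_distrib)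
        then show ?thesis using \<rho> c0(1) unfolding a_def by (simp add: powr_divide powr_minus field_simps)
      qed
      have "b * (G * T * (\<rho> ^ m) powr (1 - \<gamma> / 2)) = b * G * (T * (\<rho> ^ m) powr (1 - \<gamma> / 2))" by (simp only: mult_ac)
      also have "\<dots> = B * (s ^ (Q1 + q) * s ^ (Q1 + q) * (1 / s ^ m))" unfolding e1 b_def B_def e2 by (simp only: mult_ac)
      also have "s ^ (Q1 + q) * s ^ (Q1 + q) * (1 / s ^ m) = s powr (- 1) * s ^ (Q1 + q)"
        using s by (simp add: m_def powr_minus field_simps)
      finally show ?thesis by (simp only: mult_ac)
    qed
    finally show ?thesis .
  qed
  define K where "K = 2 * T1 * (1 + T1\<^sup>2) powr (\<gamma> / 2) + (\<Sum>q. B * s powr (- 1) * s ^ Q1 * s ^ q)"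
  have sum: "summable (\<lambda>q. B * s powr (- 1) * s ^ Q1 * s ^ q)" using s by (intro summable_mult summable_geometric) auto
  have "(\<integral>\<^sup>+t. ennreal (f z t) \<partial>lborel) \<le> ennreal K" if z: "cmod z = 1" and fm: "f z \<in> borel_measurable borel" for z
  proof -
    have Am[measurable]: "A q \<in> sets borel" for q
      unfolding A_def by measurable
    have [measurable]: "f z \<in> borel_measurable borel" by fact
    have "(\<integral>\<^sup>+t. ennreal (f z t) \<partial>lborel) \<le> (\<integral>\<^sup>+t. ennreal ((1 + T1\<^sup>2) powr (\<gamma> / 2)) * indicator {-T1..T1} t + (\<Sum>q. ennreal (f z t) * indicator (A q) t) \<partial>lborel)"
    proof (intro nn_integral_mono)
      fix t
      show "ennreal (f z t) \<le> ennreal ((1 + T1\<^sup>2) powr (\<gamma> / 2)) * indicator {-T1..T1} t + (\<Sum>q. ennreal (f z t) * indicator (A q) t)"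
      proof (cases "\<bar>t\<bar> \<le> T1")
        case True
        then have "t\<^sup>2 \<le> T1\<^sup>2" using T1 by (simp add: abs_le_square_iff[symmetric])
        then have "(1 + t\<^sup>2) powr (\<gamma> / 2) \<le> (1 + T1\<^sup>2) powr (\<gamma> / 2)" using decay(2) by (intro powr_mono2) auto
        moreover have "(cmod (F (of_real t * z)))\<^sup>2 \<le> 1" by (intro power_le_one F1) simp
        ultimately have "f z t \<le> 1 * (1 + T1\<^sup>2) powr (\<gamma> / 2)" unfolding f_def by (intro mult_mono) auto
        then have "ennreal (f z t) \<le> ennreal ((1 + T1\<^sup>2) powr (\<gamma> / 2)) * indicator {-T1..T1} t" using True by (simp add: ennreal_leI abs_le_iff)
        then show ?thesis by (rule order_trans) simp
      next
        case False
        then have "c0 / \<rho> ^ Q1 < \<bar>t\<bar>" by (simp add: T1_def a_def)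
        from exists_geometric_bracket[OF \<rho> c0(1) this] obtain q where "t \<in> A q" by (auto simp: A_def a_def)
        then have "ennreal (f z t) = ennreal (f z t) * indicator (A q) t" by simp
        also have "\<dots> \<le> (\<Sum>q. ennreal (f z t) * indicator (A q) t)"
        proof -
          define u where "u q = ennreal (f z t) * indicator (A q) t" for q
          have "sum u {q} \<le> (\<Sum>q. u q)" by (rule sum_le_suminf) auto
          then have "u q \<le> (\<Sum>q. u q)" by simp
          then show ?thesis unfolding u_def .
        qed
        finally show ?thesis by (rule order_trans) simp
      qed
    qed
    also have "\<dots> = ennreal ((1 + T1\<^sup>2) powr (\<gamma> / 2)) * emeasure lborel {-T1..T1} + (\<Sum>q. \<integral>\<^sup>+t. ennreal (f z t) * indicator (A q) t \<partial>lborel)"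
    proof -
      have "(\<integral>\<^sup>+t. ennreal ((1 + T1\<^sup>2) powr (\<gamma> / 2)) * indicator {-T1..T1} t + (\<Sum>q. ennreal (f z t) * indicator (A q) t) \<partial>lborel)
        = (\<integral>\<^sup>+t. ennreal ((1 + T1\<^sup>2) powr (\<gamma> / 2)) * indicator {-T1..T1} t \<partial>lborel) + (\<integral>\<^sup>+t. (\<Sum>q. ennreal (f z t) * indicator (A q) t) \<partial>lborel)"
        by (rule nn_integral_add) measurable
      also have "(\<integral>\<^sup>+t. (\<Sum>q. ennreal (f z t) * indicator (A q) t) \<partial>lborel) = (\<Sum>q. \<integral>\<^sup>+t. ennreal (f z t) * indicator (A q) t \<partial>lborel)"
        by (rule nn_integral_suminf) measurable
      also have "(\<integral>\<^sup>+t. ennreal ((1 + T1\<^sup>2) powr (\<gamma> / 2)) * indicator {-T1..T1} t \<partial>lborel) = ennreal ((1 + T1\<^sup>2) powr (\<gamma> / 2)) * emeasure lborel {-T1..T1}"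
        by (rule nn_integral_cmult_indicator) simp
      finally show ?thesis .
    qed
    also have "\<dots> \<le> ennreal ((1 + T1\<^sup>2) powr (\<gamma> / 2)) * ennreal (2 * T1) + (\<Sum>q. ennreal (B * s powr (- 1) * s ^ Q1 * s ^ q))"
    proof (intro add_mono mult_left_mono suminf_le)
      show "emeasure lborel {-T1..T1} \<le> ennreal (2 * T1)" using T1 by simp
      show "(\<integral>\<^sup>+t. ennreal (f z t) * indicator (A q) t \<partial>lborel) \<le> ennreal (B * s powr (- 1) * s ^ Q1 * s ^ q)" for q
        using annulus[OF z, of q] by (simp add: power_add mult.assoc)
    qed auto
    also have "(\<Sum>q. ennreal (B * s powr (- 1) * s ^ Q1 * s ^ q)) = ennreal (\<Sum>q. B * s powr (- 1) * s ^ Q1 * s ^ q)"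
      using B s by (intro suminf_ennreal2 sum) auto
    also have "ennreal ((1 + T1\<^sup>2) powr (\<gamma> / 2)) * ennreal (2 * T1) + \<dots> = ennreal K"
      unfolding K_def using T1 suminf_nonneg[OF sum] B s by (simp add: ennreal_mult[symmetric] ennreal_plus[symmetric] mult_ac del: ennreal_plus)
    finally show ?thesis .
  qed
  moreover have "f z \<in> borel_measurable borel" for z
    unfolding f_def by (intro borel_measurable_continuous_onI continuous_intros continuous_on_compose2[OF Fc])
      (auto simp: add_nonneg_eq_0_iff)
  ultimately show ?thesis unfolding f_def by blast
qed

section \<open>Verifying the hypotheses for the digits of the given system\<close>

text \<open>\<open>fourier_decay_off\<close> speaks of index sets of naturals, so \<Lambda> is
  transported along an injection. The factor \<open>b\<close> is there for the deleted digits, which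
  carry a power of \<open>l\<close>.\<close>

lemma digit_pmf_reindex:
  assumes fin: "finite \<Lambda>" and p: "prob_vector \<Lambda> p" and f: "inj_on f \<Lambda>"
  shows "digit_pmf (f ` \<Lambda>) (\<lambda>n. b * a (the_inv_into \<Lambda> f n)) (\<lambda>n. p (the_inv_into \<Lambda> f n)) = map_pmf ((*) b) (digit_pmf \<Lambda> a p)"
    and "prob_vector (f ` \<Lambda>) (\<lambda>n. p (the_inv_into \<Lambda> f n))"
proof -
  have inv: "the_inv_into \<Lambda> f (f i) = i" if "i \<in> \<Lambda>" for i by (rule the_inv_into_f_f[OF f that])
  show p': "prob_vector (f ` \<Lambda>) (\<lambda>n. p (the_inv_into \<Lambda> f n))"
    using p by (auto simp: prob_vector_def inv sum.reindex[OF f])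
  have fin': "finite (f ` \<Lambda>)" using fin by simp
  show "digit_pmf (f ` \<Lambda>) (\<lambda>n. b * a (the_inv_into \<Lambda> f n)) (\<lambda>n. p (the_inv_into \<Lambda> f n)) = map_pmf ((*) b) (digit_pmf \<Lambda> a p)"
  proof (rule pmf_eqI)
    fix c :: complex
    define A where "A = {c}"
    have "emeasure (digit_pmf (f ` \<Lambda>) (\<lambda>n. b * a (the_inv_into \<Lambda> f n)) (\<lambda>n. p (the_inv_into \<Lambda> f n))) A
      = (\<Sum>i\<in>\<Lambda>. ennreal (p i) * indicator A (b * a i))"
      using nn_integral_digit_pmf[OF fin' p', where f="indicator A" and a="\<lambda>n. b * a (the_inv_into \<Lambda> f n)"]
      by (simp add: sum.reindex[OF f] inv)
    also have "\<dots> = (\<integral>\<^sup>+c. indicator A (b * c) \<partial>digit_pmf \<Lambda> a p)"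
      by (rule nn_integral_digit_pmf[OF fin p, symmetric])
    also have "\<dots> = (\<integral>\<^sup>+c. indicator A c \<partial>map_pmf ((*) b) (digit_pmf \<Lambda> a p))"
      by (rule nn_integral_map_pmf[symmetric])
    also have "\<dots> = emeasure (map_pmf ((*) b) (digit_pmf \<Lambda> a p)) A"
      by (rule nn_integral_indicator) simp
    finally show "pmf (digit_pmf (f ` \<Lambda>) (\<lambda>n. b * a (the_inv_into \<Lambda> f n)) (\<lambda>n. p (the_inv_into \<Lambda> f n))) c
      = pmf (map_pmf ((*) b) (digit_pmf \<Lambda> a p)) c" by (simp add: A_def emeasure_pmf_single)
  qed
qed

text \<open>A single digit would make \<nu> a point mass, with correlation sum 1 at every scale. In
  terms of walks: the difference walk stays at 0, so it lies in every small ball with probability 1,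
  against the power bound.\<close>

lemma digits_not_all_equal:
  assumes l: "cmod l < 1" "l \<noteq> 0" and st: "stationary l \<alpha> \<nu>" and fin: "finite (set_pmf \<alpha>)"
    and s: "0 < s" "\<And>\<delta>. 0 < \<delta> \<Longrightarrow> corr_sum \<nu> \<delta> \<le> C * \<delta> powr s"
  shows "\<exists>c\<in>set_pmf \<alpha>. \<exists>c'\<in>set_pmf \<alpha>. c \<noteq> c'"
proof (rule ccontr)
  assume eq: "\<not> ?thesis"
  obtain c where c: "c \<in> set_pmf \<alpha>" using set_pmf_not_empty[of \<alpha>] by blast
  have "set_pmf \<alpha> = {c}" using c eq by blast
  then have "\<alpha> = return_pmf c" using set_pmf_subset_singleton[of \<alpha> c] by simp
  then have d: "diff_pmf \<alpha> = return_pmf 0" by (simp add: diff_pmf_def conv_pmf_def bind_return_pmf)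
  have w: "walk l (return_pmf 0) n = return_pmf 0" for n by (induction n) auto
  define A where "A = cmod c"
  have A: "cmod c' \<le> A" if "c' \<in> set_pmf \<alpha>" for c' using that \<open>set_pmf \<alpha> = {c}\<close> by (simp add: A_def)
  define r where "r = cmod l"
  have r: "0 < r" "r < 1" using l by (auto simp: r_def)
  define E where "E = 1 + 2 * (A / (1 - r))"
  have E: "0 < E" using r by (auto simp: E_def A_def intro!: add_pos_nonneg)
  have "1 \<le> C * E powr s * (r powr s) ^ n" for n
  proof -
    have "1 \<le> measure_pmf.prob (walk l (diff_pmf \<alpha>) n) (cball 0 (r ^ n))" using r by (simp add: d w)
    also have "\<dots> \<le> corr_sum \<nu> (r ^ n + 2 * (A / (1 - cmod l)) * cmod l ^ n)" by (rule prob_walk_le_corr_sum[OF l(1) fin A st])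
    also have "r ^ n + 2 * (A / (1 - cmod l)) * cmod l ^ n = E * r ^ n" by (simp add: E_def r_def algebra_simps)
    also have "corr_sum \<nu> (E * r ^ n) \<le> C * (E * r ^ n) powr s" using E r by (intro s(2)) simp
    also have "\<dots> = C * E powr s * (r powr s) ^ n" using E r by (simp add: powr_mult power_powr_commute)
    finally show ?thesis .
  qed
  moreover have "(\<lambda>n. C * E powr s * (r powr s) ^ n) \<longlonglongrightarrow> C * E powr s * 0"
    using r s(1) powr_less_mono2[of s r 1] by (intro tendsto_mult tendsto_const LIMSEQ_power_zero) auto
  ultimately have "1 \<le> C * E powr s * 0" by (intro LIMSEQ_le_const) auto
  then show False by simp
qed

text \<open>Both claims hold because no positive integer multiple of \<open>Arg l / pi\<close> is
  rational. The rotation is by the conjugate since that is how \<open>proj_corr_conv_le\<close>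
  turns the direction.\<close>

lemma irrational_argument:
  assumes l: "l \<noteq> 0" "Arg l / pi \<notin> \<rat>" and k: "0 < (k::nat)"
  shows "l ^ k \<notin> \<real>"
    and "0 < M \<Longrightarrow> 0 < e \<Longrightarrow> \<exists>n. cmod (((cnj (l ^ k) / of_real (cmod (l ^ k))) ^ M) ^ n - cis x) < e"
proof -
  have lp: "l = of_real (cmod l) * cis (Arg l)" using rcis_cmod_Arg[of l] by (simp add: rcis_def)
  have irr: "real m * (Arg l / pi) \<notin> \<rat>" if "0 < m" for m :: nat
  proof
    assume "real m * (Arg l / pi) \<in> \<rat>"
    then have "real m * (Arg l / pi) / real m \<in> \<rat>" by (intro Rats_divide) auto
    then show False using that l(2) by simp
  qed
  have lk: "l ^ k = of_real (cmod l ^ k) * cis (real k * Arg l)"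
    by (subst lp) (simp add: power_mult_distrib Complex.DeMoivre)
  show "l ^ k \<notin> \<real>"
  proof
    assume "l ^ k \<in> \<real>"
    then have "Im (l ^ k) = 0" by (simp add: complex_is_Real_iff)
    then have "sin (real k * Arg l) = 0" unfolding lk using l(1) by simp
    then obtain i where "real k * Arg l = of_int i * pi" by (auto simp: sin_zero_iff_int2)
    then have "real k * (Arg l / pi) = of_int i" by (simp add: field_simps)
    then show False using irr[OF k] by simp
  qed
  assume M: "0 < M" and e: "0 < e"
  have "cnj (l ^ k) / of_real (cmod (l ^ k)) = cis (- (real k * Arg l))"
    unfolding norm_power using l(1) by (subst lk) (simp add: cis_cnj)
  then have R: "(cnj (l ^ k) / of_real (cmod (l ^ k))) ^ M = cis (- (real (M * k) * Arg l))"
    by (simp add: Complex.DeMoivre mult.assoc)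
  have "- (real (M * k) * Arg l) / (2 * pi) \<notin> \<rat>"
  proof
    assume "- (real (M * k) * Arg l) / (2 * pi) \<in> \<rat>"
    then have "- 2 * (- (real (M * k) * Arg l) / (2 * pi)) \<in> \<rat>" by (intro Rats_mult) auto
    then show False using irr[of "M * k"] M k by simp
  qed
  from irrational_rotation_dense[OF this e] show "\<exists>n. cmod (((cnj (l ^ k) / of_real (cmod (l ^ k))) ^ M) ^ n - cis x) < e"
    unfolding R .
qed

theorem theorem3p7:
  fixes E' :: "complex set" and l :: complex
    and \<Lambda> :: "'i set" and a :: "'i \<Rightarrow> complex" and p :: "'i \<Rightarrow> real"
    and \<nu> :: "complex measure"
  assumes "E' \<subseteq> ball 0 1"
    and "hausdorff_dim E' = 0"
    and "fourier_decay_off E'"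
    and "l \<in> ball 0 1 - root_closure E'"
    and "l \<noteq> 0" and "Arg l / pi \<notin> \<rat>"
    and "finite \<Lambda>" and "\<Lambda> \<noteq> {}"
    and "strong_separation l \<Lambda> a"
    and "prob_vector \<Lambda> p"
    and "\<nu> = self_similar_measure l \<Lambda> a p"
    and "correlation_dim \<nu> > 1"
  shows "\<exists>\<gamma>>0.
           (\<forall>z\<in>sphere 0 1. measure_in_sobolev \<gamma> (proj_measure z \<nu>)) \<and>
           (\<forall>z\<^sub>0\<in>sphere 0 1.
              ((\<lambda>z. sobolev_norm \<gamma>
                      (\<lambda>x. lebesgue_density (proj_measure z \<nu>) x
                           - lebesgue_density (proj_measure z\<^sub>0 \<nu>) x))
                 \<longlongrightarrow> 0) (at z\<^sub>0 within sphere 0 1))"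
proof -
  have l: "cmod l < 1" "l \<noteq> 0" using assms(4,5) by auto
  define \<alpha> where "\<alpha> = digit_pmf \<Lambda> a p"
  have set\<alpha>: "set_pmf \<alpha> = a ` \<Lambda>" unfolding \<alpha>_def by (rule set_digit_pmf) fact+
  have fin: "finite (set_pmf \<alpha>)" using assms(7) by (simp add: set\<alpha>)
  have st: "stationary l \<alpha> \<nu>" unfolding \<alpha>_def assms(11) by (rule self_similar_measure_stationary) (use l assms in auto)
  note ps = stationary_prob_space[OF st] and sets = stationary_sets[OF st]
  define A where "A = Max (cmod ` set_pmf \<alpha>)"
  have A: "cmod c \<le> A" if "c \<in> set_pmf \<alpha>" for c
    unfolding A_def using that fin by (intro Max_ge) auto
  define D where "D = A / (1 - cmod l)"
  have supp: "AE w in \<nu>. cmod w \<le> D" unfolding D_def by (rule stationary_AE_bound[OF l(1) fin A st])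
  obtain s C where s: "1 < s" "0 < C" "\<And>\<delta>. 0 < \<delta> \<Longrightarrow> corr_sum \<nu> \<delta> \<le> C * \<delta> powr s"
    using corr_sum_power_bound[OF ps assms(12)] by blast
  obtain j C' \<theta> where j: "0 < C'" "0 < \<theta>" "\<theta> < cmod l ^ Suc j"
    "\<And>n N. n \<le> N \<Longrightarrow> measure_pmf.prob (walk (l ^ Suc j) (diff_pmf (walk l \<alpha> j)) N) (cball 0 (cmod l ^ (Suc j * n))) \<le> C' * \<theta> ^ n"
    using sparse_walk_bound[OF l fin A st s] by blast
  define k where "k = l ^ Suc j"
  define w where "w = walk l \<alpha> j"
  \<comment> \<open>The deleted digit is the last one of its block, hence the factor
    \<open>l ^ j\<close>.\<close>
  define v where "v = map_pmf ((*) (l ^ j)) \<alpha>"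
  have ck: "cmod k = cmod l ^ Suc j" by (simp only: k_def norm_power)
  have "cmod l ^ Suc j < 1" by (rule power_Suc_less_one) (use l in auto)
  then have k: "k \<noteq> 0" "cmod k < 1" using l unfolding ck by (simp_all only: k_def power_not_zero not_False_eq_True)
  have finw: "finite (set_pmf w)" and finv: "finite (set_pmf v)" using fin by (auto simp: w_def v_def)
  have prob: "measure_pmf.prob (walk k (diff_pmf w) N) (cball 0 (cmod k ^ n)) \<le> C' * \<theta> ^ n" if "n \<le> N" for n N
    using j(4)[OF that] unfolding k_def[symmetric] w_def[symmetric] ck power_mult .
  have split: "walk l \<alpha> (Suc j * n) = conv_pmf (walk k w n) (walk k v n)" for n
  proof -
    have "walk l \<alpha> (Suc j) = conv_pmf w v"
      using walk_add[of l \<alpha> j "Suc 0"] by (simp add: w_def v_def)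
    then show ?thesis unfolding k_def walk_mult[symmetric] by (simp only: walk_conv)
  qed

  text \<open>The measure generated by the deleted digits carries the Fourier decay.\<close>
  obtain f :: "'i \<Rightarrow> nat" where f: "inj_on f \<Lambda>"
    using finite_imp_inj_to_nat_seg[OF assms(7)] by blast
  define a' where "a' n = l ^ j * a (the_inv_into \<Lambda> f n)" for n
  define p' where "p' n = p (the_inv_into \<Lambda> f n)" for n
  define \<nu>2 where "\<nu>2 = self_similar_measure k (f ` \<Lambda>) a' p'"
  have dig: "digit_pmf (f ` \<Lambda>) a' p' = v" and p': "prob_vector (f ` \<Lambda>) p'"
    using digit_pmf_reindex(1)[OF assms(7,10) f, where b="l ^ j" and a=a] digit_pmf_reindex(2)[OF assms(7,10) f] unfolding v_def \<alpha>_def a'_def[abs_def] p'_def[abs_def] by auto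
  have st2: "stationary k v \<nu>2"
    unfolding \<nu>2_def dig[symmetric] by (rule self_similar_measure_stationary[OF k(2) _ p']) (use assms(7) in simp)
  have decay: "\<exists>C \<gamma>. C > 0 \<and> \<gamma> > 0 \<and> (\<forall>\<xi>. \<xi> \<noteq> 0 \<longrightarrow> cmod (measure_fourier \<nu>2 \<xi>) \<le> C * cmod \<xi> powr (- \<gamma>))"
  proof -
    have "k \<notin> \<real>" unfolding k_def using irrational_argument(1)[OF assms(5,6), of "Suc j"] by simp
    \<comment> \<open>The exponent \<open>Suc j\<close> depends on \<nu>, so \<open>l\<close> has to
      avoid the roots of every order of points of \<open>E'\<close>.\<close>
    moreover have "k \<notin> E'"
    proof
      assume "k \<in> E'"
      then have "l \<in> root_closure E'" unfolding root_closure_def k_def using l(1) by (intro UN_I[of "Suc j"]) auto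
      then show False using assms(4) by simp
    qed
    ultimately have "k \<in> ball 0 1 - (E' \<union> \<real>)" using k(2) by simp
    moreover have "\<exists>m\<in>f ` \<Lambda>. \<exists>n\<in>f ` \<Lambda>. a' m \<noteq> a' n"
    proof -
      obtain c c' where "c \<in> a ` \<Lambda>" "c' \<in> a ` \<Lambda>" "c \<noteq> c'"
        using digits_not_all_equal[OF l st fin _ s(3)] s(1) unfolding set\<alpha> by auto
      then obtain i i' where i: "i \<in> \<Lambda>" "i' \<in> \<Lambda>" "a i \<noteq> a i'" by auto
      then have "a' (f i) \<noteq> a' (f i')" using l(2) by (simp add: a'_def the_inv_into_f_f[OF f])
      then show ?thesis using i by blast
    qed
    moreover have "finite (f ` \<Lambda>)" "f ` \<Lambda> \<noteq> {}" using assms(7,8) by auto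
    ultimately show ?thesis using assms(3) p' unfolding fourier_decay_off_def \<nu>2_def by blast
  qed
  then obtain C2 \<gamma> where C2: "0 < C2" "0 < \<gamma>" "\<And>\<xi>. \<xi> \<noteq> 0 \<Longrightarrow> cmod (measure_fourier \<nu>2 \<xi>) \<le> C2 * cmod \<xi> powr (- \<gamma>)"
    by blast
  note ps2 = stationary_prob_space[OF st2] and sets2 = stationary_sets[OF st2]
  obtain D2 where D2: "0 < D2" "AE x in \<nu>2. cmod x \<le> D2"
    using st2 compact_prob_cball[of \<nu>2] unfolding stationary_def by blast
  \<comment> \<open>The transform equals 1 at the origin and has Lipschitz constant
    \<open>D2\<close>, hence the radius \<open>1 / (2 * D2)\<close>.\<close>
  have near: "1 / 2 \<le> cmod (measure_fourier \<nu>2 \<eta>)" if "cmod \<eta> \<le> 1 / (2 * D2)" for \<eta>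
  proof -
    have "measure_fourier \<nu>2 0 = 1" using prob_space.prob_space[OF ps2] by (simp add: measure_fourier_def)
    then have "cmod (1 - measure_fourier \<nu>2 \<eta>) \<le> D2 * cmod \<eta>"
      using measure_fourier_lipschitz[OF ps2 sets2 D2(2), of 0 \<eta>] by simp
    also have "\<dots> \<le> D2 * (1 / (2 * D2))" using that D2(1) by (intro mult_left_mono) auto
    also have "\<dots> = 1 / 2" using D2(1) by simp
    finally show ?thesis using norm_triangle_sub[of 1 "measure_fourier \<nu>2 \<eta>"] by simp
  qed

  \<comment> \<open>The loss allowed in the correlation sums is half the decay exponent \<gamma>; it
    can be fixed only now, and with it the block length \<open>M\<close>.\<close>
  obtain M Q where MQ: "0 < M" "\<And>q z. Q \<le> q \<Longrightarrow> cmod z = 1 \<Longrightarrow>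
      proj_corr (walk k (diff_pmf w) (M * q)) (cmod k ^ (M * q)) z \<le> (cmod k ^ (M * q)) powr (1 - \<gamma> / 2)"
  proof -
    have "\<exists>M>0. \<exists>Q. \<forall>q z. Q \<le> q \<longrightarrow> cmod z = 1 \<longrightarrow>
      proj_corr (walk k (diff_pmf w) (M * q)) (cmod k ^ (M * q)) z \<le> (cmod k ^ (M * q)) powr (1 - \<gamma> / 2)"
    proof (rule proj_corr_decay[OF k finw _ j(2) _ j(1) prob])
      show "\<exists>n. cmod (((cnj k / of_real (cmod k)) ^ M) ^ n - cis x) < e" if "0 < M" "0 < e" for M x e
        unfolding k_def by (rule irrational_argument(2)[OF assms(5,6) _ that]) simp
      show "\<theta> < cmod k" using j(3) by (simp only: ck)
    qed (use C2(2) in auto)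
    then show ?thesis using that by blast
  qed
  have "\<exists>K. \<forall>z. cmod z = 1 \<longrightarrow> (\<integral>\<^sup>+t. ennreal ((cmod (measure_fourier \<nu> (of_real t * z)))\<^sup>2 * (1 + t\<^sup>2) powr (\<gamma> / 2)) \<partial>lborel) \<le> ennreal K"
  proof (rule fourier_weighted_bound[OF k finw continuous_measure_fourier[OF ps sets supp] measure_fourier_le_1[OF ps] _ _ _ _ C2 MQ])
    show "cmod (measure_fourier \<nu> \<xi>) \<le> cmod (measure_fourier (walk k w n) \<xi>) * cmod (measure_fourier (walk k v n) \<xi>)" for n \<xi>
    proof -
      have "cmod (measure_fourier \<nu> \<xi>) = cmod (measure_fourier (walk k w n) \<xi> * measure_fourier (walk k v n) \<xi>) * cmod (measure_fourier \<nu> (cnj l ^ (Suc j * n) * \<xi>))"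
        using measure_fourier_stationary[OF st fin, of \<xi> "Suc j * n"] unfolding split
        by (simp add: measure_fourier_conv finw finv norm_mult)
      also have "\<dots> \<le> cmod (measure_fourier (walk k w n) \<xi> * measure_fourier (walk k v n) \<xi>) * 1"
        by (intro mult_left_mono measure_fourier_le_1 ps) simp
      finally show ?thesis by (simp add: norm_mult)
    qed
    show "measure_fourier \<nu>2 \<xi> = measure_fourier (walk k v n) \<xi> * measure_fourier \<nu>2 (cnj k ^ n * \<xi>)" for n \<xi>
      by (rule measure_fourier_stationary[OF st2 finv])
    show "0 < 1 / (2 * D2)" using D2(1) by simp
  qed (rule near)
  \<comment> \<open>The weight exponent \<gamma> / 2 is read as twice \<gamma> / 4, to match the
    doubled exponent in \<open>sobolev_of_fourier_bound\<close>.\<close>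
  then obtain K where K: "\<And>z. cmod z = 1 \<Longrightarrow> (\<integral>\<^sup>+t. ennreal ((cmod (measure_fourier \<nu> (of_real t * z)))\<^sup>2 * (1 + t\<^sup>2) powr (2 * (\<gamma> / 4))) \<partial>lborel) \<le> ennreal K"
    by auto
  show ?thesis
  proof (intro exI conjI)
    show "0 < \<gamma> / 4" using C2(2) by simp
  qed (use sobolev_of_fourier_bound[OF ps sets supp _ K] C2(2) in auto)
qed

end
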